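(* Let $0<H<\frac12$ be such that $\frac2H$ is an integer, and let $n=\frac2H$. Let $(X_t)_{t\ge0}$ be fractional Brownian motion with Hurst parameter $H$ taking values in $\mathbf{R}^n$. Then $X$ does not have double points: $$P\left(X_s=X_t\text{ for some }s,t>0\text{ with }s\ne t\right)=0.$$
   Context: Fractional Brownian motion in $\mathbf{R}^n$ with Hurst parameter $H\in(0,1]$ is the process $(X_t)_{t\ge0}$ specified by: (1) $X_0=0$ with probability 1; (2) $X$ is a Gaussian process with stationary increments; (3) for $c>0$, $X_{ct}\stackrel{\mathcal{D}}{=}c^HX_t$ (equality in distribution as processes in $t$); (4) $X_1$ has the standard normal distribution in $\mathbf{R}^n$. The components are independent; that is, $X$ is centered Gaussian with $E[X^i_sX^j_t]=\frac{\delta_{ij}}{2}\left(s^{2H}+t^{2H}-|t-s|^{2H}\right)$. The version with continuous sample paths is used. *)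

theory Defs
  imports "HOL-Probability.Probability"
begin

text \<open>Normal laws on the line are allowed to be degenerate (point masses), as is needed for
  linear combinations of the coordinates of a Gaussian process.\<close>

definition gaussian_rv :: "'w measure \<Rightarrow> ('w \<Rightarrow> real) \<Rightarrow> bool" where
  "gaussian_rv M Y \<longleftrightarrow> Y \<in> borel_measurable M \<and>
     ((\<exists>\<mu>. AE \<omega> in M. Y \<omega> = \<mu>) \<or>
      (\<exists>\<mu> \<sigma>. 0 < \<sigma> \<and> distributed M lborel Y (\<lambda>x. ennreal (normal_density \<mu> \<sigma> x))))"

text \<open>All finite-dimensional marginals are jointly Gaussian, i.e. all linear combinations, across
  both times and coordinates, are Gaussian.\<close>

definition gaussian_process ::
    "'w measure \<Rightarrow> 't set \<Rightarrow> ('t \<Rightarrow> 'w \<Rightarrow> 'b::euclidean_space) \<Rightarrow> bool" where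
  "gaussian_process M T X \<longleftrightarrow> (\<forall>t\<in>T. X t \<in> borel_measurable M) \<and>
     (\<forall>F a. finite F \<longrightarrow> F \<subseteq> T \<longrightarrow> gaussian_rv M (\<lambda>\<omega>. \<Sum>t\<in>F. a t \<bullet> X t \<omega>))"

text \<open>Equality in distribution of processes: equality of the laws on the product
  \<open>\<sigma>\<close>-algebra, equivalently of all finite-dimensional distributions.\<close>

definition same_law ::
    "'w measure \<Rightarrow> 't set \<Rightarrow> ('t \<Rightarrow> 'w \<Rightarrow> 'b::topological_space) \<Rightarrow> ('t \<Rightarrow> 'w \<Rightarrow> 'b) \<Rightarrow> bool" where
  "same_law M T X Y \<longleftrightarrow>
     distr M (Pi\<^sub>M T (\<lambda>_. borel)) (\<lambda>\<omega>. \<lambda>t\<in>T. X t \<omega>) =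
     distr M (Pi\<^sub>M T (\<lambda>_. borel)) (\<lambda>\<omega>. \<lambda>t\<in>T. Y t \<omega>)"

text \<open>Only the times \<open>t \<ge> 0\<close> are meaningful; \<open>X\<close> is unconstrained at negative times.\<close>

locale fractional_brownian_motion = prob_space M
  for M :: "'w measure" and H :: real and X :: "real \<Rightarrow> 'w \<Rightarrow> real ^ 'n" +
  assumes Hurst_parameter: "0 < H" "H \<le> 1"
    and start_zero: "AE \<omega> in M. X 0 \<omega> = 0"
    and gaussian: "gaussian_process M {0..} X"
    and stationary_increments:
      "\<And>h. 0 \<le> h \<Longrightarrow> same_law M {0..} (\<lambda>t \<omega>. X (t + h) \<omega> - X h \<omega>) (\<lambda>t \<omega>. X t \<omega> - X 0 \<omega>)"
    and self_similar:
      "\<And>c. 0 < c \<Longrightarrow> same_law M {0..} (\<lambda>t \<omega>. X (c * t) \<omega>) (\<lambda>t \<omega>. (c powr H) *\<^sub>R X t \<omega>)"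
    and standard_normal:
      "distributed M lborel (X 1) (\<lambda>x. ennreal (\<Prod>i\<in>UNIV. std_normal_density (x $ i)))"
    and independent_components:
      "indep_vars (\<lambda>_. Pi\<^sub>M {0..} (\<lambda>_. borel)) (\<lambda>i \<omega>. \<lambda>t\<in>{0..}. X t \<omega> $ i) UNIV"
    and continuous_paths: "\<And>\<omega>. \<omega> \<in> space M \<Longrightarrow> continuous_on {0..} (\<lambda>t. X t \<omega>)"
begin

lemma measurable_X: "0 \<le> t \<Longrightarrow> X t \<in> borel_measurable M"
  using gaussian by (auto simp: gaussian_process_def)

lemma measurable_X_component: "0 \<le> t \<Longrightarrow> (\<lambda>\<omega>. X t \<omega> $ i) \<in> borel_measurable M"
  using measurable_X[of t] by (rule measurable_compose) (auto intro!: borel_measurable_continuous_onI continuous_intros)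

lemma same_law_at:
  fixes Y Z :: "real \<Rightarrow> 'w \<Rightarrow> real ^ 'n"
  assumes "same_law M {0..} Y Z" "0 \<le> t"
    and Y: "\<And>t. 0 \<le> t \<Longrightarrow> Y t \<in> borel_measurable M"
    and Z: "\<And>t. 0 \<le> t \<Longrightarrow> Z t \<in> borel_measurable M"
  shows "distr M borel (Y t) = distr M borel (Z t)"
proof -
  let ?P = "Pi\<^sub>M {0::real..} (\<lambda>_. borel :: (real^'n) measure)"
  have ev: "(\<lambda>f. f t) \<in> measurable ?P borel"
    using assms(2) by (intro measurable_component_singleton) auto
  have mY: "(\<lambda>\<omega>. \<lambda>t\<in>{0..}. Y t \<omega>) \<in> measurable M ?P"
    using Y by (intro measurable_restrict) auto
  have mZ: "(\<lambda>\<omega>. \<lambda>t\<in>{0..}. Z t \<omega>) \<in> measurable M ?P"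
    using Z by (intro measurable_restrict) auto
  have "distr (distr M ?P (\<lambda>\<omega>. \<lambda>t\<in>{0..}. Y t \<omega>)) borel (\<lambda>f. f t) =
        distr (distr M ?P (\<lambda>\<omega>. \<lambda>t\<in>{0..}. Z t \<omega>)) borel (\<lambda>f. f t)"
    using assms(1) by (simp add: same_law_def)
  then show ?thesis
    using assms(2) by (simp add: distr_distr[OF ev mY] distr_distr[OF ev mZ] comp_def)
qed

lemma prod_Basis_vec:
  fixes f :: "real ^ 'n \<Rightarrow> ennreal"
  shows "(\<Prod>b\<in>Basis. f b) = (\<Prod>j\<in>UNIV. f (axis j 1))"
proof -
  have "Basis = range (\<lambda>j::'n. axis j (1::real))"
    by (auto simp: Basis_vec_def)
  moreover have "inj (\<lambda>j::'n. axis j (1::real))"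
    by (auto simp: inj_def axis_eq_axis)
  ultimately show ?thesis
    using prod.reindex[of "\<lambda>j::'n. axis j (1::real)" UNIV f] by (simp add: comp_def)
qed

lemma component_1_standard_normal:
  "distributed M lborel (\<lambda>\<omega>. X 1 \<omega> $ i) (\<lambda>x. ennreal (std_normal_density x))"
proof -
  let ?d = "\<lambda>x::real^'n. ennreal (\<Prod>j\<in>UNIV. std_normal_density (x $ j))"
  have comp[measurable]: "(\<lambda>x::real^'n. x $ k) \<in> borel_measurable borel" for k
    by (intro borel_measurable_continuous_onI continuous_intros)
  have m[measurable]: "(\<lambda>\<omega>. X 1 \<omega> $ i) \<in> borel_measurable M"
    by (rule measurable_X_component) simp
  have "emeasure (distr M lborel (\<lambda>\<omega>. X 1 \<omega> $ i)) A =
        emeasure (density lborel (\<lambda>x. ennreal (std_normal_density x))) A"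
    if "A \<in> sets lborel" for A :: "real set"
  proof -
    have A[measurable]: "A \<in> sets borel" using that by simp
    define g where "g = (\<lambda>(b::real^'n) (x::real).
      ennreal (std_normal_density x) * (if b = axis i 1 then indicator A x else 1))"
    have gm: "g b \<in> borel_measurable borel" for b
      unfolding g_def by measurable
    have one: "(\<integral>\<^sup>+x. ennreal (std_normal_density x) \<partial>lborel) = 1"
      using prob_space.emeasure_space_1[OF prob_space_normal_density[of 1 0]]
      by (simp add: emeasure_density)
    have "emeasure (distr M lborel (\<lambda>\<omega>. X 1 \<omega> $ i)) A = (\<integral>\<^sup>+\<omega>. indicator A (X 1 \<omega> $ i) \<partial>M)"
    proof -
      have "emeasure (distr M lborel (\<lambda>\<omega>. X 1 \<omega> $ i)) A =
          (\<integral>\<^sup>+x. indicator A x \<partial>distr M lborel (\<lambda>\<omega>. X 1 \<omega> $ i))"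
        using that by (intro nn_integral_indicator[symmetric]) simp
      also have "\<dots> = (\<integral>\<^sup>+\<omega>. indicator A (X 1 \<omega> $ i) \<partial>M)"
        by (rule nn_integral_distr) auto
      finally show ?thesis .
    qed
    also have "\<dots> = (\<integral>\<^sup>+x. ?d x * indicator A (x $ i) \<partial>lborel)"
      by (rule distributed_nn_integral[OF standard_normal, symmetric]) simp
    also have "\<dots> = (\<integral>\<^sup>+x. (\<Prod>b\<in>Basis. g b (x \<bullet> b)) \<partial>lborel)"
    proof (rule nn_integral_cong)
      fix x :: "real^'n"
      have "(\<Prod>b\<in>Basis. g b (x \<bullet> b)) = (\<Prod>j\<in>UNIV. g (axis j 1) (x $ j))"
        by (simp add: prod_Basis_vec inner_axis)
      also have "\<dots> = (\<Prod>j\<in>UNIV. ennreal (std_normal_density (x $ j))) *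
          (\<Prod>j\<in>UNIV. if j = i then indicator A (x $ j) else 1)"
        by (simp add: g_def prod.distrib axis_eq_axis)
      also have "\<dots> = ?d x * indicator A (x $ i)"
        by (simp add: prod_ennreal)
      finally show "?d x * indicator A (x $ i) = (\<Prod>b\<in>Basis. g b (x \<bullet> b))" by simp
    qed
    also have "\<dots> = (\<Prod>b\<in>Basis. (\<integral>\<^sup>+x. g b x \<partial>lborel))"
      by (rule nn_integral_lborel_prod) (auto intro: gm)
    also have "\<dots> = (\<Prod>j\<in>UNIV. if j = i then (\<integral>\<^sup>+x. ennreal (std_normal_density x) * indicator A x \<partial>lborel) else 1)"
      unfolding prod_Basis_vec by (rule prod.cong) (auto simp: g_def one axis_eq_axis)
    also have "\<dots> = emeasure (density lborel (\<lambda>x. ennreal (std_normal_density x))) A"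
      by (simp add: emeasure_density)
    finally show ?thesis .
  qed
  then have "distr M lborel (\<lambda>\<omega>. X 1 \<omega> $ i) = density lborel (\<lambda>x. ennreal (std_normal_density x))"
    by (intro measure_eqI) auto
  then show ?thesis by (simp add: distributed_def)
qed

lemma component_1_moments:
  "integrable M (\<lambda>\<omega>. X 1 \<omega> $ i)" "expectation (\<lambda>\<omega>. X 1 \<omega> $ i) = 0"
  "integrable M (\<lambda>\<omega>. (X 1 \<omega> $ i)\<^sup>2)" "expectation (\<lambda>\<omega>. (X 1 \<omega> $ i)\<^sup>2) = 1"
proof -
  note D = component_1_standard_normal[of i]
  show 1: "integrable M (\<lambda>\<omega>. X 1 \<omega> $ i)"
    using distributed_integrable[OF D, of "\<lambda>x. x"] integrable_std_normal_moment[of 1] by simp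
  show 2: "expectation (\<lambda>\<omega>. X 1 \<omega> $ i) = 0"
    by (rule standard_normal_distributed_expectation[OF D])
  show "integrable M (\<lambda>\<omega>. (X 1 \<omega> $ i)\<^sup>2)"
    using distributed_integrable[OF D, of "\<lambda>x. x\<^sup>2"] integrable_std_normal_moment[of 2] by simp
  show "expectation (\<lambda>\<omega>. (X 1 \<omega> $ i)\<^sup>2) = 1"
    using standard_normal_distributed_variance[OF D] 2 by simp
qed

lemma distr_integral_transfer:
  fixes Y Z :: "'w \<Rightarrow> real ^ 'n" and g :: "real ^ 'n \<Rightarrow> real"
  assumes "distr M borel Y = distr M borel Z"
    and Y: "Y \<in> borel_measurable M" and Z: "Z \<in> borel_measurable M" and g: "g \<in> borel_measurable borel"
  shows "integrable M (\<lambda>\<omega>. g (Y \<omega>)) \<longleftrightarrow> integrable M (\<lambda>\<omega>. g (Z \<omega>))"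
    and "expectation (\<lambda>\<omega>. g (Y \<omega>)) = expectation (\<lambda>\<omega>. g (Z \<omega>))"
  using integrable_distr_eq[OF Y g] integrable_distr_eq[OF Z g] integral_distr[OF Y g]
    integral_distr[OF Z g] assms(1) by simp_all

lemma increment_distr:
  assumes "0 \<le> s" "s < t"
  shows "distr M borel (\<lambda>\<omega>. X t \<omega> - X s \<omega>) = distr M borel (\<lambda>\<omega>. ((t - s) powr H) *\<^sub>R X 1 \<omega>)"
proof -
  have "distr M borel (\<lambda>\<omega>. X ((t - s) + s) \<omega> - X s \<omega>) = distr M borel (\<lambda>\<omega>. X (t - s) \<omega> - X 0 \<omega>)"
    using assms measurable_X
    by (intro same_law_at[OF stationary_increments]) (auto intro!: borel_measurable_diff)
  also have "\<dots> = distr M borel (X (t - s))"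
    using start_zero assms measurable_X[of "t - s"] measurable_X[of 0]
    by (intro distr_cong_AE) (auto intro!: borel_measurable_diff)
  also have "\<dots> = distr M borel (\<lambda>\<omega>. ((t - s) powr H) *\<^sub>R X 1 \<omega>)"
    using same_law_at[OF self_similar[of "t - s"], of 1] assms measurable_X
    by (auto intro!: borel_measurable_scaleR)
  finally show ?thesis by simp
qed

lemma increment_moments:
  assumes "0 \<le> s" "s < t"
  shows "integrable M (\<lambda>\<omega>. X t \<omega> $ i - X s \<omega> $ i)"
    and "expectation (\<lambda>\<omega>. X t \<omega> $ i - X s \<omega> $ i) = 0"
    and "integrable M (\<lambda>\<omega>. (X t \<omega> $ i - X s \<omega> $ i)\<^sup>2)"
    and "expectation (\<lambda>\<omega>. (X t \<omega> $ i - X s \<omega> $ i)\<^sup>2) = (t - s) powr (2 * H)"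
proof -
  have mY: "(\<lambda>\<omega>. X t \<omega> - X s \<omega>) \<in> borel_measurable M"
    using assms measurable_X by (intro borel_measurable_diff) auto
  have mZ: "(\<lambda>\<omega>. ((t - s) powr H) *\<^sub>R X 1 \<omega>) \<in> borel_measurable M"
    using measurable_X by (intro borel_measurable_scaleR) auto
  have g1: "(\<lambda>x::real^'n. x $ i) \<in> borel_measurable borel"
    and g2: "(\<lambda>x::real^'n. (x $ i)\<^sup>2) \<in> borel_measurable borel"
    by (intro borel_measurable_continuous_onI continuous_intros)+
  note T1 = distr_integral_transfer[OF increment_distr[OF assms] mY mZ g1]
  note T2 = distr_integral_transfer[OF increment_distr[OF assms] mY mZ g2]
  have p: "((t - s) powr H)\<^sup>2 = (t - s) powr (2 * H)"
    by (simp add: power2_eq_square flip: powr_add)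
  show "integrable M (\<lambda>\<omega>. X t \<omega> $ i - X s \<omega> $ i)"
    and "expectation (\<lambda>\<omega>. X t \<omega> $ i - X s \<omega> $ i) = 0"
    using T1 component_1_moments[of i] by (auto simp: power_mult_distrib)
  show "integrable M (\<lambda>\<omega>. (X t \<omega> $ i - X s \<omega> $ i)\<^sup>2)"
    and "expectation (\<lambda>\<omega>. (X t \<omega> $ i - X s \<omega> $ i)\<^sup>2) = (t - s) powr (2 * H)"
    using T2 component_1_moments[of i] by (auto simp: power_mult_distrib p)
qed

lemma moments:
  assumes "0 \<le> t"
  shows "integrable M (\<lambda>\<omega>. X t \<omega> $ i)" "expectation (\<lambda>\<omega>. X t \<omega> $ i) = 0"
    "integrable M (\<lambda>\<omega>. (X t \<omega> $ i)\<^sup>2)" "expectation (\<lambda>\<omega>. (X t \<omega> $ i)\<^sup>2) = t powr (2 * H)"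
proof -
  have "integrable M (\<lambda>\<omega>. X t \<omega> $ i) \<and> expectation (\<lambda>\<omega>. X t \<omega> $ i) = 0 \<and>
    integrable M (\<lambda>\<omega>. (X t \<omega> $ i)\<^sup>2) \<and> expectation (\<lambda>\<omega>. (X t \<omega> $ i)\<^sup>2) = t powr (2 * H)"
  proof (cases "t = 0")
    case True
    have z: "AE \<omega> in M. X 0 \<omega> $ i = 0" "AE \<omega> in M. (X 0 \<omega> $ i)\<^sup>2 = 0"
      using start_zero by (auto elim: eventually_mono)
    have m: "(\<lambda>\<omega>. X 0 \<omega> $ i) \<in> borel_measurable M" by (rule measurable_X_component) simp
    then have m2: "(\<lambda>\<omega>. (X 0 \<omega> $ i)\<^sup>2) \<in> borel_measurable M" by simp
    show ?thesis
      using True integrable_cong_AE[OF m _ z(1)] integrable_cong_AE[OF m2 _ z(2)]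
        integral_cong_AE[OF m _ z(1)] integral_cong_AE[OF m2 _ z(2)] by simp
  next
    case False
    with assms have t: "0 < t" by simp
    have m: "(\<lambda>\<omega>. X t \<omega> $ i) \<in> borel_measurable M" "(\<lambda>\<omega>. X 0 \<omega> $ i) \<in> borel_measurable M"
      using assms by (auto intro: measurable_X_component)
    have z: "AE \<omega> in M. X t \<omega> $ i - X 0 \<omega> $ i = X t \<omega> $ i"
      "AE \<omega> in M. (X t \<omega> $ i - X 0 \<omega> $ i)\<^sup>2 = (X t \<omega> $ i)\<^sup>2"
      using start_zero by (auto elim: eventually_mono)
    show ?thesis
      using increment_moments[OF _ t, of i] m
        integrable_cong_AE[OF _ _ z(1)] integrable_cong_AE[OF _ _ z(2)]
        integral_cong_AE[OF _ _ z(1)] integral_cong_AE[OF _ _ z(2)] by simp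
  qed
  then show "integrable M (\<lambda>\<omega>. X t \<omega> $ i)" "expectation (\<lambda>\<omega>. X t \<omega> $ i) = 0"
    "integrable M (\<lambda>\<omega>. (X t \<omega> $ i)\<^sup>2)" "expectation (\<lambda>\<omega>. (X t \<omega> $ i)\<^sup>2) = t powr (2 * H)"
    by auto
qed

lemma increment_second_moment:
  assumes "0 \<le> s" "0 \<le> t"
  shows "integrable M (\<lambda>\<omega>. (X t \<omega> $ i - X s \<omega> $ i)\<^sup>2)"
    and "expectation (\<lambda>\<omega>. (X t \<omega> $ i - X s \<omega> $ i)\<^sup>2) = \<bar>t - s\<bar> powr (2 * H)"
proof -
  have "integrable M (\<lambda>\<omega>. (X t \<omega> $ i - X s \<omega> $ i)\<^sup>2) \<and>
    expectation (\<lambda>\<omega>. (X t \<omega> $ i - X s \<omega> $ i)\<^sup>2) = \<bar>t - s\<bar> powr (2 * H)"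
    using increment_moments(3,4)[of s t i] increment_moments(3,4)[of t s i] assms
    by (cases s t rule: linorder_cases) (auto simp: power2_commute[of "X t _ $ i"])
  then show "integrable M (\<lambda>\<omega>. (X t \<omega> $ i - X s \<omega> $ i)\<^sup>2)"
    and "expectation (\<lambda>\<omega>. (X t \<omega> $ i - X s \<omega> $ i)\<^sup>2) = \<bar>t - s\<bar> powr (2 * H)" by auto
qed

lemma indep_components_at:
  assumes "0 \<le> s" "0 \<le> t" "i \<noteq> j"
  shows "indep_var borel (\<lambda>\<omega>. X s \<omega> $ i) borel (\<lambda>\<omega>. X t \<omega> $ j)"
proof -
  let ?P = "\<lambda>_::'n. Pi\<^sub>M {0::real..} (\<lambda>_. borel :: real measure)"
  have "indep_vars (\<lambda>_. borel) (\<lambda>k \<omega>. (\<lambda>t\<in>{0..}. X t \<omega> $ k) (if k = i then s else t)) UNIV"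
    by (rule indep_vars_compose2[OF independent_components])
      (use assms in \<open>auto intro!: measurable_component_singleton\<close>)
  from indep_vars_sum[of "{j}" i, OF _ _ indep_vars_subset[OF this]] show ?thesis
    using assms by simp
qed

theorem covariance:
  assumes "0 \<le> s" "0 \<le> t"
  shows "expectation (\<lambda>\<omega>. X s \<omega> $ i * X t \<omega> $ j) =
    (if i = j then 1 else 0) / 2 * (s powr (2 * H) + t powr (2 * H) - \<bar>t - s\<bar> powr (2 * H))"
proof (cases "i = j")
  case True
  have "expectation (\<lambda>\<omega>. X s \<omega> $ i * X t \<omega> $ i) =
    expectation (\<lambda>\<omega>. ((X s \<omega> $ i)\<^sup>2 + (X t \<omega> $ i)\<^sup>2 - (X t \<omega> $ i - X s \<omega> $ i)\<^sup>2) / 2)"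
    by (intro Bochner_Integration.integral_cong) (auto simp: power2_eq_square algebra_simps)
  also have "\<dots> = (s powr (2 * H) + t powr (2 * H) - \<bar>t - s\<bar> powr (2 * H)) / 2"
    using moments[of s i] moments[of t i] increment_second_moment[of s t i] assms by simp
  finally show ?thesis using True by simp
next
  case False
  then show ?thesis
    using indep_var_lebesgue_integral[OF indep_components_at[of s t i j]] moments assms by simp
qed

end

end

theory Submission
  imports Defs
begin

text \<open>A scaling argument in the spirit of Levy. Let \<open>\<alpha> K\<close> be the expected Lebesgue measure of
  \<open>{X s - X t | s \<in> [0,1], t \<in> [K,K+1]}\<close>. Since \<open>n H = 2\<close>, the same set for \<open>[0,N] \<times> [N K,N K+N]\<close>
  has expected measure \<open>N\<^sup>2 \<alpha> K\<close>, while it is covered by the \<open>N\<^sup>2\<close> sets belonging to the unit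
  squares, each of expected measure at most \<open>A = sup \<alpha>\<close>. Hence if \<open>\<alpha> K\<close> is close to \<open>A\<close>, the sets
  of any two unit squares hardly overlap. The law of \<open>X\<close> is quasi-invariant under shifts by
  \<open>h v\<close> for a trapezoidal bump \<open>h\<close>, so the sets of two squares hardly overlap even after translating one
  of them by any fixed \<open>v\<close>, and integrating over \<open>v\<close> shows that the product of their measures has
  small expectation. Using arbitrarily many squares and a uniform second moment bound, \<open>A = 0\<close>.
  So for almost every \<open>v\<close> the value \<open>v\<close> is almost surely not of the form \<open>X s - X t\<close>, and a
  last shift by a bump times \<open>v\<close> moves \<open>v\<close> to \<open>0\<close>.\<close>

section \<open>Determination of finite-dimensional laws by linear combinations\<close>

text \<open>The relation n H = 2 balances scaling against covering exactly: counting small squares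
  gives a bounded but not a vanishing estimate, and only near-equality in subadditivity can be
  exploited. The supremum A supplies it without being attained: if \<open>K\<close> satisfies
  \<alpha> \<open>K\<close> > A - \<delta>, every unit square of its N by N block is nearly
  extremal. The order of choices shapes the bounds. The number k of squares, N, the radius R, the
  shift tolerance l and then \<delta> are fixed before \<open>K\<close>, so oscillations, second
  moments and the truncation radius must be controlled uniformly in the position of the second
  interval. The assumption H < 1/2 makes the mixture representation of the covariance converge, and
  this puts the bump into the Cameron-Martin space. Quasi-invariance is used only in the form
  P(shifted event) <= P(event) / (2 l) + l exp(S) / 2 for every l > 0, which needs no density on
  path space and survives the monotone limits that lead from finitely many times to whole
  paths.\<close>

lemma weighted_Levy_uniqueness:
  fixes Y1 :: "'a \<Rightarrow> real" and Y2 :: "'b \<Rightarrow> real" and w1 :: "'a \<Rightarrow> real" and w2 :: "'b \<Rightarrow> real"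
  assumes [measurable]: "Y1 \<in> borel_measurable M1" "Y2 \<in> borel_measurable M2" "B \<in> sets borel"
    and w1: "integrable M1 w1" "\<And>x. 0 \<le> w1 x"
    and w2: "integrable M2 w2" "\<And>x. 0 \<le> w2 x"
    and eq: "\<And>b. (CLINT x|M1. w1 x *\<^sub>R iexp (b * Y1 x)) = (CLINT x|M2. w2 x *\<^sub>R iexp (b * Y2 x))"
  shows "(LINT x|M1. w1 x * indicator B (Y1 x)) = (LINT x|M2. w2 x * indicator B (Y2 x))"
proof -
  have [measurable]: "w1 \<in> borel_measurable M1" "w2 \<in> borel_measurable M2"
    using w1 w2 by auto
  define c where "c = (LINT x|M1. w1 x)"
  have c2: "c = (LINT x|M2. w2 x)"
  proof -
    have "complex_of_real (LINT x|M1. w1 x) = of_real (LINT x|M2. w2 x)"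
      using eq[of 0] by (simp add: scaleR_conv_of_real)
    then show ?thesis by (simp add: c_def)
  qed
  show ?thesis
  proof (cases "c = 0")
    case True
    have "AE x in M1. w1 x = 0" "AE x in M2. w2 x = 0"
      using integral_nonneg_eq_0_iff_AE[OF w1(1)] integral_nonneg_eq_0_iff_AE[OF w2(1)] w1 w2 True c2 c_def by auto
    then have "(LINT x|M1. w1 x * indicator B (Y1 x)) = 0" "(LINT x|M2. w2 x * indicator B (Y2 x)) = 0"
      by (auto intro!: integral_eq_zero_AE)
    then show ?thesis by simp
  next
    case False
    have "c \<ge> 0" unfolding c_def using w1 by simp
    with False have c: "c > 0" by simp
    \<comment> \<open>Tilting by \<open>w / c\<close> turns the weighted integrals into the law of
      \<open>Y\<close> under a probability measure, to which Levy's uniqueness theorem applies. The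
      two total masses agree by the case \<open>b = 0\<close>.\<close>
    have main: "real_distribution (distr (density M (\<lambda>x. ennreal (w x / c))) borel Y)"
        "char (distr (density M (\<lambda>x. ennreal (w x / c))) borel Y) b = (CLINT x|M. w x *\<^sub>R iexp (b * Y x)) / c"
        "measure (distr (density M (\<lambda>x. ennreal (w x / c))) borel Y) B = (LINT x|M. w x * indicator B (Y x)) / c"
      if [measurable]: "Y \<in> borel_measurable M" and w: "integrable M w" "\<And>x. 0 \<le> w x" "c = (LINT x|M. w x)"
      for b and M :: "'c measure" and Y :: "'c \<Rightarrow> real" and w
    proof -
      have [measurable]: "w \<in> borel_measurable M" using w by auto
      let ?D = "density M (\<lambda>x. ennreal (w x / c))"
      have "(\<integral>\<^sup>+x. ennreal (w x / c) \<partial>M) = ennreal (LINT x|M. w x / c)"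
        using w c by (intro nn_integral_eq_integral) auto
      also have "\<dots> = 1" using w c by simp
      finally have e: "(\<integral>\<^sup>+x. ennreal (w x / c) \<partial>M) = 1" .
      interpret D: prob_space ?D
        by (rule prob_spaceI) (simp add: emeasure_density e cong: nn_integral_cong)
      show 1: "real_distribution (distr ?D borel Y)"
        using D.prob_space_distr[of Y borel] by (auto simp: real_distribution_def real_distribution_axioms_def)
      have "char (distr ?D borel Y) b = (CLINT x|?D. iexp (b * Y x))"
        unfolding char_def by (subst integral_distr) auto
      also have "\<dots> = (CLINT x|M. (w x / c) *\<^sub>R iexp (b * Y x))"
        using w c by (subst integral_density) auto
      also have "\<dots> = (CLINT x|M. (w x *\<^sub>R iexp (b * Y x)) / c)"
        by (simp add: scaleR_conv_of_real)
      finally show "char (distr ?D borel Y) b = (CLINT x|M. w x *\<^sub>R iexp (b * Y x)) / c"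
        by (simp add: scaleR_conv_of_real)
      interpret R: real_distribution "distr ?D borel Y" by (rule 1)
      have "measure (distr ?D borel Y) B = (LINT x|distr ?D borel Y. indicator B x)"
        by simp
      also have "\<dots> = (LINT x|?D. indicator B (Y x))"
        by (subst integral_distr) auto
      also have "\<dots> = (LINT x|M. (w x / c) *\<^sub>R indicator B (Y x))"
        using w c by (subst integral_density) auto
      finally show "measure (distr ?D borel Y) B = (LINT x|M. w x * indicator B (Y x)) / c"
        by simp
    qed
    note m1 = main[OF assms(1) w1 c_def] and m2 = main[OF assms(2) w2 c2]
    have "distr (density M1 (\<lambda>x. ennreal (w1 x / c))) borel Y1 = distr (density M2 (\<lambda>x. ennreal (w2 x / c))) borel Y2"
      by (rule Levy_uniqueness[OF m1(1) m2(1)]) (simp only: fun_eq_iff m1(2) m2(2) eq simp_thms)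
    with m1(3) m2(3) c show ?thesis by auto
  qed
qed


text \<open>Levy uniqueness allows only nonnegative weights, so the complex weight
  \<open>iexp (th x)\<close> is assembled from the weights 1, 1 + cos and 1 + sin. Each of them,
  times \<open>iexp (b * Y x)\<close>, is a combination of the hypothesis for \<open>a\<close> equal
  to 0, 1 and -1.\<close>

lemma weighted_Levy_uniqueness_iexp:
  fixes Y1 :: "'a \<Rightarrow> real" and Y2 :: "'b \<Rightarrow> real" and p1 th1 :: "'a \<Rightarrow> real" and p2 th2 :: "'b \<Rightarrow> real"
  assumes m1[measurable]: "Y1 \<in> borel_measurable M1" "th1 \<in> borel_measurable M1"
    and m2[measurable]: "Y2 \<in> borel_measurable M2" "th2 \<in> borel_measurable M2"
    and B[measurable]: "B \<in> sets borel"
    and p1: "integrable M1 p1" "\<And>x. 0 \<le> p1 x"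
    and p2: "integrable M2 p2" "\<And>x. 0 \<le> p2 x"
    and eq: "\<And>a b. (CLINT x|M1. p1 x *\<^sub>R iexp (a * th1 x + b * Y1 x)) =
      (CLINT x|M2. p2 x *\<^sub>R iexp (a * th2 x + b * Y2 x))"
  shows "(CLINT x|M1. (p1 x * indicator B (Y1 x)) *\<^sub>R iexp (th1 x)) =
    (CLINT x|M2. (p2 x * indicator B (Y2 x)) *\<^sub>R iexp (th2 x))"
proof -
  have I: "integrable M (\<lambda>x. p x *\<^sub>R f x)" "integrable M (\<lambda>x. p x * g x)"
    if p: "integrable M p" and f: "f \<in> borel_measurable M" "\<And>x. cmod (f x) \<le> 2"
      and g: "g \<in> borel_measurable M" "\<And>x. \<bar>g x\<bar> \<le> 2"
    for M :: "'c measure" and p and f :: "'c \<Rightarrow> complex" and g :: "'c \<Rightarrow> real"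
  proof -
    have [measurable]: "p \<in> borel_measurable M" using p by auto
    have i2: "integrable M (\<lambda>x. 2 * p x)" using p by auto
    show "integrable M (\<lambda>x. p x *\<^sub>R f x)"
      by (rule Bochner_Integration.integrable_bound[OF i2])
        (use f in \<open>auto simp: abs_mult mult.commute[of _ "\<bar>p _\<bar>"] intro!: mult_left_mono\<close>)
    show "integrable M (\<lambda>x. p x * g x)"
      by (rule Bochner_Integration.integrable_bound[OF i2])
        (use g in \<open>auto simp: abs_mult mult.commute[of _ "\<bar>p _\<bar>"] intro!: mult_left_mono\<close>)
  qed
  have i1: "integrable M1 (\<lambda>x. p1 x *\<^sub>R iexp (a * th1 x + b * Y1 x))" for a b
    by (rule I(1)[OF p1(1), of _ "\<lambda>_. 0"]) auto
  have i2: "integrable M2 (\<lambda>x. p2 x *\<^sub>R iexp (a * th2 x + b * Y2 x))" for a b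
    by (rule I(1)[OF p2(1), of _ "\<lambda>_. 0"]) auto
  have lin3: "(CLINT x|M. f x + c * g x + d * h x) = (CLINT x|M. f x) + c * (CLINT x|M. g x) + d * (CLINT x|M. h x)"
    if "integrable M f" "integrable M g" "integrable M h" for M :: "'c measure" and f g h :: "'c \<Rightarrow> complex" and c d
    using that by simp
  have trig: "(LINT x|M1. p1 x * (1 + f (th1 x)) * indicator B (Y1 x)) = (LINT x|M2. p2 x * (1 + f (th2 x)) * indicator B (Y2 x))"
    if f: "\<And>t b::real. (1 + f t) *\<^sub>R iexp b = iexp (0 * t + b) + c * iexp (1 * t + b) + d * iexp (-1 * t + b)"
      and fm[measurable]: "f \<in> borel_measurable borel" and fb: "\<And>t. \<bar>f t\<bar> \<le> 1" for f :: "real \<Rightarrow> real" and c d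
  proof (rule weighted_Levy_uniqueness)
    have fb': "-1 \<le> f t" "f t \<le> 1" for t using fb[of t] by auto
    then have "\<bar>1 + f t\<bar> \<le> 2" for t using fb'[of t] by linarith
    then show "integrable M1 (\<lambda>x. p1 x * (1 + f (th1 x)))" "integrable M2 (\<lambda>x. p2 x * (1 + f (th2 x)))"
      using I(2)[OF p1(1), of "\<lambda>_. 0" "\<lambda>x. 1 + f (th1 x)"] I(2)[OF p2(1), of "\<lambda>_. 0" "\<lambda>x. 1 + f (th2 x)"]
      by auto
    show "0 \<le> p1 x * (1 + f (th1 x))" "0 \<le> p2 y * (1 + f (th2 y))" for x y
      using p1 p2 fb'[of "th1 x"] fb'[of "th2 y"] by auto
    fix b
    have e: "(p * (1 + f t)) *\<^sub>R iexp y = p *\<^sub>R iexp (0 * t + y) + c * (p *\<^sub>R iexp (1 * t + y)) + d * (p *\<^sub>R iexp (-1 * t + y))" for p t y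
      unfolding scaleR_scaleR[symmetric] f by (simp add: scaleR_conv_of_real algebra_simps)
    have "(CLINT x|M1. (p1 x * (1 + f (th1 x))) *\<^sub>R iexp (b * Y1 x)) =
      (CLINT x|M1. p1 x *\<^sub>R iexp (0 * th1 x + b * Y1 x)) + c * (CLINT x|M1. p1 x *\<^sub>R iexp (1 * th1 x + b * Y1 x))
       + d * (CLINT x|M1. p1 x *\<^sub>R iexp (-1 * th1 x + b * Y1 x))"
      unfolding e by (rule lin3[OF i1 i1 i1])
    moreover have "(CLINT x|M2. (p2 x * (1 + f (th2 x))) *\<^sub>R iexp (b * Y2 x)) =
      (CLINT x|M2. p2 x *\<^sub>R iexp (0 * th2 x + b * Y2 x)) + c * (CLINT x|M2. p2 x *\<^sub>R iexp (1 * th2 x + b * Y2 x))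
       + d * (CLINT x|M2. p2 x *\<^sub>R iexp (-1 * th2 x + b * Y2 x))"
      unfolding e by (rule lin3[OF i2 i2 i2])
    ultimately show "(CLINT x|M1. (p1 x * (1 + f (th1 x))) *\<^sub>R iexp (b * Y1 x)) = (CLINT x|M2. (p2 x * (1 + f (th2 x))) *\<^sub>R iexp (b * Y2 x))"
      by (simp only: eq)
  qed auto
  have zero: "(LINT x|M1. p1 x * (1 + (\<lambda>_. 0) (th1 x)) * indicator B (Y1 x)) = (LINT x|M2. p2 x * (1 + (\<lambda>_. 0) (th2 x)) * indicator B (Y2 x))"
    by (rule trig[of "\<lambda>_. 0" 0 0]) (auto simp: scaleR_conv_of_real)
  have cos: "(LINT x|M1. p1 x * (1 + cos (th1 x)) * indicator B (Y1 x)) = (LINT x|M2. p2 x * (1 + cos (th2 x)) * indicator B (Y2 x))"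
    by (rule trig[of cos "1/2" "1/2"]) (unfold cis_conv_exp[symmetric], auto simp: cos_add sin_add cos_diff sin_diff complex_eq_iff field_simps)
  have sin: "(LINT x|M1. p1 x * (1 + sin (th1 x)) * indicator B (Y1 x)) = (LINT x|M2. p2 x * (1 + sin (th2 x)) * indicator B (Y2 x))"
    by (rule trig[of sin "-\<i>/2" "\<i>/2"]) (unfold cis_conv_exp[symmetric], auto simp: cos_add sin_add cos_diff sin_diff complex_eq_iff field_simps)
  have J: "integrable M (\<lambda>x. p x * indicator B (Y x))" "integrable M (\<lambda>x. p x * indicator B (Y x) * sin (th x))" "integrable M (\<lambda>x. p x * indicator B (Y x) * cos (th x))"
    if [measurable]: "Y \<in> borel_measurable M" "th \<in> borel_measurable M" and p: "integrable M p"
    for M :: "'c measure" and p and th Y :: "'c \<Rightarrow> real"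
  proof -
    have [measurable]: "p \<in> borel_measurable M" using p by auto
    have i: "integrable M (\<lambda>x. p x * indicator B (Y x) * g (th x))" if [measurable]: "g \<in> borel_measurable borel" and g: "\<And>t. \<bar>g t\<bar> \<le> 1" for g :: "real \<Rightarrow> real"
    proof -
      have "\<bar>indicator B (Y x) * g (th x)\<bar> \<le> 2" for x
        using g[of "th x"] by (auto simp: indicator_def)
      then show ?thesis
        using I(2)[OF p, of "\<lambda>_. 0" "\<lambda>x. indicator B (Y x) * g (th x)"] by (simp add: mult.assoc)
    qed
    show "integrable M (\<lambda>x. p x * indicator B (Y x))" using i[of "\<lambda>_. 1"] by simp
    show "integrable M (\<lambda>x. p x * indicator B (Y x) * sin (th x))" using i[of sin] by simp
    show "integrable M (\<lambda>x. p x * indicator B (Y x) * cos (th x))" using i[of cos] by simp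
  qed
  have split: "(CLINT x|M. (p x * indicator B (Y x)) *\<^sub>R iexp (th x)) =
     of_real ((LINT x|M. p x * (1 + cos (th x)) * indicator B (Y x)) - (LINT x|M. p x * (1 + (\<lambda>_. 0) (th x)) * indicator B (Y x)))
     + \<i> * of_real ((LINT x|M. p x * (1 + sin (th x)) * indicator B (Y x)) - (LINT x|M. p x * (1 + (\<lambda>_. 0) (th x)) * indicator B (Y x)))"
    if [measurable]: "Y \<in> borel_measurable M" "th \<in> borel_measurable M" and p: "integrable M p"
    for M :: "'c measure" and p and th Y :: "'c \<Rightarrow> real"
  proof -
    note j = J[OF that]
    have "(CLINT x|M. (p x * indicator B (Y x)) *\<^sub>R iexp (th x)) =
      (CLINT x|M. of_real (p x * indicator B (Y x) * cos (th x)) + \<i> * of_real (p x * indicator B (Y x) * sin (th x)))"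
      by (intro Bochner_Integration.integral_cong) (auto simp: exp_Euler cos_of_real sin_of_real scaleR_conv_of_real algebra_simps)
    also have "\<dots> = of_real (LINT x|M. p x * indicator B (Y x) * cos (th x)) + \<i> * of_real (LINT x|M. p x * indicator B (Y x) * sin (th x))"
      using j by (subst Bochner_Integration.integral_add) (auto simp del: of_real_mult)
    also have "(LINT x|M. p x * indicator B (Y x) * cos (th x)) = (LINT x|M. p x * (1 + cos (th x)) * indicator B (Y x)) - (LINT x|M. p x * (1 + (\<lambda>_. 0) (th x)) * indicator B (Y x))"
      using j by (simp add: algebra_simps)
    also have "(LINT x|M. p x * indicator B (Y x) * sin (th x)) = (LINT x|M. p x * (1 + sin (th x)) * indicator B (Y x)) - (LINT x|M. p x * (1 + (\<lambda>_. 0) (th x)) * indicator B (Y x))"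
      using j by (simp add: algebra_simps)
    finally show ?thesis .
  qed
  show ?thesis
    unfolding split[OF m1 p1(1)] split[OF m2 p2(1)] zero cos sin ..
qed

text \<open>Frequencies are exchanged for indicators one coordinate at a time: \<open>G\<close>
  holds the coordinates already localised, \<open>K\<close> those still tested by exponentials. With
  \<open>K\<close> empty this is equality of the laws on rectangles.\<close>

lemma Cramer_Wold_aux:
  fixes Y1 :: "'j \<Rightarrow> 'a \<Rightarrow> real" and Y2 :: "'j \<Rightarrow> 'b \<Rightarrow> real"
  assumes "prob_space M1" "prob_space M2" "finite G" "finite K" "G \<inter> K = {}"
    and m1: "\<And>j. j \<in> G \<union> K \<Longrightarrow> Y1 j \<in> borel_measurable M1"
    and m2: "\<And>j. j \<in> G \<union> K \<Longrightarrow> Y2 j \<in> borel_measurable M2"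
    and B: "\<And>j. j \<in> G \<Longrightarrow> B j \<in> sets borel"
    and eq: "\<And>a. (CLINT x|M1. iexp (\<Sum>j\<in>G \<union> K. a j * Y1 j x)) = (CLINT x|M2. iexp (\<Sum>j\<in>G \<union> K. a j * Y2 j x))"
  shows "(CLINT x|M1. (\<Prod>j\<in>G. indicator (B j) (Y1 j x)) *\<^sub>R iexp (\<Sum>j\<in>K. a j * Y1 j x)) =
         (CLINT x|M2. (\<Prod>j\<in>G. indicator (B j) (Y2 j x)) *\<^sub>R iexp (\<Sum>j\<in>K. a j * Y2 j x))"
  using assms(3-)
proof (induction G arbitrary: K a rule: finite_induct)
  case empty
  then show ?case by simp
next
  case (insert g G)
  interpret M1: prob_space M1 by fact
  interpret M2: prob_space M2 by fact
  have g: "g \<notin> K" "g \<notin> G" and K: "finite K" using insert by auto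
  note m = insert.prems(3,4) and B = insert.prems(5)
  have [measurable]: "B j \<in> sets borel" if "j \<in> G" for j using B that by auto
  have [measurable]: "Y1 j \<in> borel_measurable M1" "Y2 j \<in> borel_measurable M2" if "j \<in> G" for j using m that by auto
  have [measurable]: "Y1 j \<in> borel_measurable M1" "Y2 j \<in> borel_measurable M2" if "j \<in> K" for j using m that by auto
  let ?p1 = "\<lambda>x. (\<Prod>j\<in>G. indicator (B j) (Y1 j x)) :: real" and ?p2 = "\<lambda>x. (\<Prod>j\<in>G. indicator (B j) (Y2 j x)) :: real"
  have p: "0 \<le> ?p1 x" "?p1 x \<le> 1" "0 \<le> ?p2 y" "?p2 y \<le> 1" for x y
    by (auto intro!: prod_nonneg prod_le_1)
  have ip: "integrable M1 ?p1" "integrable M2 ?p2"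
    using p by (auto intro!: M1.integrable_const_bound[where B=1] M2.integrable_const_bound[where B=1])
  have sum: "(\<Sum>j\<in>insert g K. (if j = g then b else s * a j) * Y j x) = s * (\<Sum>j\<in>K. a j * Y j x) + b * Y g x" for b s x and Y :: "'j \<Rightarrow> 'c \<Rightarrow> real"
  proof -
    have "(\<Sum>j\<in>K. (if j = g then b else s * a j) * Y j x) = (\<Sum>j\<in>K. s * (a j * Y j x))"
      using g by (intro sum.cong) auto
    then show ?thesis using K g by (simp add: sum_distrib_left)
  qed
  \<comment> \<open>The scalar \<open>s\<close> multiplies the remaining linear form as a whole,
    because the one-coordinate step needs every real combination of that form with
    \<open>Y g\<close>.\<close>
  have IH: "(CLINT x|M1. ?p1 x *\<^sub>R iexp (s * (\<Sum>j\<in>K. a j * Y1 j x) + b * Y1 g x)) =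
     (CLINT x|M2. ?p2 x *\<^sub>R iexp (s * (\<Sum>j\<in>K. a j * Y2 j x) + b * Y2 g x))" for s b
    unfolding sum[symmetric]
    by (rule insert.IH) (use insert.prems insert.hyps in \<open>auto simp: Un_insert_right\<close>)
  have "(CLINT x|M1. (?p1 x * indicator (B g) (Y1 g x)) *\<^sub>R iexp (\<Sum>j\<in>K. a j * Y1 j x)) =
         (CLINT x|M2. (?p2 x * indicator (B g) (Y2 g x)) *\<^sub>R iexp (\<Sum>j\<in>K. a j * Y2 j x))"
    by (rule weighted_Levy_uniqueness_iexp) (use ip p m B IH in auto)
  then show ?case using insert.hyps by (simp add: mult.commute)
qed

lemma Cramer_Wold_real:
  fixes Y1 :: "'j \<Rightarrow> 'a \<Rightarrow> real" and Y2 :: "'j \<Rightarrow> 'b \<Rightarrow> real"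
  assumes "prob_space M1" "prob_space M2" and G: "finite G"
    and m1: "\<And>j. j \<in> G \<Longrightarrow> Y1 j \<in> borel_measurable M1"
    and m2: "\<And>j. j \<in> G \<Longrightarrow> Y2 j \<in> borel_measurable M2"
    and eq: "\<And>a. (CLINT x|M1. iexp (\<Sum>j\<in>G. a j * Y1 j x)) = (CLINT x|M2. iexp (\<Sum>j\<in>G. a j * Y2 j x))"
  shows "distr M1 (Pi\<^sub>M G (\<lambda>_. borel)) (\<lambda>x. \<lambda>j\<in>G. Y1 j x) = distr M2 (Pi\<^sub>M G (\<lambda>_. borel)) (\<lambda>x. \<lambda>j\<in>G. Y2 j x)"
proof -
  interpret M1: prob_space M1 by fact
  interpret M2: prob_space M2 by fact
  let ?P = "Pi\<^sub>M G (\<lambda>_. borel :: real measure)"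
  let ?Z1 = "\<lambda>x. \<lambda>j\<in>G. Y1 j x"
  let ?Z2 = "\<lambda>x. \<lambda>j\<in>G. Y2 j x"
  have 1[measurable]: "?Z1 \<in> measurable M1 ?P" using m1 by (intro measurable_restrict) auto
  have 2[measurable]: "?Z2 \<in> measurable M2 ?P" using m2 by (intro measurable_restrict) auto
  have key: "complex_of_real (measure (distr M ?P (\<lambda>x. \<lambda>j\<in>G. Y j x)) (Pi\<^sub>E G A)) = (CLINT x|M. (\<Prod>j\<in>G. indicator (A j) (Y j x)) *\<^sub>R iexp 0)"
    if "prob_space M" and m: "\<And>j. j \<in> G \<Longrightarrow> Y j \<in> borel_measurable M" and A: "\<And>j. j \<in> G \<Longrightarrow> A j \<in> sets borel"
    for M :: "'c measure" and Y and A :: "'j \<Rightarrow> real set"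
  proof -
    interpret prob_space M by fact
    have [measurable]: "(\<lambda>x. \<lambda>j\<in>G. Y j x) \<in> measurable M ?P" using m by (intro measurable_restrict) auto
    have [measurable]: "Pi\<^sub>E G A \<in> sets ?P" using A G by (intro sets_PiM_I_finite) auto
    have "measure (distr M ?P (\<lambda>x. \<lambda>j\<in>G. Y j x)) (Pi\<^sub>E G A) = (LINT x|M. indicator (Pi\<^sub>E G A) (\<lambda>j\<in>G. Y j x))"
      by (subst integral_distr[of _ _ ?P "indicator (Pi\<^sub>E G A) :: _ \<Rightarrow> real", symmetric]) auto
    also have "\<dots> = (LINT x|M. (\<Prod>j\<in>G. indicator (A j) (Y j x)))"
    proof (intro Bochner_Integration.integral_cong refl)
      fix x
      show "(indicator (Pi\<^sub>E G A) (\<lambda>j\<in>G. Y j x) :: real) = (\<Prod>j\<in>G. indicator (A j) (Y j x))"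
      proof (cases "\<forall>j\<in>G. Y j x \<in> A j")
        case True then show ?thesis by (auto simp: indicator_def PiE_def)
      next
        case False
        then obtain j where "j \<in> G" "Y j x \<notin> A j" by auto
        then have "(\<lambda>j\<in>G. Y j x) \<notin> Pi\<^sub>E G A" "(\<Prod>j\<in>G. indicator (A j) (Y j x) :: real) = 0"
          using G by (auto simp: PiE_def Pi_def intro!: prod_zero bexI[of _ j])
        then show ?thesis by simp
      qed
    qed
    finally show ?thesis by (simp add: scaleR_conv_of_real del: of_real_prod)
  qed
  interpret D1: prob_space "distr M1 ?P ?Z1" by (rule M1.prob_space_distr) simp
  interpret D2: prob_space "distr M2 ?P ?Z2" by (rule M2.prob_space_distr) simp
  show ?thesis
  proof (rule measure_eqI_PiM_finite[OF G])
    fix A :: "'j \<Rightarrow> real set" assume A: "\<And>i. i \<in> G \<Longrightarrow> A i \<in> sets borel"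
    have "(CLINT x|M1. (\<Prod>j\<in>G. indicator (A j) (Y1 j x)) *\<^sub>R iexp (\<Sum>j\<in>{}. 0 * Y1 j x)) =
         (CLINT x|M2. (\<Prod>j\<in>G. indicator (A j) (Y2 j x)) *\<^sub>R iexp (\<Sum>j\<in>{}. 0 * Y2 j x))"
      by (rule Cramer_Wold_aux[OF assms(1,2) G]) (use m1 m2 A eq in auto)
    then have "complex_of_real (measure (distr M1 ?P ?Z1) (Pi\<^sub>E G A)) = of_real (measure (distr M2 ?P ?Z2) (Pi\<^sub>E G A))"
      by (simp only: key[OF assms(1) m1 A] key[OF assms(2) m2 A] sum.empty)
    then show "emeasure (distr M1 ?P ?Z1) (Pi\<^sub>E G A) = emeasure (distr M2 ?P ?Z2) (Pi\<^sub>E G A)"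
      by (simp add: D1.emeasure_eq_measure D2.emeasure_eq_measure)
  next
    show "range (\<lambda>_::nat. Pi\<^sub>E G (\<lambda>_. UNIV)) \<subseteq> prod_algebra G (\<lambda>_. borel :: real measure)"
      using G by (auto intro!: prod_algebraI_finite)
  qed (auto simp: space_PiM)
qed

lemma Cramer_Wold:
  fixes Y1 :: "'j \<Rightarrow> 'a \<Rightarrow> 'v::euclidean_space" and Y2 :: "'j \<Rightarrow> 'b \<Rightarrow> 'v"
  assumes "prob_space M1" "prob_space M2" and G: "finite G"
    and m1: "\<And>j. j \<in> G \<Longrightarrow> Y1 j \<in> borel_measurable M1"
    and m2: "\<And>j. j \<in> G \<Longrightarrow> Y2 j \<in> borel_measurable M2"
    and eq: "\<And>a. (CLINT x|M1. iexp (\<Sum>j\<in>G. a j \<bullet> Y1 j x)) = (CLINT x|M2. iexp (\<Sum>j\<in>G. a j \<bullet> Y2 j x))"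
  shows "distr M1 (Pi\<^sub>M G (\<lambda>_. borel)) (\<lambda>x. \<lambda>j\<in>G. Y1 j x) = distr M2 (Pi\<^sub>M G (\<lambda>_. borel)) (\<lambda>x. \<lambda>j\<in>G. Y2 j x)"
proof -
  let ?J = "G \<times> (Basis :: 'v set)"
  let ?Q = "Pi\<^sub>M ?J (\<lambda>_. borel :: real measure)" and ?P = "Pi\<^sub>M G (\<lambda>_. borel :: 'v measure)"
  let ?\<Phi> = "\<lambda>g. \<lambda>j\<in>G. \<Sum>b\<in>Basis. g (j, b) *\<^sub>R b :: 'v"
  have \<Phi>[measurable]: "?\<Phi> \<in> measurable ?Q ?P"
    by (intro measurable_restrict borel_measurable_sum borel_measurable_scaleR measurable_component_singleton) auto
  let ?Z1 = "\<lambda>(j, b) x. Y1 j x \<bullet> b" and ?Z2 = "\<lambda>(j, b) x. Y2 j x \<bullet> b"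
  have lin: "(\<Sum>i\<in>?J. a i * (case i of (j, b) \<Rightarrow> \<lambda>x. Y j x \<bullet> b) x) = (\<Sum>j\<in>G. (\<Sum>b\<in>Basis. a (j, b) *\<^sub>R b) \<bullet> Y j x)"
    for a x and Y :: "'j \<Rightarrow> 'c \<Rightarrow> 'v"
    by (subst sum.cartesian_product', unfold inner_sum_left) (auto intro!: sum.cong simp: inner_commute)
  have "distr M1 ?Q (\<lambda>x. \<lambda>i\<in>?J. ?Z1 i x) = distr M2 ?Q (\<lambda>x. \<lambda>i\<in>?J. ?Z2 i x)"
    by (rule Cramer_Wold_real[OF assms(1,2)]) (use G m1 m2 in \<open>auto simp: lin eq simp del: of_real_sum intro!: borel_measurable_inner\<close>)
  then have *: "distr (distr M1 ?Q (\<lambda>x. \<lambda>i\<in>?J. ?Z1 i x)) ?P ?\<Phi> = distr (distr M2 ?Q (\<lambda>x. \<lambda>i\<in>?J. ?Z2 i x)) ?P ?\<Phi>"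
    by simp
  have 1: "(\<lambda>x. \<lambda>i\<in>?J. ?Z1 i x) \<in> measurable M1 ?Q" using m1 by (intro measurable_restrict) auto
  have 2: "(\<lambda>x. \<lambda>i\<in>?J. ?Z2 i x) \<in> measurable M2 ?Q" using m2 by (intro measurable_restrict) auto
  have c: "?\<Phi> \<circ> (\<lambda>x. \<lambda>i\<in>?J. (case i of (j, b) \<Rightarrow> \<lambda>x. Y j x \<bullet> b) x) = (\<lambda>x. \<lambda>j\<in>G. Y j x)" for Y :: "'j \<Rightarrow> 'c \<Rightarrow> 'v"
    by (auto simp: fun_eq_iff restrict_def euclidean_representation)
  show ?thesis
    using * unfolding distr_distr[OF \<Phi> 1] distr_distr[OF \<Phi> 2] c .
qed

section \<open>A trapezoidal bump in the Cameron-Martin space\<close>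

text \<open>Gram-Schmidt by induction on \<open>F\<close>: \<open>R\<close> may be singular, but \<open>h\<close> vanishes on its kernel.\<close>

lemma psd_system_solvable:
  fixes R :: "'t \<Rightarrow> 't \<Rightarrow> real"
  assumes "finite F"
    and "\<And>s t. R s t = R t s"
    and "\<And>c. 0 \<le> (\<Sum>t\<in>F. c t * (\<Sum>s\<in>F. c s * R s t))"
    and "\<And>c. (\<Sum>t\<in>F. c t * (\<Sum>s\<in>F. c s * R s t)) = 0 \<Longrightarrow> (\<Sum>t\<in>F. c t * h t) = 0"
  shows "\<exists>c. \<forall>t\<in>F. (\<Sum>s\<in>F. c s * R s t) = h t"
  using assms
proof (induction F arbitrary: h rule: finite_induct)
  case empty
  then show ?case by simp
next
  case (insert p F)
  define ext where "ext x c = (\<lambda>t. if t = p then x else c t)" for x :: real and c :: "'t \<Rightarrow> real"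
  have ext: "(\<Sum>t\<in>insert p F. ext x c t * g t) = x * g p + (\<Sum>t\<in>F. c t * g t)" for x c g
  proof -
    have "(\<Sum>t\<in>F. ext x c t * g t) = (\<Sum>t\<in>F. c t * g t)"
      using insert.hyps by (intro sum.cong) (auto simp: ext_def)
    then show ?thesis using insert.hyps by (simp add: ext_def)
  qed
  let ?ap = "\<lambda>c t. \<Sum>s\<in>F. c s * R s t"
  have psd: "0 \<le> x * (x * R p p + ?ap c p) + (\<Sum>t\<in>F. c t * (x * R p t + ?ap c t))" for x c
    using insert.prems(2)[of "ext x c"] by (simp only: ext)
  have hz: "x * h p + (\<Sum>t\<in>F. c t * h t) = 0"
    if "x * (x * R p p + ?ap c p) + (\<Sum>t\<in>F. c t * (x * R p t + ?ap c t)) = 0" for x c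
    using insert.prems(3)[of "ext x c"] that by (simp only: ext)
  have psdF: "0 \<le> (\<Sum>t\<in>F. c t * ?ap c t)" for c
    using psd[of 0 c] by simp
  obtain c where c: "\<And>t. t \<in> F \<Longrightarrow> ?ap c t = h t"
    using insert.IH[of h, OF insert.prems(1) psdF] hz[of 0] by auto
  \<comment> \<open>This projects the new vector onto the old ones. For \<open>c\<close> in the
    kernel of the form on \<open>F\<close>, the quadratic form at \<open>p\<close> plus
    \<open>y\<close> times \<open>c\<close> is affine in \<open>y\<close> and nonnegative for all
    real \<open>y\<close>, so its slope vanishes.\<close>
  have "\<exists>c. \<forall>t\<in>F. ?ap c t = R p t"
  proof (rule insert.IH[OF insert.prems(1) psdF])
    fix c assume z: "(\<Sum>t\<in>F. c t * ?ap c t) = 0"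
    let ?b = "\<Sum>t\<in>F. c t * R p t"
    have b: "?ap c p = ?b" using insert.prems(1) by simp
    have q: "0 \<le> R p p + 2 * y * ?b" for y
    proof -
      have "(\<Sum>t\<in>F. (y * c t) * (1 * R p t + ?ap (\<lambda>t. y * c t) t)) = y * ?b + y\<^sup>2 * (\<Sum>t\<in>F. c t * ?ap c t)"
        by (simp add: sum_distrib_left algebra_simps sum.distrib power2_eq_square)
      moreover have "?ap (\<lambda>t. y * c t) p = y * ?b"
        by (simp only: b[symmetric] sum_distrib_left mult.assoc)
      ultimately show ?thesis using psd[of 1 "\<lambda>t. y * c t"] z by simp
    qed
    show "?b = 0"
    proof (rule ccontr)
      assume n: "?b \<noteq> 0"
      from q[of "- (R p p + 1) / (2 * ?b)"] n show False by (simp add: field_simps)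
    qed
  qed
  then obtain c0 where c0: "\<And>t. t \<in> F \<Longrightarrow> ?ap c0 t = R p t" by auto
  \<comment> \<open>The Schur complement: the squared length of the part of the \<open>p\<close>-th
    vector orthogonal to the others. If it is nonzero, one multiple of that part corrects the value
    at \<open>p\<close>; if it is zero, \<open>p\<close> minus \<open>c0\<close> lies in the kernel
    and the hypothesis on \<open>h\<close> makes the value at \<open>p\<close> right
    already.\<close>
  define q where "q = R p p - ?ap c0 p"
  show ?case
  proof (cases "q = 0")
    case False
    define x where "x = (h p - ?ap c p) / q"
    have e: "(\<Sum>s\<in>insert p F. ext x (\<lambda>s. c s - x * c0 s) s * R s t) = x * (R p t - ?ap c0 t) + ?ap c t" for t
      by (simp only: ext) (simp add: algebra_simps sum_subtractf sum_distrib_left)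
    have "(\<Sum>s\<in>insert p F. ext x (\<lambda>s. c s - x * c0 s) s * R s t) = h t" if "t \<in> insert p F" for t
    proof (cases "t = p")
      case True
      then show ?thesis unfolding e using False by (simp add: x_def flip: q_def)
    next
      case f: False
      with that have "t \<in> F" by auto
      then show ?thesis unfolding e using c c0 by simp
    qed
    then show ?thesis by blast
  next
    case True
    have "(\<Sum>t\<in>F. - c0 t * (1 * R p t + ?ap (\<lambda>s. - c0 s) t)) = 0"
      using c0 by (intro sum.neutral) (simp add: sum_negf)
    then have "1 * h p + (\<Sum>t\<in>F. - c0 t * h t) = 0"
      using True by (intro hz) (simp add: sum_negf q_def)
    then have "h p = (\<Sum>t\<in>F. c0 t * h t)" by (simp add: sum_negf)
    also have "\<dots> = (\<Sum>t\<in>F. c0 t * ?ap c t)" using c by simp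
    also have "\<dots> = (\<Sum>t\<in>F. \<Sum>s\<in>F. c s * (c0 t * R t s))"
      using insert.prems(1) by (simp add: sum_distrib_left algebra_simps)
    also have "\<dots> = (\<Sum>s\<in>F. c s * ?ap c0 s)"
      by (subst sum.swap) (simp add: sum_distrib_left)
    also have "\<dots> = ?ap c p" using c0 insert.prems(1) by simp
    finally have hp: "?ap c p = h p" by simp
    have "(\<Sum>s\<in>insert p F. ext 0 c s * R s t) = h t" if "t \<in> insert p F" for t
      using that hp c unfolding ext by auto
    then show ?thesis by blast
  qed
qed

definition fbm_cov :: "real \<Rightarrow> real \<Rightarrow> real \<Rightarrow> real" where
  "fbm_cov H s t = (s powr (2 * H) + t powr (2 * H) - \<bar>s - t\<bar> powr (2 * H)) / 2"

text \<open>The integrand is the length of the intersection of {t..t+r} with {u+1..u+2}. The bound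
  \<open>2 \<le> r\<close> makes it 1 for every \<open>t\<close> in {u..u+1}, and
  \<open>r \<le> 3\<close> makes it 0 outside the interval from u - 2 to u + 2. The range of
  \<open>r\<close> has length one, so averaging keeps the value 1.\<close>

definition bump :: "real \<Rightarrow> real \<Rightarrow> real" where
  "bump u t = integral {2..3} (\<lambda>r. max 0 (min (t + r) (u + 2) - max t (u + 1)))"

lemma bump_integrable: "(\<lambda>r. max 0 (min (t + r) (u + 2) - max t (u + 1))) integrable_on {2..3::real}"
  by (intro integrable_continuous_interval continuous_intros)

lemma bump_0: "t \<le> u - 2 \<or> u + 2 \<le> t \<Longrightarrow> bump u t = 0"
  unfolding bump_def by (subst integral_cong[of _ _ "\<lambda>_. 0"]) auto

lemma bump_1: "u \<le> t \<Longrightarrow> t \<le> u + 1 \<Longrightarrow> bump u t = 1"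
  unfolding bump_def by (subst integral_cong[of _ _ "\<lambda>_. 1"]) auto

text \<open>A power of exponent 2 H is a mixture of the functions \<open>min r u\<close>, and so is
  each of the three terms of \<open>fbm_cov\<close>. Convergence at 0 uses 0 < H, convergence at
  infinity H < 1/2.\<close>

lemma has_integral_min_powr:
  fixes H u :: real
  assumes H: "0 < H" "H < 1 / 2" and u: "0 \<le> u"
  shows "((\<lambda>r. min r u * r powr (2 * H - 2)) has_integral u powr (2 * H) / (2 * H * (1 - 2 * H))) {0..}"
proof (cases "u = 0")
  case True
  have "((\<lambda>r. min r u * r powr (2 * H - 2)) has_integral 0) {0..}"
    by (rule has_integral_is_0) (use True in auto)
  then show ?thesis using True by simp
next
  case False
  with u have u: "u > 0" by simp
  let ?f = "\<lambda>r. min r u * r powr (2 * H - 2)"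
  let ?A = "u powr (2 * H - 1 + 1) / (2 * H - 1 + 1)"
  let ?B = "u * (- (u powr (2 * H - 2 + 1)) / (2 * H - 2 + 1))"
  have 1: "(?f has_integral ?A) {0..u}"
  proof (rule has_integral_eq)
    show "((\<lambda>r. r powr (2 * H - 1)) has_integral ?A) {0..u}"
      using H u by (intro has_integral_powr_from_0) auto
    fix r assume "r \<in> {0..u}"
    then show "r powr (2 * H - 1) = min r u * r powr (2 * H - 2)"
      by (cases "r = 0") (auto simp: powr_mult_base)
  qed
  have 2: "(?f has_integral ?B) {u..}"
  proof (rule has_integral_eq)
    show "((\<lambda>r. u * r powr (2 * H - 2)) has_integral ?B) {u..}"
      using H u by (intro has_integral_mult_right has_integral_powr_to_inf) auto
  qed auto
  have "(?f has_integral
     ?A + ?B) ({0..u} \<union> {u..})"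
    by (rule has_integral_Un[OF 1 2]) (rule negligible_subset[of "{u}"], auto)
  moreover have "{0..u} \<union> {u..} = {0..}" using u by auto
  moreover have "?A + ?B
     = u powr (2 * H) / (2 * H * (1 - 2 * H))"
  proof -
    have e: "u * u powr (2 * H - 1) = u powr (2 * H)" using u by (simp add: powr_mult_base)
    have n: "2 * H - 1 \<noteq> 0" "1 - 2 * H \<noteq> 0" "2 * H \<noteq> 0" "H \<noteq> 0" using H by auto
    have "?A + ?B
      = u powr (2 * H) / (2 * H) + u powr (2 * H) / (1 - 2 * H)"
    proof -
      have "2 * H - 2 + 1 = 2 * H - 1" "2 * H - 1 + 1 = 2 * H" by simp_all
      moreover have "u * (- (u powr (2 * H - 1)) / (2 * H - 1)) = - ((u * u powr (2 * H - 1)) / (2 * H - 1))" by simp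
      moreover have "- (v / (2 * H - 1)) = v / (1 - 2 * H)" for v using n by (simp add: divide_simps) (simp add: algebra_simps)
      ultimately show ?thesis by (simp only: e)
    qed
    also have "\<dots> = u powr (2 * H) / (2 * H * (1 - 2 * H))" using n by (simp add: field_simps)
    finally show ?thesis .
  qed
  ultimately show ?thesis by simp
qed

text \<open>Jensen's inequality on an interval of length one, obtained by integrating the
  nonnegative function \<open>(f x - m)\<^sup>2\<close>.\<close>

lemma square_integral_le:
  fixes f :: "real \<Rightarrow> real"
  assumes f: "(f has_integral m) {a..a+1}" and q: "((\<lambda>x. (f x)\<^sup>2) has_integral q) {a..a+1}"
  shows "m\<^sup>2 \<le> q"
proof -
  have "((\<lambda>x. (f x)\<^sup>2 - 2 * m * f x + m\<^sup>2) has_integral (q - 2 * m * m + m\<^sup>2)) {a..a+1}"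
    using has_integral_const_real[of "m\<^sup>2" a "a+1"]
    by (intro has_integral_add has_integral_diff q has_integral_mult_right f) auto
  then have "0 \<le> q - 2 * m * m + m\<^sup>2"
  proof (rule has_integral_nonneg)
    fix x show "0 \<le> (f x)\<^sup>2 - 2 * m * f x + m\<^sup>2"
      using zero_le_power2[of "f x - m"] by (simp add: power2_diff algebra_simps)
  qed
  then show ?thesis by (simp add: power2_eq_square)
qed

lemma has_integral_indicator_interval:
  "(indicator {a..b} has_integral max 0 (b - a)) (UNIV :: real set)" (is "(?f has_integral _) _")
proof -
  have "((\<lambda>x. if x \<in> {a..b} then 1 else 0 :: real) has_integral max 0 (b - a)) UNIV"
    unfolding has_integral_restrict_UNIV using has_integral_const_real[of "1::real" a b]
    by (cases "a \<le> b") auto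
  moreover have "(\<lambda>x. if x \<in> {a..b} then 1 else 0 :: real) = ?f" by (auto simp: indicator_def)
  ultimately show ?thesis by simp
qed

text \<open>For \<open>H < 1 / 2\<close> the covariance is a mixture over \<open>r\<close>, with weight \<open>r powr (2 * H - 2)\<close>, of the
  Gram matrices of the functions \<open>indicator {t..t+r} - indicator {0..r}\<close> in \<open>L\<^sup>2\<close>. Restricting the mixture to
  \<open>2 \<le> r \<le> 3\<close> and the inner product to \<open>{u+1..u+2}\<close>, where \<open>indicator {0..r}\<close> vanishes, leaves the
  Cauchy-Schwarz bound for the integral that defines \<open>bump\<close>.\<close>

lemma fbm_cov_bump_le:
  assumes H: "0 < H" "H < 1 / 2" and u: "3 \<le> u" and F: "finite F" "F \<subseteq> {0..}"
  shows "(\<Sum>t\<in>F. c t * bump u t)\<^sup>2 \<le> 9 / (H * (1 - 2 * H)) * (\<Sum>t\<in>F. c t * (\<Sum>s\<in>F. c s * fbm_cov H s t))"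
proof -
  define I where "I s r x = (indicator {s..s+r} x :: real)" for s r x :: real
  define S where "S r x = (\<Sum>t\<in>F. c t * (I t r x - I 0 r x))" for r x
  define psi where "psi r = (\<Sum>t\<in>F. c t * (\<Sum>s\<in>F. c s * (min r s + min r t - min r \<bar>s - t\<bar>)))" for r
  define g where "g r t = max 0 (min (t + r) (u + 2) - max t (u + 1))" for r t
  let ?G = "\<lambda>r. \<Sum>t\<in>F. c t * g r t"
  have II: "((\<lambda>x. I s r x * I t r x) has_integral (r - min r \<bar>s - t\<bar>)) UNIV" if "r > 0" for s t r
  proof -
    have "(\<lambda>x. I s r x * I t r x) = indicator {max s t..min s t + r}"
      by (auto simp: I_def indicator_def fun_eq_iff)
    moreover have "max 0 ((min s t + r) - max s t) = r - min r \<bar>s - t\<bar>" using that by (auto simp: max_def min_def abs_if)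
    ultimately show ?thesis using has_integral_indicator_interval[of "max s t" "min s t + r"] by simp
  qed
  have S2: "((\<lambda>x. (S r x)\<^sup>2) has_integral psi r) UNIV" if r: "r > 0" for r
  proof -
    have "((\<lambda>x. \<Sum>t\<in>F. c t * (\<Sum>s\<in>F. c s * (I s r x * I t r x - I s r x * I 0 r x - I t r x * I 0 r x + I 0 r x * I 0 r x)))
      has_integral (\<Sum>t\<in>F. c t * (\<Sum>s\<in>F. c s * ((r - min r \<bar>s - t\<bar>) - (r - min r \<bar>s - 0\<bar>) - (r - min r \<bar>t - 0\<bar>) + (r - min r \<bar>0 - 0\<bar>))))) UNIV"
      by (intro has_integral_sum has_integral_mult_right has_integral_add has_integral_diff II[OF r] F)
    moreover have "(\<Sum>t\<in>F. c t * (\<Sum>s\<in>F. c s * ((r - min r \<bar>s - t\<bar>) - (r - min r \<bar>s - 0\<bar>) - (r - min r \<bar>t - 0\<bar>) + (r - min r \<bar>0 - 0\<bar>)))) = psi r"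
      unfolding psi_def using F r by (intro sum.cong refl arg_cong2[where f="(*)"]) (auto simp: subset_eq)
    moreover have "(\<Sum>t\<in>F. c t * (\<Sum>s\<in>F. c s * (I s r x * I t r x - I s r x * I 0 r x - I t r x * I 0 r x + I 0 r x * I 0 r x))) = (S r x)\<^sup>2" for x
      unfolding S_def power2_eq_square sum_product
      by (simp add: sum_distrib_left algebra_simps)
    ultimately show ?thesis by simp
  qed
  have g: "(?G r)\<^sup>2 \<le> psi r" if r: "2 \<le> r" "r \<le> 3" for r
  proof -
    define S' where "S' x = (\<Sum>t\<in>F. c t * I t r x)" for x
    have i: "((\<lambda>x. I t r x) has_integral g r t) {u+1..u+2}" for t
    proof -
      have "(\<lambda>x. if x \<in> {u+1..u+2} then I t r x else 0) = indicator {max t (u+1)..min (t+r) (u+2)}"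
        by (auto simp: I_def indicator_def fun_eq_iff)
      then have "((\<lambda>x. if x \<in> {u+1..u+2} then I t r x else 0) has_integral g r t) UNIV"
        using has_integral_indicator_interval[of "max t (u+1)" "min (t+r) (u+2)"] by (simp add: g_def)
      then show ?thesis by (simp only: has_integral_restrict_UNIV)
    qed
    have "(S' has_integral ?G r) {u+1..u+1+1}"
      unfolding S'_def using F i by (intro has_integral_sum has_integral_mult_right) (auto simp: add.assoc)
    moreover
    have on: "(\<lambda>x. (S r x)\<^sup>2) integrable_on {u+1..u+1+1}"
      using S2[of r] r by (intro integrable_on_subinterval[of _ UNIV]) (auto simp: integrable_on_def)
    have eq: "S r x = S' x" if "x \<in> {u+1..u+1+1}" "x \<noteq> 4" for x
    proof -
      have "I 0 r x = 0" using that r u by (auto simp: I_def)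
      then show ?thesis by (simp add: S_def S'_def)
    qed
    have "((\<lambda>x. (S' x)\<^sup>2) has_integral integral {u+1..u+1+1} (\<lambda>x. (S r x)\<^sup>2)) {u+1..u+1+1}"
      by (rule has_integral_spike[OF _ _ integrable_integral[OF on], of "{4}"]) (auto simp: eq)
    ultimately have "(?G r)\<^sup>2 \<le> integral {u+1..u+1+1} (\<lambda>x. (S r x)\<^sup>2)"
      by (rule square_integral_le)
    also have "\<dots> \<le> psi r"
      by (rule has_integral_subset_le[OF _ integrable_integral[OF on] S2]) (use r in auto)
    finally show ?thesis .
  qed
  have psi0: "0 \<le> psi r" if "r \<ge> 0" for r
  proof (cases "r = 0")
    case True
    have "psi r = 0" unfolding psi_def using True F by (auto simp: subset_eq intro!: sum.neutral)
    then show ?thesis by simp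
  next
    case False
    show ?thesis by (rule has_integral_nonneg[OF S2]) (use False that in auto)
  qed
  let ?k = "2 * H * (1 - 2 * H)"
  have gen: "a / k + b / k - d / k = 2 / k * ((a + b - d) / 2)" for a b d k :: real
    by (simp add: add_divide_distrib diff_divide_distrib)
  have k: "?k > 0" using H by simp
  have tot: "((\<lambda>r. psi r * r powr (2 * H - 2)) has_integral (\<Sum>t\<in>F. c t * (\<Sum>s\<in>F. c s * (2 / ?k * fbm_cov H s t)))) {0..}"
  proof -
    have "((\<lambda>r. \<Sum>t\<in>F. c t * (\<Sum>s\<in>F. c s * (min r s * r powr (2 * H - 2) + min r t * r powr (2 * H - 2) - min r \<bar>s - t\<bar> * r powr (2 * H - 2))))
      has_integral (\<Sum>t\<in>F. c t * (\<Sum>s\<in>F. c s * (s powr (2 * H) / ?k + t powr (2 * H) / ?k - \<bar>s - t\<bar> powr (2 * H) / ?k)))) {0..}"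
      using F by (intro has_integral_sum has_integral_mult_right has_integral_add has_integral_diff has_integral_min_powr H) auto
    moreover have "(\<Sum>t\<in>F. c t * (\<Sum>s\<in>F. c s * (min r s * r powr (2 * H - 2) + min r t * r powr (2 * H - 2) - min r \<bar>s - t\<bar> * r powr (2 * H - 2))))
       = psi r * r powr (2 * H - 2)" for r
      unfolding psi_def by (simp add: sum_distrib_left sum_distrib_right algebra_simps)
    moreover have "s powr (2 * H) / ?k + t powr (2 * H) / ?k - \<bar>s - t\<bar> powr (2 * H) / ?k = 2 / ?k * fbm_cov H s t" for s t
      unfolding fbm_cov_def by (simp only: gen)
    ultimately show ?thesis by simp
  qed
  have gint: "((\<lambda>r. ?G r) has_integral (\<Sum>t\<in>F. c t * bump u t)) {2..2+1}"
    using F integrable_integral[OF bump_integrable]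
    by (intro has_integral_sum has_integral_mult_right) (auto simp: g_def bump_def)
  have gsq: "(\<lambda>r. (?G r)\<^sup>2) integrable_on {2..2+1}"
    unfolding g_def by (intro integrable_continuous_interval continuous_intros)
  have "(\<Sum>t\<in>F. c t * bump u t)\<^sup>2 \<le> integral {2..2+1} (\<lambda>r. (?G r)\<^sup>2)"
    by (rule square_integral_le[OF gint integrable_integral[OF gsq]])
  also have "\<dots> = 9 * integral {2..2+1} (\<lambda>r. 1/9 * (?G r)\<^sup>2)"
    by simp
  also have "\<dots> \<le> 9 * (\<Sum>t\<in>F. c t * (\<Sum>s\<in>F. c s * (2 / ?k * fbm_cov H s t)))"
  proof (intro mult_left_mono)
    have on: "(\<lambda>r. psi r * r powr (2 * H - 2)) integrable_on {2..2+1}"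
      unfolding psi_def by (intro integrable_continuous_interval continuous_intros) auto
    have "integral {2..2+1} (\<lambda>r. 1/9 * (?G r)\<^sup>2) \<le> integral {2..2+1} (\<lambda>r. psi r * r powr (2 * H - 2))"
    proof (rule integral_le[OF _ on])
      show "(\<lambda>r. 1/9 * (?G r)\<^sup>2) integrable_on {2..2+1}"
        using gsq by (intro integrable_on_mult_right)
      fix r :: real assume r: "r \<in> {2..2+1}"
      \<comment> \<open>Origin of the 9: on the interval from 2 to 3 the mixing weight
        \<open>r powr (2 * H - 2)\<close> is at least \<open>3 powr (-2)\<close>. The other factor 1
        / (H (1 - 2 H)) normalises the mixture.\<close>
      have "1/9 = (3::real) powr (-2)" by (simp add: powr_minus powr_numeral)
      also have "\<dots> \<le> r powr (-2)" using r by (intro powr_mono2') auto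
      also have "\<dots> \<le> r powr (2 * H - 2)" using r H by (intro powr_mono) auto
      finally have "1/9 \<le> r powr (2 * H - 2)" .
      then have "1/9 * (?G r)\<^sup>2 \<le> r powr (2 * H - 2) * psi r"
        using g[of r] r by (intro mult_mono) auto
      then show "1/9 * (?G r)\<^sup>2 \<le> psi r * r powr (2 * H - 2)" by (simp add: mult.commute)
    qed
    also have "\<dots> \<le> (\<Sum>t\<in>F. c t * (\<Sum>s\<in>F. c s * (2 / ?k * fbm_cov H s t)))"
      by (rule has_integral_subset_le[OF _ integrable_integral[OF on] tot]) (use psi0 in auto)
    finally show "integral {2..2+1} (\<lambda>r. 1/9 * (?G r)\<^sup>2) \<le> (\<Sum>t\<in>F. c t * (\<Sum>s\<in>F. c s * (2 / ?k * fbm_cov H s t)))" .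
  qed simp
  also have "\<dots> = 9 / (H * (1 - 2 * H)) * (\<Sum>t\<in>F. c t * (\<Sum>s\<in>F. c s * fbm_cov H s t))"
  proof -
    have e: "2 / ?k = 1 / (H * (1 - 2 * H))" using H by (simp add: field_simps)
    have "(\<Sum>t\<in>F. c t * (\<Sum>s\<in>F. c s * (e * fbm_cov H s t))) = e * (\<Sum>t\<in>F. c t * (\<Sum>s\<in>F. c s * fbm_cov H s t))" for e
      by (simp add: sum_distrib_left mult_ac)
    from this[of "1 / (H * (1 - 2 * H))"] show ?thesis unfolding e by (simp only:)
  qed
  finally show ?thesis .
qed

section \<open>Quasi-invariance under shifts by the bump\<close>

text \<open>The shifted density is the geometric mean of the standard density and of
  \<open>exp (m\<^sup>2)\<close> times the density with mean \<open>2 * m\<close>. The inequality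
  between geometric and arithmetic means with parameter \<open>l\<close> splits it; the first part
  gives the integral of \<open>f\<close>, and in the second \<open>f\<close> is bounded by 1. For
  small \<open>l\<close> the error term is small, while the loss 1 / (2 l) only multiplies the
  original integral.\<close>

lemma gaussian_shift_bound:
  fixes f :: "real \<Rightarrow> ennreal"
  assumes [measurable]: "f \<in> borel_measurable borel" and f1: "\<And>x. f x \<le> 1" and l: "0 < l"
  shows "(\<integral>\<^sup>+x. f (x + m) \<partial>std_normal_distribution) \<le>
    ennreal (1 / (2 * l)) * (\<integral>\<^sup>+x. f x \<partial>std_normal_distribution) + ennreal (l / 2 * exp (m\<^sup>2))"
proof -
  let ?d = "normal_density (2 * m) 1"
  let ?N = "std_normal_distribution"
  have "(\<integral>\<^sup>+x. f (x + m) \<partial>?N) = (\<integral>\<^sup>+x. ennreal (std_normal_density x) * f (x + m) \<partial>lborel)"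
    by (subst nn_integral_density) auto
  also have "\<dots> = (\<integral>\<^sup>+x. ennreal (std_normal_density (x - m)) * f x \<partial>lborel)"
    by (subst nn_integral_real_affine[where c=1 and t="-m"]) (auto simp: algebra_simps)
  also have "\<dots> \<le> (\<integral>\<^sup>+x. ennreal (1 / (2 * l)) * (ennreal (std_normal_density x) * f x) + ennreal (l / 2 * exp (m\<^sup>2)) * ennreal (?d x) \<partial>lborel)"
  proof (intro nn_integral_mono)
    fix x
    let ?a = "std_normal_density x" and ?b = "std_normal_density (x - m)" and ?c = "exp (m\<^sup>2) * normal_density (2 * m) 1 x"
    have a: "?a > 0" by (simp add: normal_density_pos)
    have bc: "?b\<^sup>2 = ?a * ?c"
    proof -
      have "?b = 1 / sqrt (2 * pi) * exp (- (x - m)\<^sup>2 / 2)" "?a = 1 / sqrt (2 * pi) * exp (- x\<^sup>2 / 2)"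
        "normal_density (2 * m) 1 x = 1 / sqrt (2 * pi) * exp (- (x - 2 * m)\<^sup>2 / 2)"
        by (simp_all add: normal_density_def)
      moreover have "(exp (- (x - m)\<^sup>2 / 2))\<^sup>2 = exp (- x\<^sup>2 / 2) * (exp (m\<^sup>2) * exp (- (x - 2 * m)\<^sup>2 / 2))"
        unfolding exp_add[symmetric] exp_double[symmetric] by (simp add: power2_eq_square field_simps)
      ultimately show ?thesis by (simp add: power_mult_distrib power2_eq_square)
    qed
    have "?b \<le> 1 / (2 * l) * ?a + l / 2 * ?c"
    proof -
      have "0 \<le> (?a - l * ?b)\<^sup>2" by simp
      also have "\<dots> = ?a * (?a - 2 * l * ?b + l\<^sup>2 * ?c)"
        using bc by (simp add: power2_diff power_mult_distrib) (simp add: power2_eq_square algebra_simps)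
      finally have "0 \<le> ?a - 2 * l * ?b + l\<^sup>2 * ?c" using a by (simp add: zero_le_mult_iff)
      then have "2 * l * ?b \<le> 2 * l * (1 / (2 * l) * ?a + l / 2 * ?c)"
        using l by (simp add: algebra_simps power2_eq_square)
      then show ?thesis using l by simp
    qed
    then have "ennreal ?b \<le> ennreal (1 / (2 * l)) * ennreal ?a + ennreal (l / 2 * exp (m\<^sup>2)) * ennreal (?d x)"
      using l a by (simp add: ennreal_mult[symmetric] ennreal_plus[symmetric] mult.assoc del: ennreal_plus)
    then have "ennreal ?b * f x \<le> (ennreal (1 / (2 * l)) * ennreal ?a + ennreal (l / 2 * exp (m\<^sup>2)) * ennreal (?d x)) * f x"
      by (rule mult_right_mono) simp
    also have "\<dots> = ennreal (1 / (2 * l)) * (ennreal ?a * f x) + ennreal (l / 2 * exp (m\<^sup>2)) * ennreal (?d x) * f x"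
      by (simp add: algebra_simps)
    also have "\<dots> \<le> ennreal (1 / (2 * l)) * (ennreal ?a * f x) + ennreal (l / 2 * exp (m\<^sup>2)) * ennreal (?d x) * 1"
      using f1 by (intro add_left_mono mult_left_mono) auto
    finally show "ennreal ?b * f x \<le> ennreal (1 / (2 * l)) * (ennreal ?a * f x) + ennreal (l / 2 * exp (m\<^sup>2)) * ennreal (?d x)"
      by simp
  qed
  also have "\<dots> = ennreal (1 / (2 * l)) * (\<integral>\<^sup>+x. ennreal (std_normal_density x) * f x \<partial>lborel) + ennreal (l / 2 * exp (m\<^sup>2)) * (\<integral>\<^sup>+x. ennreal (?d x) \<partial>lborel)"
    by (subst nn_integral_add) (auto simp: nn_integral_cmult)
  also have "(\<integral>\<^sup>+x. ennreal (?d x) \<partial>lborel) = 1"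
    using prob_space.emeasure_space_1[OF prob_space_normal_density[of 1 "2 * m"]]
    by (simp add: emeasure_density)
  also have "(\<integral>\<^sup>+x. ennreal (std_normal_density x) * f x \<partial>lborel) = (\<integral>\<^sup>+x. f x \<partial>?N)"
    by (subst nn_integral_density) auto
  finally show ?thesis by simp
qed

lemma (in prob_space) gaussian_rv_char:
  assumes g: "gaussian_rv M Y" and i: "integrable M (\<lambda>x. (Y x)\<^sup>2)" and m: "expectation Y = 0"
  shows "(CLINT x|M. iexp (Y x)) = exp (- expectation (\<lambda>x. (Y x)\<^sup>2) / 2)"
proof -
  have [measurable]: "Y \<in> borel_measurable M" using g by (simp add: gaussian_rv_def)
  from g consider (const) \<mu> where "AE \<omega> in M. Y \<omega> = \<mu>"
    | (normal) \<mu> \<sigma> where "0 < \<sigma>" "distributed M lborel Y (\<lambda>x. ennreal (normal_density \<mu> \<sigma> x))"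
    by (auto simp: gaussian_rv_def)
  then show ?thesis
  proof cases
    case const
    have "expectation Y = expectation (\<lambda>_. \<mu>)" by (rule integral_cong_AE) (use const in auto)
    then have 0: "AE \<omega> in M. Y \<omega> = 0" using const m prob_space by simp
    have "(CLINT x|M. iexp (Y x)) = (CLINT x|M. 1)"
      by (rule integral_cong_AE) (use 0 in auto)
    moreover have "expectation (\<lambda>x. (Y x)\<^sup>2) = expectation (\<lambda>_. 0)"
      by (rule integral_cong_AE) (use 0 in auto)
    ultimately show ?thesis using prob_space by simp
  next
    case normal
    have \<mu>: "\<mu> = 0" using normal_distributed_expectation[OF normal] m by simp
    have v: "expectation (\<lambda>x. (Y x)\<^sup>2) = \<sigma>\<^sup>2"
      using normal_distributed_variance[OF normal] m by simp
    have "distributed M lborel (\<lambda>x. (Y x - \<mu>) / \<sigma>) (\<lambda>x. ennreal (std_normal_density x))"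
      using normal_standard_normal_convert[OF normal(1)] normal(2) by simp
    then have d: "distr M lborel (\<lambda>x. Y x / \<sigma>) = std_normal_distribution"
      by (simp add: distributed_def \<mu>)
    have "(CLINT x|M. iexp (Y x)) = (CLINT x|M. iexp (\<sigma> * (Y x / \<sigma>)))" using normal by simp
    also have "\<dots> = (CLINT y|distr M lborel (\<lambda>x. Y x / \<sigma>). iexp (\<sigma> * y))"
      by (subst integral_distr) auto
    also have "\<dots> = char std_normal_distribution \<sigma>" unfolding d char_def ..
    also have "\<dots> = exp (- expectation (\<lambda>x. (Y x)\<^sup>2) / 2)"
      by (simp add: char_std_normal_distribution v exp_of_real[symmetric])
    finally show ?thesis .
  qed
qed

context fractional_brownian_motion
begin

lemma inner_product_moment:
  assumes s: "0 \<le> s" and t: "0 \<le> t"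
  shows "integrable M (\<lambda>\<omega>. (a \<bullet> X s \<omega>) * (b \<bullet> X t \<omega>))"
    and "expectation (\<lambda>\<omega>. (a \<bullet> X s \<omega>) * (b \<bullet> X t \<omega>)) = (a \<bullet> b) * fbm_cov H s t"
proof -
  let ?f = "\<lambda>\<omega>. (a \<bullet> X s \<omega>) * (b \<bullet> X t \<omega>)"
  have i: "integrable M (\<lambda>\<omega>. X s \<omega> $ i * X t \<omega> $ j)" for i j
  proof (rule Bochner_Integration.integrable_bound)
    show "integrable M (\<lambda>\<omega>. (X s \<omega> $ i)\<^sup>2 + (X t \<omega> $ j)\<^sup>2)" using moments s t by auto
    show "(\<lambda>\<omega>. X s \<omega> $ i * X t \<omega> $ j) \<in> borel_measurable M"
      using measurable_X_component s t by (intro borel_measurable_times) auto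
    have "\<bar>x * y\<bar> \<le> x\<^sup>2 + y\<^sup>2" for x y :: real
      using sum_squares_bound[of "\<bar>x\<bar>" "\<bar>y\<bar>"] abs_ge_zero[of "x * y"] by (simp only: abs_mult power2_abs)
    then show "AE \<omega> in M. norm (X s \<omega> $ i * X t \<omega> $ j) \<le> norm ((X s \<omega> $ i)\<^sup>2 + (X t \<omega> $ j)\<^sup>2)"
      by simp
  qed
  have e: "(a \<bullet> X s \<omega>) * (b \<bullet> X t \<omega>) = (\<Sum>i\<in>UNIV. \<Sum>j\<in>UNIV. (a $ i * b $ j) * (X s \<omega> $ i * X t \<omega> $ j))" for \<omega>
    unfolding inner_vec_def sum_product by (simp add: mult_ac)
  show "integrable M ?f"
    unfolding e using i by auto
  have "expectation ?f = (\<Sum>i\<in>UNIV. \<Sum>j\<in>UNIV. (a $ i * b $ j) * expectation (\<lambda>\<omega>. X s \<omega> $ i * X t \<omega> $ j))"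
    unfolding e using i by simp
  also have "\<dots> = (\<Sum>i\<in>UNIV. \<Sum>j\<in>UNIV. if j = i then (a $ i * b $ j) * fbm_cov H s t else 0)"
    unfolding covariance[OF s t] by (intro sum.cong) (auto simp: fbm_cov_def abs_minus_commute)
  also have "\<dots> = (a \<bullet> b) * fbm_cov H s t"
    by (simp add: inner_vec_def sum_distrib_right)
  finally show "expectation ?f = (a \<bullet> b) * fbm_cov H s t" .
qed

lemma linear_combination_char:
  assumes F: "finite F" "F \<subseteq> {0..}"
  shows "(CLINT \<omega>|M. iexp (\<Sum>t\<in>F. a t \<bullet> X t \<omega>)) = exp (- (\<Sum>t\<in>F. \<Sum>s\<in>F. (a t \<bullet> a s) * fbm_cov H t s) / 2)"
    and "0 \<le> (\<Sum>t\<in>F. \<Sum>s\<in>F. (a t \<bullet> a s) * fbm_cov H t s)"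
proof -
  let ?q = "\<Sum>t\<in>F. \<Sum>s\<in>F. (a t \<bullet> a s) * fbm_cov H t s"
  let ?Y = "\<lambda>\<omega>. \<Sum>t\<in>F. a t \<bullet> X t \<omega>"
  have pos: "0 \<le> t" if "t \<in> F" for t using F that by auto
  have sq: "(?Y \<omega>)\<^sup>2 = (\<Sum>t\<in>F. \<Sum>s\<in>F. (a t \<bullet> X t \<omega>) * (a s \<bullet> X s \<omega>))" for \<omega>
    by (simp add: power2_eq_square sum_product)
  have i: "integrable M (\<lambda>\<omega>. (?Y \<omega>)\<^sup>2)"
    unfolding sq using inner_product_moment pos by auto
  have e: "expectation (\<lambda>\<omega>. (?Y \<omega>)\<^sup>2) = ?q"
    unfolding sq using inner_product_moment pos by (simp add: Bochner_Integration.integral_sum)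
  have m: "integrable M (\<lambda>\<omega>. a t \<bullet> X t \<omega>)" "expectation (\<lambda>\<omega>. a t \<bullet> X t \<omega>) = 0" if "t \<in> F" for t
    using moments[of t] pos[OF that] by (auto simp: inner_vec_def)
  have "expectation ?Y = 0" using m by (simp add: Bochner_Integration.integral_sum)
  moreover have "gaussian_rv M ?Y" using gaussian F by (auto simp: gaussian_process_def)
  ultimately show "(CLINT \<omega>|M. iexp (?Y \<omega>)) = exp (- ?q / 2)"
    using gaussian_rv_char[OF _ i] e by simp
  have "0 \<le> expectation (\<lambda>\<omega>. (?Y \<omega>)\<^sup>2)" by (intro integral_nonneg_AE) auto
  then show "0 \<le> ?q" using e by simp
qed


lemma psd_fbm_cov:
  assumes F: "finite F" "F \<subseteq> {0..}"
  shows "0 \<le> (\<Sum>t\<in>F. c t * (\<Sum>s\<in>F. c s * fbm_cov H s t))"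
proof -
  \<comment> \<open>Any unit vector would do: the form is the variance of the combination of the
    corresponding scalar coordinate.\<close>
  let ?e = "axis undefined 1 :: real ^ 'n"
  have "0 \<le> (\<Sum>t\<in>F. \<Sum>s\<in>F. ((c t *\<^sub>R ?e) \<bullet> (c s *\<^sub>R ?e)) * fbm_cov H t s)"
    by (rule linear_combination_char[OF F])
  also have "\<dots> = (\<Sum>t\<in>F. c t * (\<Sum>s\<in>F. c s * fbm_cov H s t))"
    by (intro sum.cong refl) (auto simp: sum_distrib_left inner_axis_axis fbm_cov_def abs_minus_commute add.commute intro!: sum.cong)
  finally show ?thesis .
qed

text \<open>The vector \<open>X\<close> has on \<open>F\<close> the law of \<open>X - \<theta> \<xi> h v + \<tau> g h v\<close>, where \<open>\<xi>\<close> is the element of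
  the Gaussian space with covariance \<open>h v\<close> against \<open>X\<close> and \<open>g\<close> is an independent standard
  normal variable. Shifting \<open>X\<close> by \<open>h v\<close> thus amounts to shifting \<open>g\<close> by \<open>1 / \<tau>\<close>.\<close>

lemma finite_shift_bound:
  fixes v :: "real ^ 'n"
  assumes F: "finite F" "F \<subseteq> {0..}" and B: "B \<in> sets (Pi\<^sub>M F (\<lambda>_. borel))"
    and h: "\<And>c. (\<Sum>t\<in>F. c t * h t)\<^sup>2 \<le> C * (\<Sum>t\<in>F. c t * (\<Sum>s\<in>F. c s * fbm_cov H s t))"
    and S: "0 < S" "C * (norm v)\<^sup>2 \<le> S" and l: "0 < l"
  shows "emeasure M {\<omega> \<in> space M. (\<lambda>t\<in>F. X t \<omega> + h t *\<^sub>R v) \<in> B} \<le>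
    ennreal (1 / (2 * l)) * emeasure M {\<omega> \<in> space M. (\<lambda>t\<in>F. X t \<omega>) \<in> B} + ennreal (l / 2 * exp S)"
proof -
  note [measurable] = B
  have sym: "fbm_cov H s t = fbm_cov H t s" for s t by (simp add: fbm_cov_def abs_minus_commute add.commute)
  have "(\<Sum>t\<in>F. c t * h t) = 0" if "(\<Sum>t\<in>F. c t * (\<Sum>s\<in>F. c s * fbm_cov H s t)) = 0" for c
    using h[of c] unfolding that by simp
  then have "\<exists>c. \<forall>t\<in>F. (\<Sum>s\<in>F. c s * fbm_cov H s t) = h t"
    by (rule psd_system_solvable[OF F(1) sym psd_fbm_cov[OF F]])
  then obtain c where c: "\<And>t. t \<in> F \<Longrightarrow> (\<Sum>s\<in>F. c s * fbm_cov H s t) = h t" by auto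
  \<comment> \<open>The squared Cameron-Martin norm of \<open>h\<close> restricted to
    \<open>F\<close>. Hypothesis \<open>h\<close> at its own representing coefficients reads
    \<open>K\<^sup>2 \<le> C * K\<close>, which bounds it uniformly in \<open>F\<close>.\<close>
  define K where "K = (\<Sum>t\<in>F. c t * h t)"
  have KK: "(\<Sum>t\<in>F. c t * (\<Sum>s\<in>F. c s * fbm_cov H s t)) = K" using c by (simp add: K_def)
  have K0: "0 \<le> K" using psd_fbm_cov[OF F, of c] KK by simp
  have "K\<^sup>2 \<le> C * K" using h[of c] KK by (simp add: K_def)
  then have KC: "K \<le> C \<or> K = 0" using K0 by (auto simp: power2_eq_square)
  define Q where "Q = K * (norm v)\<^sup>2"
  have Q0: "0 \<le> Q" using K0 by (simp add: Q_def)
  have QS: "Q \<le> S"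
  proof (cases "K = 0")
    case True then show ?thesis using S by (simp add: Q_def)
  next
    case False
    then have "Q \<le> C * (norm v)\<^sup>2" using KC by (auto simp: Q_def intro: mult_right_mono)
    then show ?thesis using S by simp
  qed
  \<comment> \<open>Subtracting \<theta> \<xi> h v lowers the variance of a test functional with
    pairing \<eta> by \<open>(2 * \<theta> - \<theta>\<^sup>2 * Q) * \<eta>\<^sup>2\<close>, where Q
    is the variance of \<xi>, and \<tau> g h v restores exactly this amount. With \<theta> = 1 / S
    and Q \<le> S the square of \<tau> is at least 1 / S, so the displacement 1 / \<tau> of g has
    square at most S.\<close>
  define \<theta> where "\<theta> = 1 / S"
  define \<tau> where "\<tau> = sqrt (2 * \<theta> - \<theta>\<^sup>2 * Q)"
  have "\<theta>\<^sup>2 * Q \<le> \<theta>\<^sup>2 * S" using QS by (intro mult_left_mono) auto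
  also have "\<dots> = \<theta>" using S by (simp add: \<theta>_def power2_eq_square)
  finally have \<tau>1: "1 / S \<le> 2 * \<theta> - \<theta>\<^sup>2 * Q" by (simp add: \<theta>_def)
  moreover have "0 < 1 / S" using S by simp
  ultimately have "0 < 2 * \<theta> - \<theta>\<^sup>2 * Q" by (rule less_le_trans[rotated])
  then have \<tau>2: "\<tau>\<^sup>2 = 2 * \<theta> - \<theta>\<^sup>2 * Q" and \<tau>0: "0 < \<tau>" by (auto simp: \<tau>_def)
  have m2: "(1 / \<tau>)\<^sup>2 \<le> S"
  proof -
    have "1 / S \<le> \<tau>\<^sup>2" using \<tau>1 \<tau>2 by simp
    then have "1 \<le> S * \<tau>\<^sup>2" using S by (simp add: field_simps)
    then show ?thesis using \<tau>0 by (simp add: power_divide field_simps)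
  qed
  let ?N = std_normal_distribution
  interpret N: real_distribution ?N by (rule real_dist_normal_dist)
  interpret P: pair_prob_space M ?N ..
  define \<xi> where "\<xi> \<omega> = (\<Sum>t\<in>F. c t * (v \<bullet> X t \<omega>))" for \<omega>
  have X[measurable]: "X t \<in> borel_measurable M" if "t \<in> F" for t using that F by (intro measurable_X) auto
  have \<xi>m[measurable]: "\<xi> \<in> borel_measurable M"
    unfolding \<xi>_def by measurable
  define Z where "Z t = (\<lambda>(\<omega>, g). X t \<omega> + (\<tau> * g - \<theta> * \<xi> \<omega>) *\<^sub>R h t *\<^sub>R v)" for t
  have Zm[measurable]: "Z t \<in> borel_measurable (M \<Otimes>\<^sub>M ?N)" if "t \<in> F" for t
    using X[OF that] unfolding Z_def by measurable
  have char: "(CLINT x|M. iexp (\<Sum>t\<in>F. a t \<bullet> X t x)) = (CLINT x|(M \<Otimes>\<^sub>M ?N). iexp (\<Sum>t\<in>F. a t \<bullet> Z t x))" for a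
  proof -
    define \<eta> where "\<eta> = (\<Sum>t\<in>F. h t * (a t \<bullet> v))"
    \<comment> \<open>Since \<xi> is itself a combination of the values of X, the correction can be
      absorbed into the coefficients. The variance identity for the new combination is
      \<open>qb\<close>.\<close>
    define b where "b t = a t - (\<theta> * \<eta> * c t) *\<^sub>R v" for t
    let ?bX = "\<lambda>\<omega>. \<Sum>t\<in>F. b t \<bullet> X t \<omega>"
    have lin: "(\<Sum>t\<in>F. a t \<bullet> Z t (\<omega>, g)) = (?bX \<omega>) + (\<tau> * \<eta>) * g" for \<omega> g
    proof -
      have "(\<Sum>t\<in>F. a t \<bullet> Z t (\<omega>, g)) = (\<Sum>t\<in>F. a t \<bullet> X t \<omega>) + (\<tau> * g - \<theta> * \<xi> \<omega>) * \<eta>"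
        by (simp add: Z_def inner_add_right sum.distrib \<eta>_def sum_distrib_left mult.assoc)
      moreover have "(?bX \<omega>) = (\<Sum>t\<in>F. a t \<bullet> X t \<omega>) - \<theta> * \<eta> * \<xi> \<omega>"
        by (simp add: b_def inner_diff_left sum_subtractf \<xi>_def sum_distrib_left mult.assoc)
      ultimately show ?thesis by (simp add: algebra_simps)
    qed
    let ?q = "\<lambda>a. \<Sum>t\<in>F. \<Sum>s\<in>F. (a t \<bullet> a s) * fbm_cov H t s"
    have cross: "(\<Sum>t\<in>F. \<Sum>s\<in>F. (a t \<bullet> v) * c s * fbm_cov H t s) = \<eta>"
    proof -
      have "(\<Sum>t\<in>F. \<Sum>s\<in>F. (a t \<bullet> v) * c s * fbm_cov H t s) = (\<Sum>t\<in>F. (a t \<bullet> v) * (\<Sum>s\<in>F. c s * fbm_cov H s t))"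
        by (simp add: sum_distrib_left mult_ac sym)
      then show ?thesis using c by (simp add: \<eta>_def mult.commute)
    qed
    have cross': "(\<Sum>t\<in>F. \<Sum>s\<in>F. (a s \<bullet> v) * c t * fbm_cov H t s) = \<eta>"
      by (subst sum.swap) (simp add: cross sym)
    have cc: "(\<Sum>t\<in>F. \<Sum>s\<in>F. c t * c s * fbm_cov H t s) = K"
      unfolding KK[symmetric] by (simp add: sum_distrib_left mult_ac sym)
    have "?q b = (\<Sum>t\<in>F. \<Sum>s\<in>F. (a t \<bullet> a s) * fbm_cov H t s - \<theta> * \<eta> * ((a t \<bullet> v) * c s * fbm_cov H t s)
        - \<theta> * \<eta> * ((a s \<bullet> v) * c t * fbm_cov H t s) + (\<theta> * \<eta>)\<^sup>2 * (norm v)\<^sup>2 * (c t * c s * fbm_cov H t s))"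
      unfolding b_def by (intro sum.cong refl) (simp add: inner_diff_left inner_diff_right dot_square_norm inner_commute[of v] power2_eq_square algebra_simps)
    also have "\<dots> = ?q a - \<theta> * \<eta> * \<eta> - \<theta> * \<eta> * \<eta> + (\<theta> * \<eta>)\<^sup>2 * (norm v)\<^sup>2 * K"
      unfolding sum.distrib sum_subtractf sum_distrib_left[symmetric] cross cross' cc ..
    also have "\<dots> = ?q a - (\<tau> * \<eta>)\<^sup>2"
      unfolding power_mult_distrib \<tau>2 by (simp add: Q_def power2_eq_square algebra_simps)
    finally have qb: "?q b = ?q a - (\<tau> * \<eta>)\<^sup>2" .
    have bm[measurable]: "(\<lambda>\<omega>. \<Sum>t\<in>F. b t \<bullet> X t \<omega>) \<in> borel_measurable M" by measurable
    have meas: "(\<lambda>(\<omega>, g). iexp ((?bX \<omega>) + (\<tau> * \<eta>) * g)) \<in> borel_measurable (M \<Otimes>\<^sub>M ?N)"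
      by measurable
    have int: "integrable (M \<Otimes>\<^sub>M ?N) (\<lambda>(\<omega>, g). iexp ((?bX \<omega>) + (\<tau> * \<eta>) * g))"
      by (rule P.integrable_const_bound[where B=1, OF _ meas]) (auto simp: split_beta)
    have "(CLINT x|(M \<Otimes>\<^sub>M ?N). iexp (\<Sum>t\<in>F. a t \<bullet> Z t x)) = (CLINT x|(M \<Otimes>\<^sub>M ?N). (\<lambda>(\<omega>, g). iexp ((?bX \<omega>) + (\<tau> * \<eta>) * g)) x)"
      by (intro Bochner_Integration.integral_cong refl) (simp add: split_beta lin[symmetric])
    also have "\<dots> = (CLINT \<omega>|M. CLINT g|?N. iexp ((?bX \<omega>) + (\<tau> * \<eta>) * g))"
      using P.integral_fst'[OF int] by simp
    also have "\<dots> = (CLINT \<omega>|M. CLINT g|?N. iexp (?bX \<omega>) * iexp ((\<tau> * \<eta>) * g))"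
      by (simp add: distrib_left exp_add)
    also have "\<dots> = (CLINT \<omega>|M. iexp (?bX \<omega>) * char ?N (\<tau> * \<eta>))"
      unfolding char_def by (intro Bochner_Integration.integral_cong refl integral_mult_right_zero)
    also have "\<dots> = (CLINT \<omega>|M. iexp (?bX \<omega>)) * char ?N (\<tau> * \<eta>)"
      by (rule integral_mult_left_zero)
    also have "\<dots> = exp (of_real (- ?q b / 2)) * exp (of_real (- (\<tau> * \<eta>)\<^sup>2 / 2))"
      unfolding linear_combination_char(1)[OF F] by (simp add: char_std_normal_distribution exp_of_real[symmetric])
    also have "\<dots> = exp (of_real (- ?q a / 2))"
      unfolding exp_add[symmetric] of_real_add[symmetric] qb by (simp add: field_simps)
    also have "\<dots> = (CLINT x|M. iexp (\<Sum>t\<in>F. a t \<bullet> X t x))"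
      unfolding linear_combination_char(1)[OF F] by (simp add: exp_of_real[symmetric])
    finally show ?thesis ..
  qed
  let ?P = "Pi\<^sub>M F (\<lambda>_. borel :: (real ^ 'n) measure)"
  have law: "distr M ?P (\<lambda>x. \<lambda>t\<in>F. X t x) = distr (M \<Otimes>\<^sub>M ?N) ?P (\<lambda>x. \<lambda>t\<in>F. Z t x)"
    by (rule Cramer_Wold[OF prob_space_axioms P.prob_space_axioms F(1)]) (use X Zm char in auto)
  have Xm[measurable]: "(\<lambda>x. \<lambda>t\<in>F. X t x) \<in> measurable M ?P" by (intro measurable_restrict) auto
  let ?ZB = "\<lambda>f. {x \<in> space (M \<Otimes>\<^sub>M ?N). f (\<lambda>t\<in>F. Z t x) \<in> B}"
  have ZM[measurable]: "(\<lambda>x. \<lambda>t\<in>F. Z t x) \<in> measurable (M \<Otimes>\<^sub>M ?N) ?P" by (intro measurable_restrict) auto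
  define T where "T w = (\<lambda>t\<in>F. w t + h t *\<^sub>R v)" for w
  have T[measurable]: "T \<in> measurable ?P ?P"
    unfolding T_def by (intro measurable_restrict borel_measurable_add measurable_component_singleton) auto
  have tr: "emeasure M {\<omega> \<in> space M. f (\<lambda>t\<in>F. X t \<omega>) \<in> B} = emeasure (M \<Otimes>\<^sub>M ?N) (?ZB f)"
    if f[measurable]: "f \<in> measurable ?P ?P" for f
  proof -
    have A: "f -` B \<inter> space ?P \<in> sets ?P" by measurable
    have "emeasure (distr M ?P (\<lambda>x. \<lambda>t\<in>F. X t x)) (f -` B \<inter> space ?P) = emeasure M {\<omega> \<in> space M. f (\<lambda>t\<in>F. X t \<omega>) \<in> B}"
      using measurable_space[OF Xm] by (subst emeasure_distr[OF Xm A]) (auto intro!: arg_cong[where f="emeasure M"])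
    moreover have "emeasure (distr (M \<Otimes>\<^sub>M ?N) ?P (\<lambda>x. \<lambda>t\<in>F. Z t x)) (f -` B \<inter> space ?P) = emeasure (M \<Otimes>\<^sub>M ?N) (?ZB f)"
      using measurable_space[OF ZM] by (subst emeasure_distr[OF ZM A]) (auto intro!: arg_cong[where f="emeasure (M \<Otimes>\<^sub>M ?N)"])
    ultimately show ?thesis using law by simp
  qed
  have shift: "T (\<lambda>t\<in>F. Z t (\<omega>, g)) = (\<lambda>t\<in>F. Z t (\<omega>, g + 1 / \<tau>))" for \<omega> g
  proof -
    have "Z t (\<omega>, g) + h t *\<^sub>R v = Z t (\<omega>, g + 1 / \<tau>)" for t
    proof -
      have "\<tau> * (g + 1 / \<tau>) - \<theta> * \<xi> \<omega> = (\<tau> * g - \<theta> * \<xi> \<omega>) + 1" using \<tau>0 by (simp add: field_simps)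
      then show ?thesis unfolding Z_def by (simp only: prod.case scaleR_left_distrib scaleR_one add.assoc)
    qed
    then show ?thesis by (simp add: T_def cong: restrict_cong)
  qed
  have em: "emeasure (M \<Otimes>\<^sub>M ?N) (?ZB f) = (\<integral>\<^sup>+\<omega>. \<integral>\<^sup>+g. indicator B (f (\<lambda>t\<in>F. Z t (\<omega>, g))) \<partial>?N \<partial>M)"
    if f[measurable]: "f \<in> measurable ?P ?P" for f
  proof -
    have SZ: "(?ZB f) \<in> sets (M \<Otimes>\<^sub>M ?N)" by measurable
    have JZ: "(\<lambda>x. indicator B (f (\<lambda>t\<in>F. Z t x)) :: ennreal) \<in> borel_measurable (M \<Otimes>\<^sub>M ?N)" by measurable
    have "emeasure (M \<Otimes>\<^sub>M ?N) (?ZB f) = (\<integral>\<^sup>+x. indicator (?ZB f) x \<partial>(M \<Otimes>\<^sub>M ?N))"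
      by (rule nn_integral_indicator[OF SZ, symmetric])
    also have "\<dots> = (\<integral>\<^sup>+x. indicator B (f (\<lambda>t\<in>F. Z t x)) \<partial>(M \<Otimes>\<^sub>M ?N))"
      by (intro nn_integral_cong) (auto simp: indicator_def)
    also have "\<dots> = (\<integral>\<^sup>+\<omega>. \<integral>\<^sup>+g. indicator B (f (\<lambda>t\<in>F. Z t (\<omega>, g))) \<partial>?N \<partial>M)"
      by (rule N.nn_integral_fst[OF JZ, symmetric])
    finally show ?thesis .
  qed
  have mi: "(\<lambda>x. x) \<in> measurable ?P ?P" by simp
  let ?a = "ennreal (1 / (2 * l))"
  let ?I = "\<lambda>\<omega> g. indicator B (\<lambda>t\<in>F. Z t (\<omega>, g)) :: ennreal"
  have Im: "(\<lambda>x. ?I (fst x) (snd x)) \<in> borel_measurable (M \<Otimes>\<^sub>M ?N)" by simp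
  have Im2[measurable]: "?I \<omega> \<in> borel_measurable borel" if "\<omega> \<in> space M" for \<omega>
    using measurable_compose[OF measurable_Pair1'[OF that] Im] by simp
  have "emeasure M {\<omega> \<in> space M. (\<lambda>t\<in>F. X t \<omega> + h t *\<^sub>R v) \<in> B} = emeasure M {\<omega> \<in> space M. T (\<lambda>t\<in>F. X t \<omega>) \<in> B}"
    by (simp add: T_def cong: restrict_cong)
  also have "\<dots> = (\<integral>\<^sup>+\<omega>. \<integral>\<^sup>+g. ?I \<omega> (g + 1 / \<tau>) \<partial>?N \<partial>M)"
    unfolding tr[OF T] em[OF T] shift ..
  also have "\<dots> \<le> (\<integral>\<^sup>+\<omega>. ?a * (\<integral>\<^sup>+g. ?I \<omega> g \<partial>?N) + ennreal (l / 2 * exp ((1 / \<tau>)\<^sup>2)) \<partial>M)"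
    by (intro nn_integral_mono gaussian_shift_bound Im2 l) (auto simp: indicator_def)
  also have "\<dots> = ?a * (\<integral>\<^sup>+\<omega>. \<integral>\<^sup>+g. ?I \<omega> g \<partial>?N \<partial>M) + ennreal (l / 2 * exp ((1 / \<tau>)\<^sup>2))"
  proof -
    have [measurable]: "(\<lambda>\<omega>. \<integral>\<^sup>+g. ?I \<omega> g \<partial>?N) \<in> borel_measurable M"
      using N.borel_measurable_nn_integral_fst[OF Im] by simp
    show ?thesis by (subst nn_integral_add) (auto simp: nn_integral_cmult emeasure_space_1)
  qed
  also have "(\<integral>\<^sup>+\<omega>. \<integral>\<^sup>+g. ?I \<omega> g \<partial>?N \<partial>M) = emeasure M {\<omega> \<in> space M. (\<lambda>t\<in>F. X t \<omega>) \<in> B}"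
    using tr[OF mi] em[OF mi] by (simp only:)
  finally show ?thesis
    by (rule order_trans) (use m2 l in \<open>intro add_left_mono ennreal_leI mult_left_mono, auto\<close>)
qed

end

text \<open>The rational times make \<open>near_diff\<close> depend on countably many coordinates of the path; for a
  path that is continuous on the intervals \<open>I\<close> and \<open>J\<close> it says that \<open>z\<close> is a difference
  \<open>w s - w t\<close>.\<close>

definition near_diff :: "(real \<Rightarrow> 'a::real_normed_vector) \<Rightarrow> real set \<Rightarrow> real set \<Rightarrow> 'a \<Rightarrow> bool" where
  "near_diff w I J z \<longleftrightarrow> (\<forall>m::nat. \<exists>s\<in>I \<inter> \<rat>. \<exists>t\<in>J \<inter> \<rat>. norm (w s - w t - z) < 1 / Suc m)"

text \<open>The differences over a product of compact intervals form a compact, hence closed, set,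
  so approximation yields an exact hit. Conversely, the rationals are dense in each nondegenerate
  interval and the path is continuous there.\<close>

lemma near_diff_iff:
  assumes "a < b" "c < d" and w: "continuous_on {a..b} w" "continuous_on {c..d} w"
  shows "near_diff w {a..b} {c..d} z \<longleftrightarrow> (\<exists>s\<in>{a..b}. \<exists>t\<in>{c..d}. w s - w t = z)"
proof
  let ?S = "(\<lambda>p. w (fst p) - w (snd p)) ` ({a..b} \<times> {c..d})"
  assume near: "near_diff w {a..b} {c..d} z"
  have "compact ?S"
    by (intro compact_continuous_image compact_Times compact_Icc continuous_on_diff
        continuous_on_compose2[OF w(1)] continuous_on_compose2[OF w(2)] continuous_intros) auto
  then have cl: "closed ?S" by (rule compact_imp_closed)
  have "z \<in> closure ?S"
    unfolding closure_approachable
  proof (intro allI impI)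
    fix e :: real assume "0 < e"
    then obtain m where m: "1 / real (Suc m) < e" using nat_approx_posE by blast
    obtain s t where "s \<in> {a..b}" "t \<in> {c..d}" "norm (w s - w t - z) < 1 / Suc m"
      using near unfolding near_diff_def by blast
    then show "\<exists>y\<in>?S. dist y z < e"
      using m by (intro bexI[of _ "w s - w t"]) (auto simp: dist_norm intro!: rev_image_eqI[of "(s, t)"])
  qed
  then have "z \<in> ?S" using cl by simp
  then show "\<exists>s\<in>{a..b}. \<exists>t\<in>{c..d}. w s - w t = z" by force
next
  have dense: "\<exists>s'\<in>{x..y} \<inter> \<rat>. norm (w s' - w s) < e" if xy: "x < y" "continuous_on {x..y} w" "s \<in> {x..y}" "0 < e" for x y s e
  proof -
    obtain \<delta> where \<delta>: "\<delta> > 0" "\<And>s'. s' \<in> {x..y} \<Longrightarrow> dist s' s < \<delta> \<Longrightarrow> dist (w s') (w s) < e"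
      using xy(2)[unfolded continuous_on_iff, rule_format, OF xy(3,4)] by blast
    have "max x (s - \<delta>) < min y (s + \<delta>)" using xy \<delta> by auto
    then obtain r where r: "r \<in> \<rat>" "max x (s - \<delta>) < r" "r < min y (s + \<delta>)" using Rats_dense_in_real by blast
    then show ?thesis using \<delta>(2)[of r] by (intro bexI[of _ r]) (auto simp: dist_norm)
  qed
  assume "\<exists>s\<in>{a..b}. \<exists>t\<in>{c..d}. w s - w t = z"
  then obtain s t where st: "s \<in> {a..b}" "t \<in> {c..d}" "w s - w t = z" by blast
  show "near_diff w {a..b} {c..d} z"
    unfolding near_diff_def
  proof
    fix m :: nat
    have e: "0 < 1 / real (Suc m) / 2" by simp
    obtain s' where s': "s' \<in> {a..b} \<inter> \<rat>" "norm (w s' - w s) < 1 / Suc m / 2" using dense[OF assms(1) w(1) st(1) e] by blast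
    obtain t' where t': "t' \<in> {c..d} \<inter> \<rat>" "norm (w t' - w t) < 1 / Suc m / 2" using dense[OF assms(2) w(2) st(2) e] by blast
    have "w s' - w t' - z = (w s' - w s) - (w t' - w t)" using st(3) by (simp add: algebra_simps)
    then have "norm (w s' - w t' - z) \<le> norm (w s' - w s) + norm (w t' - w t)" by (metis norm_triangle_ineq4)
    also have "\<dots> < 1 / Suc m / 2 + 1 / Suc m / 2" using s' t' by (intro add_strict_mono)
    finally have "norm (w s' - w t' - z) < 1 / Suc m" by (simp only: field_sum_of_halves)
    then show "\<exists>s\<in>{a..b} \<inter> \<rat>. \<exists>t\<in>{c..d} \<inter> \<rat>. norm (w s - w t - z) < 1 / Suc m" using s' t' by blast
  qed
qed

lemma near_diff_cong:
  assumes "\<And>t. t \<in> I \<union> J \<Longrightarrow> w t = w' t"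
  shows "near_diff w I J z = near_diff w' I J z"
  using assms unfolding near_diff_def by auto

lemma near_diff_translate: "near_diff (\<lambda>t. w t - a) I J z = near_diff w I J z"
  unfolding near_diff_def by simp

lemma measurable_near_diff:
  fixes Y :: "real \<Rightarrow> 'a \<Rightarrow> 'v::{real_normed_vector, second_countable_topology}"
  assumes Y: "\<And>t. t \<in> I \<union> J \<Longrightarrow> Y t \<in> borel_measurable N" and g[measurable]: "g \<in> borel_measurable N"
  shows "Measurable.pred N (\<lambda>x. near_diff (\<lambda>t. Y t x) I J (g x))"
proof -
  have c: "countable (I \<inter> \<rat>)" "countable (J \<inter> \<rat>)" by (auto intro: countable_subset[OF _ countable_rat])
  have [measurable]: "Measurable.pred N (\<lambda>x. norm (Y s x - Y t x - g x) < 1 / Suc m)" if "s \<in> I \<inter> \<rat>" "t \<in> J \<inter> \<rat>" for s t m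
  proof -
    have [measurable]: "Y s \<in> borel_measurable N" "Y t \<in> borel_measurable N" using Y that by auto
    show ?thesis by measurable
  qed
  have 1: "{x \<in> space N. norm (Y s x - Y t x - g x) < 1 / Suc m} \<in> sets N" if "s \<in> I \<inter> \<rat>" "t \<in> J \<inter> \<rat>" for s t m
    using that by measurable
  show ?thesis unfolding near_diff_def pred_def
    using 1 by (intro sets.sets_Collect_countable_All sets.sets_Collect_countable_Ex' c)
qed

section \<open>Shifts and equality in law for events on whole paths\<close>

context fractional_brownian_motion
begin

text \<open>Each \<Phi> m j looks at finitely many times, so the finite-dimensional bound holds for
  the union over \<open>j < k\<close>. It passes to the increasing limit in \<open>k\<close> and
  then to the decreasing limit in \<open>m\<close> because its constants do not depend on the set of
  times.\<close>

lemma path_shift_bound: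
  fixes v :: "real ^ 'n" and \<Phi> :: "nat \<Rightarrow> nat \<Rightarrow> (real \<Rightarrow> real ^ 'n) \<Rightarrow> bool"
  assumes H: "H < 1 / 2" and u: "3 \<le> u" and l: "0 < l"
    and S: "0 < S" "9 / (H * (1 - 2 * H)) * (norm v)\<^sup>2 \<le> S"
    and T: "\<And>j. finite (T j)" "\<And>j. T j \<subseteq> {0..}"
    and meas: "\<And>m j. {w \<in> space (Pi\<^sub>M (T j) (\<lambda>_. borel)). \<Phi> m j w} \<in> sets (Pi\<^sub>M (T j) (\<lambda>_. borel))"
    and dep: "\<And>m j w. \<Phi> m j (restrict w (T j)) = \<Phi> m j w"
    and mono: "\<And>m j w. \<Phi> (Suc m) j w \<Longrightarrow> \<Phi> m j w"
  shows "emeasure M {\<omega> \<in> space M. \<forall>m. \<exists>j. \<Phi> m j (\<lambda>t. X t \<omega> + bump u t *\<^sub>R v)} \<le>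
    ennreal (1 / (2 * l)) * emeasure M {\<omega> \<in> space M. \<forall>m. \<exists>j. \<Phi> m j (\<lambda>t. X t \<omega>)} + ennreal (l / 2 * exp S)"
proof -
  let ?a = "ennreal (1 / (2 * l))"
  let ?b = "ennreal (l / 2 * exp S)"
  let ?Xb = "\<lambda>y \<omega> t. X t \<omega> + bump u t *\<^sub>R y"
  \<comment> \<open>The parameter \<open>y\<close> covers both sides at once: \<open>v\<close> gives
    the shifted path and \<open>0\<close> the original one.\<close>
  define E where "E y m k = {\<omega> \<in> space M. \<exists>j<k. \<Phi> m j (?Xb y \<omega>)}" for y m k
  have ev: "E y m k \<in> sets M \<and> emeasure M (E v m k) \<le> ?a * emeasure M (E 0 m k) + ?b" for y m k
  proof -
    define F where "F = (\<Union>j<k. T j)"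
    have F: "finite F" "F \<subseteq> {0..}" using T by (auto simp: F_def)
    let ?P = "Pi\<^sub>M F (\<lambda>_. borel :: (real ^ 'n) measure)"
    define B where "B = {w \<in> space ?P. \<exists>j<k. \<Phi> m j w}"
    have Bj: "{w \<in> space ?P. \<Phi> m j w} \<in> sets ?P" if "j < k" for j
    proof -
      have r: "(\<lambda>w. restrict w (T j)) \<in> measurable ?P (Pi\<^sub>M (T j) (\<lambda>_. borel))"
        using that by (intro measurable_restrict_subset) (auto simp: F_def)
      have "(\<lambda>w. restrict w (T j)) -` {w \<in> space (Pi\<^sub>M (T j) (\<lambda>_. borel)). \<Phi> m j w} \<inter> space ?P \<in> sets ?P"
        by (rule measurable_sets[OF r meas])
      also have "(\<lambda>w. restrict w (T j)) -` {w \<in> space (Pi\<^sub>M (T j) (\<lambda>_. borel)). \<Phi> m j w} \<inter> space ?P = {w \<in> space ?P. \<Phi> m j w}"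
        using measurable_space[OF r] by (simp only: vimage_def Int_def mem_Collect_eq dep) blast
      finally show ?thesis .
    qed
    have "B = (\<Union>j\<in>{..<k}. {w \<in> space ?P. \<Phi> m j w})"
      unfolding B_def by blast
    also have "\<dots> \<in> sets ?P"
      by (rule sets.finite_UN) (simp_all only: finite_lessThan lessThan_iff Bj)
    finally have B: "B \<in> sets ?P" .
    have dep': "(\<lambda>t\<in>F. w t) \<in> B \<longleftrightarrow> (\<exists>j<k. \<Phi> m j w)" for w
    proof -
      have "\<Phi> m j (restrict w F) = \<Phi> m j w" if "j < k" for j
      proof -
        have "restrict (restrict w F) (T j) = restrict w (T j)"
          using that by (auto simp: restrict_def F_def)
        then show ?thesis using dep[of m j "restrict w F"] dep[of m j w] by simp
      qed
      then show ?thesis by (auto simp: B_def space_PiM)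
    qed
    have E: "E y m k = {\<omega> \<in> space M. (\<lambda>t\<in>F. X t \<omega> + bump u t *\<^sub>R y) \<in> B}" for y
      unfolding E_def dep' ..
    have "(\<lambda>\<omega>. \<lambda>t\<in>F. X t \<omega> + bump u t *\<^sub>R y) \<in> measurable M ?P"
      using measurable_X F by (intro measurable_restrict borel_measurable_add) auto
    from measurable_sets[OF this B] have "E y m k \<in> sets M" unfolding E by (simp add: vimage_def Int_def conj_commute)
    moreover have "emeasure M {\<omega> \<in> space M. (\<lambda>t\<in>F. X t \<omega> + bump u t *\<^sub>R v) \<in> B} \<le>
      ?a * emeasure M {\<omega> \<in> space M. (\<lambda>t\<in>F. X t \<omega>) \<in> B} + ?b"
      by (rule finite_shift_bound[OF F B fbm_cov_bump_le[OF Hurst_parameter(1) H u F] S l])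
    ultimately show ?thesis unfolding E by simp
  qed
  note Es[measurable] = conjunct1[OF ev] and Eb = conjunct2[OF ev]
  have incr: "incseq (E y m)" for y m by (auto simp: incseq_def E_def intro: order_less_le_trans)
  define G where "G y m = (\<Union>k. E y m k)" for y m
  have Gs: "G y m \<in> sets M" for y m by (auto simp: G_def)
  have Gl: "(\<lambda>k. emeasure M (E y m k)) \<longlonglongrightarrow> emeasure M (G y m)" for y m
    unfolding G_def by (rule Lim_emeasure_incseq) (use incr in auto)
  have Geq: "G y m = {\<omega> \<in> space M. \<exists>j. \<Phi> m j (?Xb y \<omega>)}" for y m
    by (auto simp: G_def E_def)
  have decr: "decseq (G y)" for y
    unfolding decseq_Suc_iff
  proof (intro allI subsetI)
    fix m \<omega> assume "\<omega> \<in> G y (Suc m)"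
    then obtain j where j: "\<omega> \<in> space M" "\<Phi> (Suc m) j (?Xb y \<omega>)" by (auto simp only: Geq mem_Collect_eq)
    then show "\<omega> \<in> G y m" using mono[OF j(2)] by (auto simp only: Geq mem_Collect_eq)
  qed
  have Gb: "emeasure M (G v m) \<le> ?a * emeasure M (G 0 m) + ?b" for m
  proof (rule LIMSEQ_le[OF Gl])
    show "(\<lambda>k. ?a * emeasure M (E 0 m k) + ?b) \<longlonglongrightarrow> ?a * emeasure M (G 0 m) + ?b"
      by (intro tendsto_add ennreal_tendsto_cmult Gl tendsto_const) auto
  qed (use Eb in auto)
  have Il: "(\<lambda>m. emeasure M (G y m)) \<longlonglongrightarrow> emeasure M (\<Inter>m. G y m)" for y
    by (rule Lim_emeasure_decseq) (use decr Gs in auto)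
  have "emeasure M (\<Inter>m. G v m) \<le> ?a * emeasure M (\<Inter>m. G 0 m) + ?b"
  proof (rule LIMSEQ_le[OF Il])
    show "(\<lambda>m. ?a * emeasure M (G 0 m) + ?b) \<longlonglongrightarrow> ?a * emeasure M (\<Inter>m. G 0 m) + ?b"
      by (intro tendsto_add ennreal_tendsto_cmult Il tendsto_const) auto
  qed (use Gb in auto)
  moreover have "(\<Inter>m. G y m) = {\<omega> \<in> space M. \<forall>m. \<exists>j. \<Phi> m j (?Xb y \<omega>)}" for y
    by (auto simp: Geq)
  ultimately show ?thesis by simp
qed

lemma same_law_nn_integral:
  fixes Y Z :: "real \<Rightarrow> 'w \<Rightarrow> real ^ 'n"
  assumes law: "same_law M {0..} Y Z" and Y: "\<And>t. 0 \<le> t \<Longrightarrow> Y t \<in> borel_measurable M" and Z: "\<And>t. 0 \<le> t \<Longrightarrow> Z t \<in> borel_measurable M"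
    and f: "f \<in> borel_measurable (Pi\<^sub>M {0..} (\<lambda>_. borel :: (real ^ 'n) measure))"
  shows "(\<integral>\<^sup>+\<omega>. f (\<lambda>t\<in>{0..}. Y t \<omega>) \<partial>M) = (\<integral>\<^sup>+\<omega>. f (\<lambda>t\<in>{0..}. Z t \<omega>) \<partial>M)"
proof -
  let ?P = "Pi\<^sub>M {0::real..} (\<lambda>_. borel :: (real ^ 'n) measure)"
  have 1: "(\<lambda>\<omega>. \<lambda>t\<in>{0..}. Y t \<omega>) \<in> measurable M ?P" using Y by (intro measurable_restrict) auto
  have 2: "(\<lambda>\<omega>. \<lambda>t\<in>{0..}. Z t \<omega>) \<in> measurable M ?P" using Z by (intro measurable_restrict) auto
  show ?thesis
    using nn_integral_distr[OF 1, of f] nn_integral_distr[OF 2, of f] f law by (simp add: same_law_def)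
qed

text \<open>\<open>near_diff\<close> reads the path only at rational times, so it is measurable for
  the product algebra, jointly with \<open>z\<close>; this joint measurability makes the Lebesgue
  measure of the difference set a measurable functional of the path.\<close>

lemma same_law_near_diff:
  fixes Y Z :: "real \<Rightarrow> 'w \<Rightarrow> real ^ 'n"
  assumes law: "same_law M {0..} Y Z" and Y: "\<And>t. 0 \<le> t \<Longrightarrow> Y t \<in> borel_measurable M" and Z: "\<And>t. 0 \<le> t \<Longrightarrow> Z t \<in> borel_measurable M"
    and IJ: "I \<subseteq> {0..}" "J \<subseteq> {0..}"
  shows "(\<integral>\<^sup>+\<omega>. emeasure lborel {z. near_diff (\<lambda>t. Y t \<omega>) I J z} \<partial>M) = (\<integral>\<^sup>+\<omega>. emeasure lborel {z. near_diff (\<lambda>t. Z t \<omega>) I J z} \<partial>M)"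
    and "emeasure M {\<omega> \<in> space M. near_diff (\<lambda>t. Y t \<omega>) I J z} = emeasure M {\<omega> \<in> space M. near_diff (\<lambda>t. Z t \<omega>) I J z}"
proof -
  let ?P = "Pi\<^sub>M {0::real..} (\<lambda>_. borel :: (real ^ 'n) measure)"
  have e: "near_diff (\<lambda>t\<in>{0..}. w t) I J z = near_diff w I J z" for w :: "real \<Rightarrow> real ^ 'n" and z
    using IJ by (intro near_diff_cong) auto
  let ?R = "{p \<in> space (?P \<Otimes>\<^sub>M lborel). near_diff (\<lambda>t. fst p t) I J (snd p)}"
  have m1: "Measurable.pred (?P \<Otimes>\<^sub>M lborel) (\<lambda>p. near_diff (\<lambda>t. fst p t) I J (snd p))"
    using IJ by (intro measurable_near_diff measurable_compose[OF measurable_fst] measurable_component_singleton) auto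
  then have "?R \<in> sets (?P \<Otimes>\<^sub>M lborel)"
    by (simp only: pred_def)
  from lborel.measurable_emeasure_Pair[OF this]
  have "(\<lambda>w. emeasure lborel (Pair w -` ?R)) \<in> borel_measurable ?P" .
  moreover have "Pair w -` ?R = {z. near_diff w I J z}" if "w \<in> space ?P" for w
    using that by (auto simp: space_pair_measure)
  ultimately have "(\<lambda>w. emeasure lborel {z. near_diff w I J z}) \<in> borel_measurable ?P"
    by (simp cong: measurable_cong)
  from same_law_nn_integral[OF law Y Z this]
  show "(\<integral>\<^sup>+\<omega>. emeasure lborel {z. near_diff (\<lambda>t. Y t \<omega>) I J z} \<partial>M) = (\<integral>\<^sup>+\<omega>. emeasure lborel {z. near_diff (\<lambda>t. Z t \<omega>) I J z} \<partial>M)"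
    by (simp add: e)
  have m2: "Measurable.pred ?P (\<lambda>w. near_diff (\<lambda>t. w t) I J z)"
    using IJ by (intro measurable_near_diff measurable_component_singleton) auto
  then have B: "{w \<in> space ?P. near_diff w I J z} \<in> sets ?P" by simp
  have em: "emeasure M {\<omega> \<in> space M. near_diff (\<lambda>t. V t \<omega>) I J z} = (\<integral>\<^sup>+\<omega>. indicator {w \<in> space ?P. near_diff w I J z} (\<lambda>t\<in>{0..}. V t \<omega>) \<partial>M)"
    if V: "\<And>t. 0 \<le> t \<Longrightarrow> V t \<in> borel_measurable M" for V
  proof -
    have "Measurable.pred M (\<lambda>\<omega>. near_diff (\<lambda>t. V t \<omega>) I J z)"
      using IJ V by (intro measurable_near_diff) auto
    then have "emeasure M {\<omega> \<in> space M. near_diff (\<lambda>t. V t \<omega>) I J z} = (\<integral>\<^sup>+\<omega>. indicator {\<omega> \<in> space M. near_diff (\<lambda>t. V t \<omega>) I J z} \<omega> \<partial>M)"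
      by (subst nn_integral_indicator) auto
    also have "\<dots> = (\<integral>\<^sup>+\<omega>. indicator {w \<in> space ?P. near_diff w I J z} (\<lambda>t\<in>{0..}. V t \<omega>) \<partial>M)"
      by (intro nn_integral_cong) (auto simp: indicator_def e space_PiM)
    finally show ?thesis .
  qed
  show "emeasure M {\<omega> \<in> space M. near_diff (\<lambda>t. Y t \<omega>) I J z} = emeasure M {\<omega> \<in> space M. near_diff (\<lambda>t. Z t \<omega>) I J z}"
    by (rule trans[OF em[OF Y] trans[OF same_law_nn_integral[OF law Y Z] em[OF Z, symmetric]]]) (use B in auto)
qed

end

section \<open>Moments of oscillations\<close>

text \<open>A grid point with odd index on level k + 1 has its left neighbour on level k, so each
  level costs at most one increment.\<close>

lemma dyadic_chaining:
  fixes f :: "real \<Rightarrow> 'v::real_normed_vector"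
  assumes D: "\<And>k j. j < 2 ^ k \<Longrightarrow> norm (f (real (Suc j) / 2 ^ k) - f (real j / 2 ^ k)) \<le> D k"
    and D0: "\<And>k. 0 \<le> D k"
  shows "j \<le> 2 ^ k \<Longrightarrow> norm (f (real j / 2 ^ k) - f 0) \<le> (\<Sum>i\<le>k. D i)"
proof (induction k arbitrary: j)
  case 0
  then have "j = 0 \<or> j = 1" by auto
  then show ?case using D[of 0 0] D0[of 0] by (elim disjE) simp_all
next
  case (Suc k)
  have even: "norm (f (real (2 * i) / 2 ^ Suc k) - f 0) \<le> (\<Sum>i\<le>k. D i)" if "2 * i \<le> 2 ^ Suc k" for i
  proof -
    have "real (2 * i) / 2 ^ Suc k = real i / 2 ^ k" by simp
    then show ?thesis using Suc.IH[of i] that by (simp only:) simp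
  qed
  show ?case
  proof (cases "even j")
    case True
    then obtain i where "j = 2 * i" by (elim evenE)
    then show ?thesis using even[of i] Suc.prems D0[of "Suc k"] by simp
  next
    case False
    then obtain i where i: "j = Suc (2 * i)" by (auto elim: oddE)
    have "norm (f (real j / 2 ^ Suc k) - f 0) = norm ((f (real (Suc (2 * i)) / 2 ^ Suc k) - f (real (2 * i) / 2 ^ Suc k)) + (f (real (2 * i) / 2 ^ Suc k) - f 0))"
      by (simp add: i)
    also have "\<dots> \<le> norm (f (real (Suc (2 * i)) / 2 ^ Suc k) - f (real (2 * i) / 2 ^ Suc k)) + norm (f (real (2 * i) / 2 ^ Suc k) - f 0)"
      by (rule norm_triangle_ineq)
    also have "\<dots> \<le> D (Suc k) + (\<Sum>i\<le>k. D i)"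
      using Suc.prems i by (intro add_mono D even) auto
    finally show ?thesis by simp
  qed
qed

text \<open>Kolmogorov's chaining with geometrically decaying increments: the dyadic points below
  \<open>t\<close> converge to \<open>t\<close>, and continuity transfers the bound by the geometric
  series.\<close>

lemma continuous_chaining:
  fixes f :: "real \<Rightarrow> 'v::real_normed_vector"
  assumes c: "continuous_on {0..1} f" and q: "0 \<le> q" "q < 1" and A: "0 \<le> A"
    and D: "\<And>k j. j < 2 ^ k \<Longrightarrow> norm (f (real (Suc j) / 2 ^ k) - f (real j / 2 ^ k)) \<le> A * q ^ k"
    and t: "t \<in> {0..1}"
  shows "norm (f t - f 0) \<le> A / (1 - q)"
proof -
  define d where "d k = nat \<lfloor>2 ^ k * t\<rfloor>" for k
  have dr: "real (d k) = of_int \<lfloor>2 ^ k * t\<rfloor>" for k using t by (simp add: d_def)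
  have d1: "real (d k) \<le> 2 ^ k * t" "2 ^ k * t - 1 < real (d k)" for k
    unfolding dr by linarith+
  have dle: "d k \<le> 2 ^ k" for k
  proof -
    have "2 ^ k * t \<le> 2 ^ k" using t by (simp add: mult_left_le)
    then have "real (d k) \<le> 2 ^ k" using d1(1)[of k] by linarith
    then have "real (d k) \<le> real (2 ^ k)" by (simp only: of_nat_power of_nat_numeral)
    then show ?thesis by (simp only: of_nat_le_iff)
  qed
  have in01: "real (d k) / 2 ^ k \<in> {0..1}" for k
  proof -
    have "real (d k) \<le> real (2 ^ k)" using dle[of k] by (simp only: of_nat_le_iff)
    then show ?thesis by simp
  qed
  have lim: "(\<lambda>k. real (d k) / 2 ^ k) \<longlonglongrightarrow> t"
  proof (rule real_tendsto_sandwich)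
    show "\<forall>\<^sub>F k in sequentially. t - (1 / 2) ^ k \<le> real (d k) / 2 ^ k"
    proof (intro always_eventually allI)
      fix k
      have "t - (1 / 2) ^ k = (2 ^ k * t - 1) / 2 ^ k" by (simp add: power_divide diff_divide_distrib)
      also have "\<dots> \<le> real (d k) / 2 ^ k" using d1(2)[of k] by (intro divide_right_mono) auto
      finally show "t - (1 / 2) ^ k \<le> real (d k) / 2 ^ k" .
    qed
    show "\<forall>\<^sub>F k in sequentially. real (d k) / 2 ^ k \<le> t"
      using d1(1) by (auto simp: field_simps)
    have "(\<lambda>k. t - (1 / 2) ^ k) \<longlonglongrightarrow> t - 0"
      by (intro tendsto_diff tendsto_const LIMSEQ_power_zero) auto
    then show "(\<lambda>k. t - (1 / 2) ^ k) \<longlonglongrightarrow> t" by simp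
  qed auto
  have "(\<lambda>k. f (real (d k) / 2 ^ k)) \<longlonglongrightarrow> f t"
    using in01 by (intro continuous_on_tendsto_compose[OF c lim t] always_eventually) blast
  then have "(\<lambda>k. norm (f (real (d k) / 2 ^ k) - f 0)) \<longlonglongrightarrow> norm (f t - f 0)"
    by (intro tendsto_intros)
  moreover have "norm (f (real (d k) / 2 ^ k) - f 0) \<le> A / (1 - q)" for k
  proof -
    have "norm (f (real (d k) / 2 ^ k) - f 0) \<le> (\<Sum>i\<le>k. A * q ^ i)"
      using A q by (intro dyadic_chaining D dle) auto
    also have "\<dots> = A * (\<Sum>i\<le>k. q ^ i)" by (simp add: sum_distrib_left)
    also have "\<dots> \<le> A * (1 / (1 - q))"
    proof (rule mult_left_mono[OF _ A])
      have "(\<Sum>i\<le>k. q ^ i) \<le> (\<Sum>i. q ^ i)"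
        using q by (intro sum_le_suminf) (auto simp: summable_geometric)
      then show "(\<Sum>i\<le>k. q ^ i) \<le> 1 / (1 - q)" using q by (simp add: suminf_geometric)
    qed
    finally show ?thesis by simp
  qed
  ultimately show ?thesis by (intro LIMSEQ_le_const2) auto
qed

context fractional_brownian_motion
begin

lemma increment_norm_moment:
  assumes "0 \<le> s" "s < t"
  shows "(\<integral>\<^sup>+\<omega>. ennreal (norm (X t \<omega> - X s \<omega>) ^ p) \<partial>M) = ennreal (((t - s) powr H) ^ p) * (\<integral>\<^sup>+\<omega>. ennreal (norm (X 1 \<omega>) ^ p) \<partial>M)"
proof -
  have [measurable]: "X t \<in> borel_measurable M" "X s \<in> borel_measurable M" "X 1 \<in> borel_measurable M"
    using assms by (auto intro: measurable_X)
  let ?g = "\<lambda>x :: real ^ 'n. ennreal (norm x ^ p)"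
  let ?r = "(t - s) powr H"
  have "(\<integral>\<^sup>+\<omega>. ?g (X t \<omega> - X s \<omega>) \<partial>M) = (\<integral>\<^sup>+x. ?g x \<partial>distr M borel (\<lambda>\<omega>. X t \<omega> - X s \<omega>))"
    by (subst nn_integral_distr) auto
  also have "\<dots> = (\<integral>\<^sup>+\<omega>. ?g (?r *\<^sub>R X 1 \<omega>) \<partial>M)"
    unfolding increment_distr[OF assms] by (subst nn_integral_distr) auto
  also have "\<dots> = (\<integral>\<^sup>+\<omega>. ennreal (?r ^ p) * ?g (X 1 \<omega>) \<partial>M)"
    by (intro nn_integral_cong) (simp add: power_mult_distrib ennreal_mult)
  also have "\<dots> = ennreal (?r ^ p) * (\<integral>\<^sup>+\<omega>. ?g (X 1 \<omega>) \<partial>M)"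
    by (rule nn_integral_cmult) auto
  finally show ?thesis .
qed

lemma norm_1_moment_finite: "(\<integral>\<^sup>+\<omega>. ennreal (norm (X 1 \<omega>) ^ (2 * p)) \<partial>M) < \<infinity>"
proof -
  let ?n = "real CARD('n)"
  have i: "integrable M (\<lambda>\<omega>. (X 1 \<omega> $ i) ^ (2 * p))" for i
    using distributed_integrable[OF component_1_standard_normal[of i], of "\<lambda>x. x ^ (2 * p)"] integrable_std_normal_moment[of "2 * p"] by simp
  have le: "norm x ^ (2 * p) \<le> ?n ^ (2 * p) * (\<Sum>i\<in>UNIV. (x $ i) ^ (2 * p))" for x :: "real ^ 'n"
  proof -
    obtain i where i: "\<And>j. \<bar>x $ j\<bar> \<le> \<bar>x $ i\<bar>"
    proof -
      have "Max (range (\<lambda>j. \<bar>x $ j\<bar>)) \<in> range (\<lambda>j. \<bar>x $ j\<bar>)" by (intro Max_in) auto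
      then obtain i where "\<bar>x $ i\<bar> = Max (range (\<lambda>j. \<bar>x $ j\<bar>))" by force
      then show ?thesis by (intro that[of i]) auto
    qed
    have "norm x \<le> (\<Sum>j\<in>UNIV. \<bar>x $ j\<bar>)" by (rule norm_le_l1_cart)
    also have "\<dots> \<le> (\<Sum>j\<in>(UNIV :: 'n set). \<bar>x $ i\<bar>)" by (intro sum_mono i)
    finally have "norm x \<le> ?n * \<bar>x $ i\<bar>" by simp
    then have "norm x ^ (2 * p) \<le> (?n * \<bar>x $ i\<bar>) ^ (2 * p)" by (intro power_mono) auto
    also have "\<dots> = ?n ^ (2 * p) * (x $ i) ^ (2 * p)" by (simp add: power_mult_distrib power_mult)
    also have "\<dots> \<le> ?n ^ (2 * p) * (\<Sum>i\<in>UNIV. (x $ i) ^ (2 * p))"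
      by (intro mult_left_mono member_le_sum) (auto simp: power_mult)
    finally show ?thesis .
  qed
  have "(\<integral>\<^sup>+\<omega>. ennreal (norm (X 1 \<omega>) ^ (2 * p)) \<partial>M) \<le> (\<integral>\<^sup>+\<omega>. ennreal (?n ^ (2 * p) * (\<Sum>i\<in>UNIV. (X 1 \<omega> $ i) ^ (2 * p))) \<partial>M)"
    by (intro nn_integral_mono ennreal_leI le)
  also have "\<dots> < \<infinity>"
    using i by (subst nn_integral_eq_integral) (auto intro!: sum_nonneg always_eventually mult_nonneg_nonneg zero_le_even_power)
  finally show ?thesis .
qed

end

locale critical_fbm = fractional_brownian_motion M H X
  for M :: "'w measure" and H :: real and X :: "real \<Rightarrow> 'w \<Rightarrow> real ^ 'n" +
  assumes H_less: "H < 1 / 2" and critical: "real CARD('n) = 2 / H"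
begin

text \<open>The exponent is twice the dimension because the square of a volume is compared with this
  power of a diameter. As n H = 2, the corresponding increment moment decays like the fourth power
  of the time step, more than chaining needs.\<close>

lemma powr_H_dim: "0 < r \<Longrightarrow> (r powr H) ^ (2 * CARD('n)) = r ^ 4"
proof -
  assume r: "0 < r"
  have "(r powr H) ^ (2 * CARD('n)) = (r powr H) powr real (2 * CARD('n))"
    using r by (simp only: powr_realpow powr_gt_zero)
  also have "\<dots> = r powr (H * real (2 * CARD('n)))" by (rule powr_powr)
  also have "H * real (2 * CARD('n)) = 4" using critical Hurst_parameter by (simp add: field_simps)
  finally show ?thesis using r powr_realpow[of r 4] by simp
qed

text \<open>A measurable majorant takes the place of the supremum of the oscillation over an
  uncountable set of times.\<close>

definition osc_bound :: "real \<Rightarrow> real \<Rightarrow> ('w \<Rightarrow> ennreal) \<Rightarrow> bool" where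
  "osc_bound C x U \<longleftrightarrow> U \<in> borel_measurable M \<and> (\<integral>\<^sup>+\<omega>. U \<omega> \<partial>M) \<le> ennreal C \<and>
    (\<forall>\<omega>\<in>space M. \<forall>s\<in>{x..x+1}. ennreal (norm (X s \<omega> - X x \<omega>) ^ (2 * CARD('n))) \<le> U \<omega>)"

lemma osc_boundD:
  assumes "osc_bound C x U"
  shows "U \<in> borel_measurable M" "(\<integral>\<^sup>+\<omega>. U \<omega> \<partial>M) \<le> ennreal C"
    "\<And>\<omega> s. \<omega> \<in> space M \<Longrightarrow> s \<in> {x..x+1} \<Longrightarrow> ennreal (norm (X s \<omega> - X x \<omega>) ^ (2 * CARD('n))) \<le> U \<omega>"
  using assms by (auto simp: osc_bound_def)

text \<open>Chaining over the dyadic points of {x..x+1}. Stationary increments make the constant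
  independent of \<open>x\<close>, which is what uniformity in the position of the squares rests
  on.\<close>

lemma oscillation_moment:
  obtains C :: real where "0 \<le> C" and
    "\<And>x. 0 \<le> x \<Longrightarrow> \<exists>U. osc_bound C x U"
proof -
  have n0: "0 < CARD('n)" by simp
  let ?p = "(2 * CARD('n))"
  define m where "m = (\<integral>\<^sup>+\<omega>. ennreal (norm (X 1 \<omega>) ^ ?p) \<partial>M)"
  have m: "m < \<infinity>" unfolding m_def by (rule norm_1_moment_finite)
  \<comment> \<open>Matched to the weight \<open>4 ^ k\<close> below: a bound on the weighted sum
    leaves a factor \<open>(1 / 4) ^ k\<close> in the power of each increment, and its root of order
    \<open>?p\<close> is \<open>q ^ k\<close>.\<close>
  define q :: real where "q = root ?p (1 / 4)"
  have q: "0 < q" "q < 1" "q ^ ?p = 1 / 4"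
    using n0 by (auto simp: q_def real_root_lt_1_iff)
  define c where "c = (1 / (1 - q)) ^ ?p"
  have c: "0 \<le> c" using q by (simp add: c_def)
  define C where "C = enn2real (ennreal c * (2 * m))"
  have eC: "ennreal c * (2 * m) = ennreal C"
    unfolding C_def using m by (simp add: ennreal_mult_less_top ennreal_mult_eq_top_iff less_top)
  show ?thesis
  proof (rule that[of C])
    show "0 \<le> C" by (simp add: C_def)
    fix x :: real assume x: "0 \<le> x"
    define t where "t k j = x + real j / 2 ^ k" for k j
    have t0: "0 \<le> t k j" for k j using x by (simp add: t_def)
    have [measurable]: "X (t k j) \<in> borel_measurable M" for k j using t0 by (rule measurable_X)
    let ?D = "\<lambda>k j \<omega>. norm (X (t k (Suc j)) \<omega> - X (t k j) \<omega>)"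
    \<comment> \<open>Each term has mean \<open>(1 / 4) ^ k * m\<close>, since the increment moment
      is a multiple of \<open>(1 / 16) ^ k\<close>. With \<open>2 ^ k\<close> terms the level
      contributes \<open>(1 / 2) ^ k * m\<close>, and the total mean is 2 m.\<close>
    define V where "V \<omega> = (\<Sum>k. \<Sum>j<2 ^ k. ennreal (4 ^ k * ?D k j \<omega> ^ ?p))" for \<omega>
    have [measurable]: "V \<in> borel_measurable M" unfolding V_def by measurable
    have inc: "(\<integral>\<^sup>+\<omega>. ennreal (4 ^ k * ?D k j \<omega> ^ ?p) \<partial>M) = ennreal ((1 / 4) ^ k) * m" for k j
    proof -
      have d: "t k (Suc j) - t k j = 1 / 2 ^ k" by (simp add: t_def field_simps)
      then have lt: "t k j < t k (Suc j)" by (simp add: algebra_simps)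
      have "(\<integral>\<^sup>+\<omega>. ennreal (4 ^ k * ?D k j \<omega> ^ ?p) \<partial>M) = ennreal (4 ^ k) * (\<integral>\<^sup>+\<omega>. ennreal (?D k j \<omega> ^ ?p) \<partial>M)"
        by (subst nn_integral_cmult[symmetric]) (auto simp: ennreal_mult)
      also have "\<dots> = ennreal (4 ^ k) * (ennreal ((1 / 2 ^ k) ^ 4) * m)"
        unfolding increment_norm_moment[OF t0 lt] d by (subst powr_H_dim) (auto simp: m_def)
      also have "\<dots> = ennreal (4 ^ k * (1 / 2 ^ k) ^ 4) * m" by (simp add: ennreal_mult mult.assoc)
      also have "(4 :: real) ^ k * (1 / 2 ^ k) ^ 4 = (1 / 4) ^ k"
      proof -
        have "(1 / 2 ^ k :: real) ^ 4 = ((1 / 2) ^ k) ^ 4" by (simp add: power_divide)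
        also have "\<dots> = ((1 / 2) ^ 4) ^ k" by (simp only: power_mult[symmetric] mult.commute)
        finally have "(1 / 2 ^ k :: real) ^ 4 = (1 / 16) ^ k" by (simp add: power4_eq_xxxx)
        then show ?thesis by (simp add: power_mult_distrib[symmetric])
      qed
      finally show ?thesis .
    qed
    have "(\<integral>\<^sup>+\<omega>. V \<omega> \<partial>M) = (\<Sum>k. \<integral>\<^sup>+\<omega>. (\<Sum>j<2 ^ k. ennreal (4 ^ k * ?D k j \<omega> ^ (2 * CARD('n)))) \<partial>M)"
      unfolding V_def by (rule nn_integral_suminf) measurable
    also have "\<dots> = (\<Sum>k. \<Sum>j<(2::nat) ^ k. ennreal ((1 / 4) ^ k) * m)"
      by (intro suminf_cong, subst nn_integral_sum) (measurable, simp only: inc)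
    also have "\<dots> = (\<Sum>k. ennreal ((1 / 2) ^ k) * m)"
    proof (intro suminf_cong)
      fix k
      have "(\<Sum>j<(2::nat) ^ k. ennreal ((1 / 4) ^ k) * m) = ennreal (2 ^ k) * ennreal ((1 / 4) ^ k) * m"
        by (simp add: mult.assoc ennreal_power[symmetric] ennreal_of_nat_eq_real_of_nat)
      also have "\<dots> = ennreal (2 ^ k * (1 / 4) ^ k) * m" by (simp add: ennreal_mult)
      also have "(2 :: real) ^ k * (1 / 4) ^ k = (1 / 2) ^ k" by (simp add: power_mult_distrib[symmetric])
      finally show "(\<Sum>j<(2::nat) ^ k. ennreal ((1 / 4) ^ k) * m) = ennreal ((1 / 2) ^ k) * m" .
    qed
    also have "\<dots> = 2 * m"
    proof -
      have "(\<Sum>k. ennreal ((1 / 2) ^ k)) = ennreal (\<Sum>k. (1 / 2) ^ k)"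
        by (intro suminf_ennreal2) (auto simp: summable_geometric)
      then have "(\<Sum>k. ennreal ((1 / 2) ^ k)) = 2" by (simp add: suminf_geometric)
      then show ?thesis by simp
    qed
    finally have V: "(\<integral>\<^sup>+\<omega>. V \<omega> \<partial>M) = 2 * m" .
    let ?U = "\<lambda>\<omega>. ennreal c * V \<omega>"
    have "(\<integral>\<^sup>+\<omega>. ?U \<omega> \<partial>M) = ennreal C"
      by (simp add: nn_integral_cmult V eC)
    moreover have "ennreal (norm (X s \<omega> - X x \<omega>) ^ ?p) \<le> ?U \<omega>" if \<omega>: "\<omega> \<in> space M" and s: "s \<in> {x..x+1}" for \<omega> s
    proof (cases "V \<omega> = \<infinity>")
      case True
      have "c > 0" using q by (simp add: c_def)
      then show ?thesis using True by (simp add: ennreal_mult_top)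
    next
      case False
      define A where "A = root ?p (enn2real (V \<omega>))"
      have A0: "0 \<le> A" by (simp add: A_def)
      have Ap: "A ^ ?p = enn2real (V \<omega>)" using n0 by (simp add: A_def)
      have cont: "continuous_on {0..1} (\<lambda>r. X (x + r) \<omega>)"
        using x by (intro continuous_on_compose2[OF continuous_paths[OF \<omega>]] continuous_intros) auto
      have "norm (X (x + (s - x)) \<omega> - X (x + 0) \<omega>) \<le> A / (1 - q)"
      proof (rule continuous_chaining[OF cont _ q(2) A0])
        fix k j assume j: "j < (2::nat) ^ k"
        let ?d = "?D k j \<omega>"
        have "ennreal (4 ^ k * ?d ^ ?p) \<le> (\<Sum>j<2 ^ k. ennreal (4 ^ k * ?D k j \<omega> ^ ?p))"
          using j by (intro member_le_sum) auto
        also have "\<dots> \<le> V \<omega>"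
          unfolding V_def using sum_le_suminf[of "\<lambda>k. \<Sum>j<2 ^ k. ennreal (4 ^ k * ?D k j \<omega> ^ ?p)" "{k}"] by auto
        also have "\<dots> = ennreal (A ^ ?p)" using False by (simp add: Ap less_top)
        finally have "4 ^ k * ?d ^ ?p \<le> A ^ ?p" using A0 by simp
        then have "?d ^ ?p \<le> A ^ ?p * (1 / 4) ^ k" by (simp add: field_simps power_divide)
        also have "\<dots> = (A * q ^ k) ^ ?p"
          unfolding q(3)[symmetric] by (simp add: power_mult_distrib power_mult[symmetric] mult.commute)
        finally have "?d \<le> A * q ^ k"
          using A0 q n0 by (subst (asm) power_mono_iff) auto
        then show "norm (X (x + real (Suc j) / 2 ^ k) \<omega> - X (x + real j / 2 ^ k) \<omega>) \<le> A * q ^ k"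
          by (simp add: t_def)
      qed (use q s in auto)
      then have "norm (X s \<omega> - X x \<omega>) ^ ?p \<le> (A / (1 - q)) ^ ?p" by (intro power_mono) auto
      also have "\<dots> = c * enn2real (V \<omega>)" by (simp add: c_def power_divide Ap)
      finally have "ennreal (norm (X s \<omega> - X x \<omega>) ^ ?p) \<le> ennreal (c * enn2real (V \<omega>))" by (rule ennreal_leI)
      also have "\<dots> = ?U \<omega>" using False c by (simp add: ennreal_mult less_top)
      finally show ?thesis .
    qed
    ultimately show "\<exists>U. osc_bound C x U"
      unfolding osc_bound_def by (intro exI[of _ ?U]) auto
  qed
qed

end

section \<open>Expected measure of the set of differences\<close>

lemma emeasure_lborel_scale:
  fixes P :: "'v::euclidean_space \<Rightarrow> bool"
  assumes k: "0 < k" and [measurable]: "{z. P z} \<in> sets borel"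
  shows "emeasure lborel {z. P ((1 / k) *\<^sub>R z)} = ennreal (k ^ DIM('v)) * emeasure lborel {z. P z}"
proof -
  have m: "(\<lambda>z. (1 / k) *\<^sub>R z) -` {z. P z} \<inter> space borel \<in> sets (borel :: 'v measure)"
    by (rule measurable_sets[of _ borel borel]) auto
  then have m': "{z. P ((1 / k) *\<^sub>R z)} \<in> sets (borel :: 'v measure)" by (simp add: vimage_def)
  have "emeasure lborel {z. P ((1 / k) *\<^sub>R z)} = emeasure (density (distr lborel borel (\<lambda>x. 0 + k *\<^sub>R x)) (\<lambda>_. ennreal (\<bar>k\<bar> ^ DIM('v)))) {z. P ((1 / k) *\<^sub>R z)}"
    using lborel_affine[of k "0 :: 'v"] k by simp
  also have "\<dots> = ennreal (k ^ DIM('v)) * emeasure (distr lborel borel (\<lambda>x. 0 + k *\<^sub>R x)) {z. P ((1 / k) *\<^sub>R z)}"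
    using m' k by (subst emeasure_density) (auto simp: nn_integral_cmult)
  also have "emeasure (distr lborel borel (\<lambda>x. 0 + k *\<^sub>R x)) {z. P ((1 / k) *\<^sub>R z)} = emeasure lborel {z. P z}"
    using m' k by (subst emeasure_distr) (auto simp: vimage_def)
  finally show ?thesis .
qed

lemma emeasure_lborel_translate:
  fixes P :: "'v::euclidean_space \<Rightarrow> bool"
  assumes [measurable]: "{z. P z} \<in> sets borel"
  shows "emeasure lborel {z. P (z - a)} = emeasure lborel {z. P z}"
proof -
  have m: "(\<lambda>z. z - a) -` {z. P z} \<inter> space borel \<in> sets (borel :: 'v measure)"
    by (rule measurable_sets[of _ borel borel]) auto
  then have m': "{z. P (z - a)} \<in> sets (borel :: 'v measure)" by (simp add: vimage_def)
  have "emeasure lborel {z. P (z - a)} = emeasure (distr lborel borel ((+) a)) {z. P (z - a)}"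
    by (simp add: lborel_distr_plus)
  also have "\<dots> = emeasure lborel {z. P z}"
    using m' by (subst emeasure_distr) (auto simp: vimage_def)
  finally show ?thesis .
qed

lemma near_diff_translate_sets: "{z. near_diff w I J (z - a)} \<in> sets (borel :: 'v::euclidean_space measure)"
proof -
  have "Measurable.pred (borel :: 'v measure) (\<lambda>z. near_diff (\<lambda>t. w t) I J (z - a))"
    by (rule measurable_near_diff) auto
  then show ?thesis by (simp add: pred_def)
qed

lemma near_diff_sets: "{z. near_diff w I J z} \<in> sets (borel :: 'v::euclidean_space measure)"
  using near_diff_translate_sets[of w I J 0] by simp

context fractional_brownian_motion
begin

abbreviation near_X :: "'w \<Rightarrow> real set \<Rightarrow> real set \<Rightarrow> real ^ 'n \<Rightarrow> bool" where
  "near_X \<omega> \<equiv> near_diff (\<lambda>t. X t \<omega>)"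

abbreviation range_size :: "'w \<Rightarrow> real set \<Rightarrow> real set \<Rightarrow> ennreal" where
  "range_size \<omega> I J \<equiv> emeasure lborel {z. near_X \<omega> I J z}"

definition mean_range :: "real set \<Rightarrow> real set \<Rightarrow> ennreal" where
  "mean_range I J = (\<integral>\<^sup>+\<omega>. range_size \<omega> I J \<partial>M)"

lemma near_diff_X_iff:
  assumes "\<omega> \<in> space M" "0 \<le> a" "a < b" "0 \<le> c" "c < d"
  shows "near_X \<omega> {a..b} {c..d} z \<longleftrightarrow> (\<exists>s\<in>{a..b}. \<exists>t\<in>{c..d}. X s \<omega> - X t \<omega> = z)"
  using assms by (intro near_diff_iff continuous_on_subset[OF continuous_paths]) auto

text \<open>Real affine maps need not preserve rational times, so the change of time goes through
  exact differences, which is where continuity of the path enters.\<close>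

lemma near_diff_X_affine:
  assumes \<omega>: "\<omega> \<in> space M" and "0 < r" "0 \<le> h" "0 \<le> a" "a < b" "0 \<le> c" "c < d"
  shows "near_diff (\<lambda>t. X (r * t + h) \<omega>) {a..b} {c..d} z \<longleftrightarrow> near_X \<omega> {r * a + h..r * b + h} {r * c + h..r * d + h} z"
proof -
  have bex: "(\<exists>s\<in>{r * x + h..r * y + h}. P s) \<longleftrightarrow> (\<exists>s\<in>{x..y}. P (r * s + h))" for x y P
  proof
    assume "\<exists>s\<in>{r * x + h..r * y + h}. P s"
    then obtain s where s: "r * x + h \<le> s" "s \<le> r * y + h" "P s" by auto
    have "s = r * ((s - h) / r) + h" using assms by simp
    then have "P (r * ((s - h) / r) + h)" using s by simp
    moreover have "(s - h) / r \<in> {x..y}" using s assms by (auto simp: field_simps)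
    ultimately show "\<exists>s\<in>{x..y}. P (r * s + h)" by blast
  qed (use assms in auto)
  have "continuous_on {x..y} (\<lambda>t. X (r * t + h) \<omega>)" if "0 \<le> x" for x y
    using assms that by (intro continuous_on_compose2[OF continuous_paths[OF \<omega>]] continuous_intros) auto
  then have "near_diff (\<lambda>t. X (r * t + h) \<omega>) {a..b} {c..d} z \<longleftrightarrow> (\<exists>s\<in>{a..b}. \<exists>t\<in>{c..d}. X (r * s + h) \<omega> - X (r * t + h) \<omega> = z)"
    using assms by (intro near_diff_iff) auto
  also have "\<dots> \<longleftrightarrow> near_X \<omega> {r * a + h..r * b + h} {r * c + h..r * d + h} z"
    using assms by (subst near_diff_X_iff) (auto simp: bex)
  finally show ?thesis .
qed

lemma mean_range_shift:
  assumes "0 \<le> h" "0 \<le> a" "a < b" "0 \<le> c" "c < d"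
  shows "mean_range {a + h..b + h} {c + h..d + h} = mean_range {a..b} {c..d}"
proof -
  have "mean_range {a + h..b + h} {c + h..d + h} = (\<integral>\<^sup>+\<omega>. emeasure lborel {z. near_diff (\<lambda>t. X (t + h) \<omega> - X h \<omega>) {a..b} {c..d} z} \<partial>M)"
    unfolding mean_range_def near_diff_translate using near_diff_X_affine[of _ 1 h a b c d] assms
    by (intro nn_integral_cong) simp
  also have "\<dots> = (\<integral>\<^sup>+\<omega>. emeasure lborel {z. near_diff (\<lambda>t. X t \<omega> - X 0 \<omega>) {a..b} {c..d} z} \<partial>M)"
    using assms measurable_X by (intro same_law_near_diff stationary_increments borel_measurable_diff) auto
  also have "\<dots> = mean_range {a..b} {c..d}"
    unfolding near_diff_translate mean_range_def ..
  finally show ?thesis .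
qed

lemma near_diff_X_scaleR:
  assumes \<omega>: "\<omega> \<in> space M" and k: "0 < k" and "0 \<le> a" "a < b" "0 \<le> c" "c < d"
  shows "near_diff (\<lambda>t. k *\<^sub>R X t \<omega>) {a..b} {c..d} z \<longleftrightarrow> near_X \<omega> {a..b} {c..d} ((1 / k) *\<^sub>R z)"
proof -
  have "continuous_on {x..y} (\<lambda>t. k *\<^sub>R X t \<omega>)" if "0 \<le> x" for x y
    using that by (intro continuous_intros continuous_on_subset[OF continuous_paths[OF \<omega>]]) auto
  then have "near_diff (\<lambda>t. k *\<^sub>R X t \<omega>) {a..b} {c..d} z \<longleftrightarrow> (\<exists>s\<in>{a..b}. \<exists>t\<in>{c..d}. k *\<^sub>R X s \<omega> - k *\<^sub>R X t \<omega> = z)"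
    using assms by (intro near_diff_iff) auto
  also have "\<dots> \<longleftrightarrow> (\<exists>s\<in>{a..b}. \<exists>t\<in>{c..d}. X s \<omega> - X t \<omega> = (1 / k) *\<^sub>R z)"
  proof -
    have "k *\<^sub>R x - k *\<^sub>R y = z \<longleftrightarrow> x - y = (1 / k) *\<^sub>R z" for x y :: "real ^ 'n"
      using k by (auto simp: scaleR_right_diff_distrib[symmetric])
    then show ?thesis by simp
  qed
  also have "\<dots> \<longleftrightarrow> near_X \<omega> {a..b} {c..d} ((1 / k) *\<^sub>R z)"
    using assms by (subst near_diff_X_iff) auto
  finally show ?thesis .
qed

text \<open>The value \<open>0\<close> is fixed by the spatial part of the scaling, so the
  probability of hitting it is the same on every time scale and only squares of side one need to be
  studied.\<close>

lemma hit_zero_scale: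
  assumes r: "0 < r" and "0 \<le> a" "a < b" "0 \<le> c" "c < d"
  shows "emeasure M {\<omega> \<in> space M. near_X \<omega> {r * a..r * b} {r * c..r * d} 0} =
    emeasure M {\<omega> \<in> space M. near_X \<omega> {a..b} {c..d} 0}"
proof -
  have k: "0 < r powr H" using r by simp
  have "{\<omega> \<in> space M. near_X \<omega> {r * a..r * b} {r * c..r * d} 0} = {\<omega> \<in> space M. near_diff (\<lambda>t. X (r * t) \<omega>) {a..b} {c..d} 0}"
    using near_diff_X_affine[of _ r 0 a b c d] assms by auto
  also have "emeasure M \<dots> = emeasure M {\<omega> \<in> space M. near_diff (\<lambda>t. (r powr H) *\<^sub>R X t \<omega>) {a..b} {c..d} 0}"
    using assms measurable_X by (intro same_law_near_diff self_similar) (auto intro!: borel_measurable_scaleR)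
  also have "{\<omega> \<in> space M. near_diff (\<lambda>t. (r powr H) *\<^sub>R X t \<omega>) {a..b} {c..d} 0} = {\<omega> \<in> space M. near_X \<omega> {a..b} {c..d} 0}"
    using near_diff_X_scaleR[OF _ k assms(2-5)] by auto
  finally show ?thesis .
qed

lemma measurable_near_diff_X:
  fixes g :: "'b \<Rightarrow> real ^ 'n"
  assumes "I \<subseteq> {0..}" "J \<subseteq> {0..}" and f: "f \<in> measurable N M" and g: "g \<in> borel_measurable N"
  shows "Measurable.pred N (\<lambda>x. near_diff (\<lambda>t. X t (f x)) I J (g x))"
  using assms by (intro measurable_near_diff measurable_compose[OF f] measurable_X g) auto

lemma sigma_finite_nn_integral_emeasure_eq:
  assumes N: "sigma_finite_measure N" and P: "Measurable.pred (M \<Otimes>\<^sub>M N) (\<lambda>p. P (fst p) (snd p))"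
  shows "(\<lambda>\<omega>. emeasure N {z \<in> space N. P \<omega> z}) \<in> borel_measurable M"
    and "(\<integral>\<^sup>+\<omega>. emeasure N {z \<in> space N. P \<omega> z} \<partial>M) = (\<integral>\<^sup>+z. emeasure M {\<omega> \<in> space M. P \<omega> z} \<partial>N)"
    and "(\<lambda>z. emeasure M {\<omega> \<in> space M. P \<omega> z}) \<in> borel_measurable N"
proof -
  interpret N: sigma_finite_measure N by fact
  interpret P: pair_sigma_finite M N ..
  let ?S = "{p \<in> space (M \<Otimes>\<^sub>M N). P (fst p) (snd p)}"
  have S: "?S \<in> sets (M \<Otimes>\<^sub>M N)" using P by (simp only: pred_def)
  have e1: "Pair \<omega> -` ?S = {z \<in> space N. P \<omega> z}" if "\<omega> \<in> space M" for \<omega> using that by (auto simp: space_pair_measure)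
  have e2: "(\<lambda>\<omega>. (\<omega>, z)) -` ?S = {\<omega> \<in> space M. P \<omega> z}" if "z \<in> space N" for z using that by (auto simp: space_pair_measure)
  show "(\<lambda>\<omega>. emeasure N {z \<in> space N. P \<omega> z}) \<in> borel_measurable M"
    using N.measurable_emeasure_Pair[OF S] e1 by (simp cong: measurable_cong)
  show "(\<lambda>z. emeasure M {\<omega> \<in> space M. P \<omega> z}) \<in> borel_measurable N"
    using P.measurable_emeasure_Pair2[OF S] e2 by (simp cong: measurable_cong)
  have "(\<integral>\<^sup>+\<omega>. emeasure N {z \<in> space N. P \<omega> z} \<partial>M) = (\<integral>\<^sup>+\<omega>. emeasure N (Pair \<omega> -` ?S) \<partial>M)"
    by (intro nn_integral_cong) (simp only: e1)
  also have "\<dots> = emeasure (M \<Otimes>\<^sub>M N) ?S" by (rule N.emeasure_pair_measure_alt[OF S, symmetric])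
  also have "\<dots> = (\<integral>\<^sup>+z. emeasure M ((\<lambda>\<omega>. (\<omega>, z)) -` ?S) \<partial>N)" by (rule P.emeasure_pair_measure_alt2[OF S])
  finally show "(\<integral>\<^sup>+\<omega>. emeasure N {z \<in> space N. P \<omega> z} \<partial>M) = (\<integral>\<^sup>+z. emeasure M {\<omega> \<in> space M. P \<omega> z} \<partial>N)"
    using e2 by (simp cong: nn_integral_cong)
qed

lemma nn_integral_emeasure_eq:
  assumes P: "Measurable.pred (M \<Otimes>\<^sub>M lborel) (\<lambda>p. P (fst p) (snd p))"
  shows "(\<lambda>\<omega>. emeasure lborel {z. P \<omega> z}) \<in> borel_measurable M"
    and "(\<integral>\<^sup>+\<omega>. emeasure lborel {z :: real ^ 'n. P \<omega> z} \<partial>M) = (\<integral>\<^sup>+z. emeasure M {\<omega> \<in> space M. P \<omega> z} \<partial>lborel)"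
    and "(\<lambda>z. emeasure M {\<omega> \<in> space M. P \<omega> z}) \<in> borel_measurable lborel"
  using sigma_finite_nn_integral_emeasure_eq[OF lborel.sigma_finite_measure_axioms P] by simp_all

end

section \<open>Scaling and second moments of the volume at the critical dimension\<close>

context critical_fbm
begin

lemma mean_range_scale:
  assumes r: "0 < r" and "0 \<le> a" "a < b" "0 \<le> c" "c < d"
  shows "mean_range {r * a..r * b} {r * c..r * d} = ennreal (r\<^sup>2) * mean_range {a..b} {c..d}"
proof -
  have k: "0 < r powr H" using r by simp
  have kn: "(r powr H) ^ CARD('n) = r\<^sup>2"
  proof -
    have "(r powr H) ^ CARD('n) = (r powr H) powr real CARD('n)" using k by (simp only: powr_realpow)
    also have "\<dots> = r powr (H * real CARD('n))" by (rule powr_powr)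
    also have "H * real CARD('n) = 2" using critical Hurst_parameter by (simp add: field_simps)
    finally show ?thesis using r powr_realpow[of r 2] by simp
  qed
  let ?S = "\<lambda>\<omega>. {z. near_diff (\<lambda>t. (r powr H) *\<^sub>R X t \<omega>) {a..b} {c..d} z}"
  have "mean_range {r * a..r * b} {r * c..r * d} = (\<integral>\<^sup>+\<omega>. emeasure lborel {z. near_diff (\<lambda>t. X (r * t) \<omega>) {a..b} {c..d} z} \<partial>M)"
    unfolding mean_range_def using near_diff_X_affine[of _ r 0 a b c d] assms
    by (intro nn_integral_cong) simp
  also have "\<dots> = (\<integral>\<^sup>+\<omega>. emeasure lborel (?S \<omega>) \<partial>M)"
    using assms measurable_X by (intro same_law_near_diff self_similar) (auto intro!: borel_measurable_scaleR)
  also have "\<dots> = (\<integral>\<^sup>+\<omega>. ennreal (r\<^sup>2) * range_size \<omega> {a..b} {c..d} \<partial>M)"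
  proof (intro nn_integral_cong)
    fix \<omega> assume \<omega>: "\<omega> \<in> space M"
    have "emeasure lborel (?S \<omega>) = emeasure lborel {z. near_X \<omega> {a..b} {c..d} ((1 / (r powr H)) *\<^sub>R z)}"
      using near_diff_X_scaleR[OF \<omega> k assms(2-5)] by simp
    also have "\<dots> = ennreal ((r powr H) ^ DIM(real ^ 'n)) * range_size \<omega> {a..b} {c..d}"
      by (rule emeasure_lborel_scale[OF k near_diff_sets])
    finally show "emeasure lborel (?S \<omega>) = ennreal (r\<^sup>2) * range_size \<omega> {a..b} {c..d}"
      by (simp add: kn)
  qed
  also have "\<dots> = ennreal (r\<^sup>2) * mean_range {a..b} {c..d}"
    unfolding mean_range_def using assms
    by (intro nn_integral_cmult nn_integral_emeasure_eq(1) measurable_near_diff_X) auto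
  finally show ?thesis .
qed

text \<open>The difference set lies in a cube around \<open>X a \<omega> - X c \<omega>\<close>
  whose half side \<rho> is the sum of the two oscillations, so its squared volume is at most
  \<open>(2 * \<rho>) ^ (2 * CARD('n))\<close>. Bounding 2 \<rho> by 4 times the larger oscillation
  gives the power of 4. The centre does not matter, hence neither does the distance between
  \<open>a\<close> and \<open>c\<close>.\<close>

lemma second_moment_range:
  obtains C :: real where "0 \<le> C" and
    "\<And>a c. 0 \<le> a \<Longrightarrow> 0 \<le> c \<Longrightarrow> (\<integral>\<^sup>+\<omega>. (range_size \<omega> {a..a+1} {c..c+1})\<^sup>2 \<partial>M) \<le> ennreal C"
proof -
  let ?p = "2 * CARD('n)"
  obtain C where C: "0 \<le> C" and U: "\<And>x. 0 \<le> x \<Longrightarrow> \<exists>U. osc_bound C x U"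
    using oscillation_moment by blast
  show ?thesis
  proof (rule that[of "4 ^ ?p * (C + C)"])
    show "0 \<le> 4 ^ ?p * (C + C)" using C by simp
    fix a c :: real assume ac: "0 \<le> a" "0 \<le> c"
    obtain U1 where "osc_bound C a U1" using U[OF ac(1)] by blast
    note U1[measurable] = osc_boundD(1)[OF this] and U1C = osc_boundD(2)[OF this] and U1b = osc_boundD(3)[OF this]
    obtain U2 where "osc_bound C c U2" using U[OF ac(2)] by blast
    note U2[measurable] = osc_boundD(1)[OF this] and U2C = osc_boundD(2)[OF this] and U2b = osc_boundD(3)[OF this]
    have p0: "0 < ?p" by simp
    let ?L = "\<lambda>\<omega>. range_size \<omega> {a..a+1} {c..c+1}"
    have pt: "(?L \<omega>)\<^sup>2 \<le> ennreal (4 ^ ?p) * (U1 \<omega> + U2 \<omega>)" if \<omega>: "\<omega> \<in> space M" for \<omega>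
    proof (cases "U1 \<omega> = \<infinity> \<or> U2 \<omega> = \<infinity>")
      case True
      then show ?thesis by (auto simp: ennreal_mult_top)
    next
      case False
      define u1 where "u1 = enn2real (U1 \<omega>)"
      define u2 where "u2 = enn2real (U2 \<omega>)"
      have u: "U1 \<omega> = ennreal u1" "U2 \<omega> = ennreal u2" "0 \<le> u1" "0 \<le> u2"
        using False by (auto simp: u1_def u2_def less_top)
      have root: "x \<le> root ?p y" if "ennreal (x ^ ?p) \<le> ennreal y" "0 \<le> x" "0 \<le> y" for x y
      proof -
        have "x ^ ?p \<le> y" using that by simp
        then have "root ?p (x ^ ?p) \<le> root ?p y" using p0 by (intro real_root_le_mono)
        then show ?thesis using p0 that by (simp add: real_root_power_cancel)
      qed
      define \<rho> where "\<rho> = root ?p u1 + root ?p u2"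
      have \<rho>0: "0 \<le> \<rho>" using u by (simp add: \<rho>_def)
      let ?z = "X a \<omega> - X c \<omega>" and ?o = "(\<chi> i. \<rho>) :: real ^ 'n"
      have sub: "{z. near_X \<omega> {a..a+1} {c..c+1} z} \<subseteq> cbox (?z - ?o) (?z + ?o)"
      proof
        fix z assume "z \<in> {z. near_X \<omega> {a..a+1} {c..c+1} z}"
        then obtain s t where st: "s \<in> {a..a+1}" "t \<in> {c..c+1}" "X s \<omega> - X t \<omega> = z"
          using near_diff_X_iff[OF \<omega>, of a "a+1" c "c+1" z] ac by auto
        have "norm (X s \<omega> - X a \<omega>) \<le> root ?p u1" "norm (X t \<omega> - X c \<omega>) \<le> root ?p u2"
          using U1b[OF \<omega> st(1)] U2b[OF \<omega> st(2)] u by (auto intro!: root)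
        moreover have "z - ?z = (X s \<omega> - X a \<omega>) - (X t \<omega> - X c \<omega>)" using st by simp
        then have "norm (z - ?z) \<le> norm (X s \<omega> - X a \<omega>) + norm (X t \<omega> - X c \<omega>)" by (metis norm_triangle_ineq4)
        ultimately have nz: "norm (z - ?z) \<le> \<rho>" by (simp add: \<rho>_def)
        have "\<bar>(z - ?z) $ i\<bar> \<le> \<rho>" for i using component_le_norm_cart[of "z - ?z" i] nz by linarith
        then have "\<bar>z $ i - ?z $ i\<bar> \<le> \<rho>" for i by simp
        then have "?z $ i - \<rho> \<le> z $ i \<and> z $ i \<le> ?z $ i + \<rho>" for i by (smt (verit))
        then show "z \<in> cbox (?z - ?o) (?z + ?o)" by (simp add: mem_box_cart)
      qed
      have "?L \<omega> \<le> emeasure lborel (cbox (?z - ?o) (?z + ?o))"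
        by (rule emeasure_mono[OF sub]) simp
      also have "\<dots> = ennreal (\<Prod>b\<in>Basis. ((?z + ?o) - (?z - ?o)) \<bullet> b)"
      proof (rule emeasure_lborel_cbox)
        fix b :: "real ^ 'n" assume "b \<in> Basis"
        then obtain i where "b = axis i 1" by (auto simp: Basis_vec_def)
        then show "(?z - ?o) \<bullet> b \<le> (?z + ?o) \<bullet> b" using \<rho>0 by (simp add: inner_axis)
      qed
      also have "(\<Prod>b\<in>Basis. ((?z + ?o) - (?z - ?o)) \<bullet> b) = (\<Prod>b\<in>(Basis :: (real ^ 'n) set). 2 * \<rho>)"
      proof (rule prod.cong)
        fix b :: "real ^ 'n" assume "b \<in> Basis"
        then obtain i where "b = axis i 1" by (auto simp: Basis_vec_def)
        then show "((?z + ?o) - (?z - ?o)) \<bullet> b = 2 * \<rho>" by (simp add: inner_axis)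
      qed simp
      also have "\<dots> = (2 * \<rho>) ^ CARD('n)" by simp
      finally have "(?L \<omega>)\<^sup>2 \<le> (ennreal ((2 * \<rho>) ^ CARD('n)))\<^sup>2"
        by (intro power_mono) auto
      also have "\<dots> = ennreal ((2 * \<rho>) ^ ?p)"
      proof -
        have "((2 * \<rho>) ^ CARD('n))\<^sup>2 = (2 * \<rho>) ^ ?p" by (simp only: power_mult[symmetric] mult.commute)
        then show ?thesis using \<rho>0 by (simp only: ennreal_power zero_le_power mult_nonneg_nonneg zero_le_numeral)
      qed
      also have "\<dots> \<le> ennreal (4 ^ ?p * (u1 + u2))"
      proof (rule ennreal_leI)
        have "(max (root ?p u1) (root ?p u2)) ^ ?p = root ?p u1 ^ ?p \<or> (max (root ?p u1) (root ?p u2)) ^ ?p = root ?p u2 ^ ?p"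
          by (simp only: max_def) simp
        then have m: "(max (root ?p u1) (root ?p u2)) ^ ?p \<le> u1 + u2"
          unfolding real_root_pow_pos2[OF p0 u(3)] real_root_pow_pos2[OF p0 u(4)] using u by linarith
        have "\<rho> \<le> 2 * max (root ?p u1) (root ?p u2)" by (simp add: \<rho>_def)
        then have "(2 * \<rho>) ^ ?p \<le> (4 * max (root ?p u1) (root ?p u2)) ^ ?p" using \<rho>0 by (intro power_mono) auto
        also have "\<dots> = 4 ^ ?p * (max (root ?p u1) (root ?p u2)) ^ ?p" by (rule power_mult_distrib)
        also have "\<dots> \<le> 4 ^ ?p * (u1 + u2)" using m by (intro mult_left_mono) auto
        finally show "(2 * \<rho>) ^ ?p \<le> 4 ^ ?p * (u1 + u2)" .
      qed
      also have "\<dots> = ennreal (4 ^ ?p) * (U1 \<omega> + U2 \<omega>)" using u by (simp add: ennreal_mult)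
      finally show ?thesis .
    qed
    have "(\<integral>\<^sup>+\<omega>. (?L \<omega>)\<^sup>2 \<partial>M) \<le> (\<integral>\<^sup>+\<omega>. ennreal (4 ^ ?p) * (U1 \<omega> + U2 \<omega>) \<partial>M)"
      by (intro nn_integral_mono pt)
    also have "\<dots> = ennreal (4 ^ ?p) * ((\<integral>\<^sup>+\<omega>. U1 \<omega> \<partial>M) + (\<integral>\<^sup>+\<omega>. U2 \<omega> \<partial>M))"
      by (subst nn_integral_cmult) (auto simp: nn_integral_add)
    also have "\<dots> \<le> ennreal (4 ^ ?p) * (ennreal C + ennreal C)"
      by (intro mult_left_mono add_mono U1C U2C) auto
    also have "\<dots> = ennreal (4 ^ ?p * (C + C))"
      using C unfolding ennreal_plus[OF C C, symmetric] by (intro ennreal_mult[symmetric]) auto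
    finally show "(\<integral>\<^sup>+\<omega>. (?L \<omega>)\<^sup>2 \<partial>M) \<le> ennreal (4 ^ ?p * (C + C))" .
  qed
qed

end

section \<open>Decoupling the difference sets of two squares\<close>

lemma near_diff_enum:
  assumes "I \<inter> \<rat> \<noteq> {}" "J \<inter> \<rat> \<noteq> {}"
  shows "near_diff w I J z \<longleftrightarrow> (\<forall>m. \<exists>i. case from_nat_into ((I \<inter> \<rat>) \<times> (J \<inter> \<rat>)) i of (s, t) \<Rightarrow> norm (w s - w t - z) < 1 / Suc m)"
proof -
  let ?D = "(I \<inter> \<rat>) \<times> (J \<inter> \<rat>)"
  have c: "countable ?D"
    by (intro countable_SIGMA) (auto intro: countable_subset[OF _ countable_rat])
  have r: "range (from_nat_into ?D) = ?D" by (rule range_from_nat_into[OF _ c]) (use assms in auto)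
  have "(\<exists>s\<in>I \<inter> \<rat>. \<exists>t\<in>J \<inter> \<rat>. P s t) \<longleftrightarrow> (\<exists>i. case from_nat_into ?D i of (s, t) \<Rightarrow> P s t)" for P
  proof -
    have "(\<exists>s\<in>I \<inter> \<rat>. \<exists>t\<in>J \<inter> \<rat>. P s t) \<longleftrightarrow> (\<exists>p\<in>?D. case p of (s, t) \<Rightarrow> P s t)" by auto
    also have "\<dots> \<longleftrightarrow> (\<exists>p\<in>range (from_nat_into ?D). case p of (s, t) \<Rightarrow> P s t)" by (simp only: r)
    finally show ?thesis by simp
  qed
  then show ?thesis unfolding near_diff_def by simp
qed

context fractional_brownian_motion
begin

text \<open>The bump is 1 on \<open>I2\<close> and 0 on all the other times involved, so adding it
  times \<open>v\<close> leaves the first condition alone and moves only the second target. With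
  \<open>k = 1\<close> it serves the sets translated by \<open>X y\<close>, with
  \<open>k = 0\<close> the plain ones.\<close>

lemma pair_shift_bound:
  fixes v z1 z2 :: "real ^ 'n"
  assumes H: "H < 1 / 2" and u: "3 \<le> u" and l: "0 < l"
    and S: "0 < S" "9 / (H * (1 - 2 * H)) * (norm v)\<^sup>2 \<le> S"
    and pos: "I1 \<subseteq> {0..}" "J1 \<subseteq> {0..}" "I2 \<subseteq> {0..}" "J2 \<subseteq> {0..}" "0 \<le> y"
    and ne: "I1 \<inter> \<rat> \<noteq> {}" "J1 \<inter> \<rat> \<noteq> {}" "I2 \<inter> \<rat> \<noteq> {}" "J2 \<inter> \<rat> \<noteq> {}"
    and b0: "\<And>t. t \<in> I1 \<union> J1 \<union> J2 \<union> {y} \<Longrightarrow> bump u t = 0" and b1: "\<And>t. t \<in> I2 \<Longrightarrow> bump u t = 1"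
  shows "emeasure M {\<omega> \<in> space M. near_X \<omega> I1 J1 (z1 - k *\<^sub>R X y \<omega>) \<and> near_X \<omega> I2 J2 (z2 - v - k *\<^sub>R X y \<omega>)}
    \<le> ennreal (1 / (2 * l)) * emeasure M {\<omega> \<in> space M. near_X \<omega> I1 J1 (z1 - k *\<^sub>R X y \<omega>) \<and> near_X \<omega> I2 J2 (z2 - k *\<^sub>R X y \<omega>)}
      + ennreal (l / 2 * exp S)"
proof -
  \<comment> \<open>\<open>path_shift_bound\<close> admits a single index. The rational time pairs
    of each condition are enumerated, and \<open>prod_decode\<close> merges the two enumerations, so
    that a joint approximation amounts to two independent ones.\<close>
  define e1 where "e1 = from_nat_into ((I1 \<inter> \<rat>) \<times> (J1 \<inter> \<rat>))"
  define e2 where "e2 = from_nat_into ((I2 \<inter> \<rat>) \<times> (J2 \<inter> \<rat>))"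
  have e1: "e1 i \<in> I1 \<times> J1" for i using from_nat_into[of "(I1 \<inter> \<rat>) \<times> (J1 \<inter> \<rat>)" i] ne by (auto simp: e1_def)
  have e2: "e2 i \<in> I2 \<times> J2" for i using from_nat_into[of "(I2 \<inter> \<rat>) \<times> (J2 \<inter> \<rat>)" i] ne by (auto simp: e2_def)
  define s1 where "s1 j = fst (e1 (fst (prod_decode j)))" for j
  define t1 where "t1 j = snd (e1 (fst (prod_decode j)))" for j
  define s2 where "s2 j = fst (e2 (snd (prod_decode j)))" for j
  define t2 where "t2 j = snd (e2 (snd (prod_decode j)))" for j
  have in_st: "s1 j \<in> I1" "t1 j \<in> J1" "s2 j \<in> I2" "t2 j \<in> J2" for j
    using e1[of "fst (prod_decode j)"] e2[of "snd (prod_decode j)"] by (auto simp: s1_def t1_def s2_def t2_def mem_Times_iff)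
  define \<Phi> where "\<Phi> m j w \<longleftrightarrow> norm (w (s1 j) - w (t1 j) - (z1 - k *\<^sub>R w y)) < 1 / real (Suc m) \<and>
      norm (w (s2 j) - w (t2 j) - (z2 - k *\<^sub>R w y)) < 1 / real (Suc m)" for m j and w :: "real \<Rightarrow> real ^ 'n"
  define T where "T j = {s1 j, t1 j, s2 j, t2 j, y}" for j
  have \<Phi>: "(\<forall>m. \<exists>j. \<Phi> m j w) \<longleftrightarrow> near_diff w I1 J1 (z1 - k *\<^sub>R w y) \<and> near_diff w I2 J2 (z2 - k *\<^sub>R w y)" for w
  proof -
    have "(\<exists>j. \<Phi> m j w) \<longleftrightarrow> (\<exists>i. case e1 i of (s, t) \<Rightarrow> norm (w s - w t - (z1 - k *\<^sub>R w y)) < 1 / Suc m) \<and>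
       (\<exists>i. case e2 i of (s, t) \<Rightarrow> norm (w s - w t - (z2 - k *\<^sub>R w y)) < 1 / Suc m)" (is "_ \<longleftrightarrow> (\<exists>i. ?A i) \<and> (\<exists>i. ?B i)") for m
    proof
      assume "(\<exists>i. ?A i) \<and> (\<exists>i. ?B i)"
      then obtain i i' where "?A i" "?B i'" by (elim conjE exE) iprover
      then have "\<Phi> m (prod_encode (i, i')) w" by (simp add: \<Phi>_def s1_def t1_def s2_def t2_def split_beta)
      then show "\<exists>j. \<Phi> m j w" by blast
    qed (auto simp: \<Phi>_def s1_def t1_def s2_def t2_def split_beta)
    then show ?thesis
      unfolding near_diff_enum[OF ne(1,2)] near_diff_enum[OF ne(3,4)] e1_def[symmetric] e2_def[symmetric] by (simp only: all_conj_distrib)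
  qed
  have n1: "near_diff (\<lambda>t. X t \<omega> + bump u t *\<^sub>R v) I1 J1 z = near_X \<omega> I1 J1 z" for z \<omega>
    using b0 by (intro near_diff_cong) auto
  have n2: "near_diff (\<lambda>t. X t \<omega> + bump u t *\<^sub>R v) I2 J2 (z2 - a) = near_X \<omega> I2 J2 (z2 - v - a)" for a \<omega>
  proof -
    have "(X s \<omega> + bump u s *\<^sub>R v) - (X t \<omega> + bump u t *\<^sub>R v) - (z2 - a) = X s \<omega> - X t \<omega> - (z2 - v - a)" if "s \<in> I2" "t \<in> J2" for s t
      using b0[of t] b1[of s] that by (simp add: algebra_simps)
    note * = this
    show ?thesis unfolding near_diff_def by (intro all_cong1 bex_cong refl) (simp only: * Int_iff)
  qed
  have by0: "bump u y = 0" using b0 by simp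
  have "emeasure M {\<omega> \<in> space M. \<forall>m. \<exists>j. \<Phi> m j (\<lambda>t. X t \<omega> + bump u t *\<^sub>R v)} \<le>
    ennreal (1 / (2 * l)) * emeasure M {\<omega> \<in> space M. \<forall>m. \<exists>j. \<Phi> m j (\<lambda>t. X t \<omega>)} + ennreal (l / 2 * exp S)"
  proof (rule path_shift_bound[OF H u l S])
    show "finite (T j)" "T j \<subseteq> {0..}" for j using in_st[of j] pos by (auto simp: T_def)
    show "{w \<in> space (Pi\<^sub>M (T j) (\<lambda>_. borel)). \<Phi> m j w} \<in> sets (Pi\<^sub>M (T j) (\<lambda>_. borel))" for m j
    proof -
      let ?B = "borel_measurable (Pi\<^sub>M (T j) (\<lambda>_. borel :: (real ^ 'n) measure))"
      have [measurable]: "(\<lambda>w. w (s1 j)) \<in> ?B"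
        "(\<lambda>w. w (t1 j)) \<in> ?B"
        "(\<lambda>w. w (s2 j)) \<in> ?B"
        "(\<lambda>w. w (t2 j)) \<in> ?B"
        "(\<lambda>w. w y) \<in> ?B"
        by (intro measurable_component_singleton; simp add: T_def)+
      show ?thesis unfolding \<Phi>_def by measurable
    qed
    show "\<Phi> m j (restrict w (T j)) = \<Phi> m j w" for m j w by (simp add: \<Phi>_def T_def)
    show "\<Phi> m j w" if "\<Phi> (Suc m) j w" for m j w
    proof -
      have "1 / real (Suc (Suc m)) \<le> 1 / real (Suc m)" by (simp add: field_simps)
      then show ?thesis using that unfolding \<Phi>_def by linarith
    qed
  qed
  then show ?thesis unfolding \<Phi> n1 n2 by (simp only: by0 scaleR_zero_left add_0_right n1 n2)
qed

text \<open>Adding \<open>X y\<close> keeps the differences in a bounded region when the second interval \<open>J\<close> is far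
  away; without it the set \<open>cball 0 R\<close> would have to grow with the distance.\<close>

definition local_range :: "real set \<Rightarrow> real set \<Rightarrow> real \<Rightarrow> real \<Rightarrow> 'w \<Rightarrow> (real ^ 'n) set" where
  "local_range I J y R \<omega> = {z. near_X \<omega> I J (z - X y \<omega>) \<and> z \<in> cball 0 R}"

lemma pred_near_diff_snd:
  assumes "I \<subseteq> {0..}" "J \<subseteq> {0..}" "0 \<le> y" "g \<in> borel_measurable N"
  shows "Measurable.pred (M \<Otimes>\<^sub>M N) (\<lambda>p. near_diff (\<lambda>t. X t (fst p)) I J (g (snd p) - X y (fst p)))"
proof -
  have [measurable]: "X y \<in> borel_measurable M" "g \<in> borel_measurable N" using assms measurable_X by auto
  show ?thesis by (intro measurable_near_diff_X) (use assms in auto)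
qed

lemma measurable_local_range:
  assumes "I \<subseteq> {0..}" "J \<subseteq> {0..}" "0 \<le> y"
  shows "(\<lambda>\<omega>. emeasure lborel (local_range I J y R \<omega>)) \<in> borel_measurable M"
proof -
  have "Measurable.pred (M \<Otimes>\<^sub>M (lborel :: (real ^ 'n) measure)) (\<lambda>p. snd p \<in> cball 0 R)"
    unfolding mem_cball_0 by measurable
  then show ?thesis unfolding local_range_def using assms
    by (intro nn_integral_emeasure_eq(1) pred_intros_logic pred_near_diff_snd[of _ _ _ "\<lambda>x. x"]) auto
qed

text \<open>By Tonelli the mean product of volumes is the integral over \<open>z\<close> and
  \<open>w\<close> of the probability that \<open>z\<close> lies in the first and \<open>w\<close>
  in the second set. The shift by \<open>z - w\<close> compares it with the probability that
  \<open>z\<close> lies in both, and integrating that over \<open>z\<close> gives the mean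
  overlap.\<close>

lemma local_range_product_bound:
  assumes H: "H < 1 / 2" and u: "3 \<le> u" and l: "0 < l" and R: "0 \<le> R"
    and pos: "I1 \<subseteq> {0..}" "I2 \<subseteq> {0..}" "J \<subseteq> {0..}" "0 \<le> y"
    and ne: "I1 \<inter> \<rat> \<noteq> {}" "I2 \<inter> \<rat> \<noteq> {}" "J \<inter> \<rat> \<noteq> {}"
    and b0: "\<And>t. t \<in> I1 \<union> J \<union> {y} \<Longrightarrow> bump u t = 0" and b1: "\<And>t. t \<in> I2 \<Longrightarrow> bump u t = 1"
  defines "V \<equiv> emeasure lborel (cball 0 R :: (real ^ 'n) set)"
    and "S \<equiv> 9 / (H * (1 - 2 * H)) * (2 * R)\<^sup>2 + 1"
  shows "(\<integral>\<^sup>+\<omega>. emeasure lborel (local_range I1 J y R \<omega>) * emeasure lborel (local_range I2 J y R \<omega>) \<partial>M) \<le>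
    V * (ennreal (1 / (2 * l)) * (\<integral>\<^sup>+\<omega>. emeasure lborel {z. near_X \<omega> I1 J z \<and> near_X \<omega> I2 J z} \<partial>M)
      + V * ennreal (l / 2 * exp S))"
proof -
  let ?L = "lborel :: (real ^ 'n) measure" and ?B = "cball 0 R :: (real ^ 'n) set"
  let ?P1 = "\<lambda>z \<omega>. near_X \<omega> I1 J (z - X y \<omega>)"
  let ?P2 = "\<lambda>z \<omega>. near_X \<omega> I2 J (z - X y \<omega>)"
  let ?PP = "\<lambda>z. {\<omega> \<in> space M. ?P1 z \<omega> \<and> ?P2 z \<omega>}"
  let ?nn = "\<lambda>\<omega> z. near_X \<omega> I1 J z \<and> near_X \<omega> I2 J z"
  have C: "0 < 9 / (H * (1 - 2 * H))" using H Hurst_parameter by simp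
  \<comment> \<open>The summand 1 in \<open>S\<close> keeps it positive also for
    \<open>R = 0\<close>; the other summand covers every difference of two points of the ball, whose
    norm is at most 2 R.\<close>
  have S0: "0 < S" unfolding S_def using C by (intro add_nonneg_pos mult_nonneg_nonneg) auto
  let ?a = "ennreal (1 / (2 * l))"
  let ?b = "ennreal (l / 2 * exp S)"
  have hit: "emeasure M {\<omega> \<in> space M. ?P1 z \<omega> \<and> ?P2 w \<omega>} \<le> ?a * emeasure M (?PP z) + ?b"
    if zw: "z \<in> ?B" "w \<in> ?B" for z w
  proof -
    have "norm (z - w) \<le> 2 * R" using zw norm_triangle_ineq4[of z w] by (simp add: dist_norm)
    then have "(norm (z - w))\<^sup>2 \<le> (2 * R)\<^sup>2" by (intro power_mono) auto
    then have "9 / (H * (1 - 2 * H)) * (norm (z - w))\<^sup>2 \<le> 9 / (H * (1 - 2 * H)) * (2 * R)\<^sup>2"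
      using C by (intro mult_left_mono) auto
    then have "9 / (H * (1 - 2 * H)) * (norm (z - w))\<^sup>2 \<le> S" unfolding S_def by linarith
    from pair_shift_bound[OF H u l S0 this pos(1,3,2,3,4) ne(1,3,2,3) _ b1, where ?z1.0 = z and ?z2.0 = z and k = 1]
    show ?thesis using b0 by simp
  qed
  have p1: "Measurable.pred (M \<Otimes>\<^sub>M ?L) (\<lambda>p. ?P1 (snd p) (fst p))"
    using pred_near_diff_snd[OF pos(1,3,4), of "\<lambda>x. x" ?L] by simp
  have p2: "Measurable.pred (M \<Otimes>\<^sub>M ?L) (\<lambda>p. ?P2 (snd p) (fst p))"
    using pred_near_diff_snd[OF pos(2,3,4), of "\<lambda>x. x" ?L] by simp
  have p12: "Measurable.pred (M \<Otimes>\<^sub>M ?L) (\<lambda>p. ?P1 (snd p) (fst p) \<and> ?P2 (snd p) (fst p))"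
    using p1 p2 by simp
  define e where "e z = emeasure M (?PP z)" for z
  have e[measurable]: "e \<in> borel_measurable ?L"
    using sigma_finite_nn_integral_emeasure_eq(3)[OF lborel.sigma_finite_measure_axioms p12] unfolding e_def .
  define g where "g z = ?a * emeasure M (?PP z) + ?b" for z
  have [measurable]: "g \<in> borel_measurable ?L" unfolding g_def e_def[symmetric] by measurable
  have [measurable]: "?B \<in> sets borel" by simp
  have "indicator ?B \<in> borel_measurable ?L" by simp
  then have gm: "(\<lambda>p. indicator ?B (fst p) * (indicator ?B (snd p) * g (fst p))) \<in> borel_measurable (?L \<Otimes>\<^sub>M ?L)"
    by (intro borel_measurable_times_ennreal measurable_compose[OF measurable_fst] measurable_compose[OF measurable_snd]) auto
  let ?Q = "\<lambda>\<omega> p. (fst p \<in> ?B \<and> ?P1 (fst p) \<omega>) \<and> (snd p \<in> ?B \<and> ?P2 (snd p) \<omega>)"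
  have q1: "Measurable.pred (M \<Otimes>\<^sub>M (?L \<Otimes>\<^sub>M ?L)) (\<lambda>p. ?P1 (fst (snd p)) (fst p))"
    by (rule pred_near_diff_snd[OF pos(1,3,4), of fst "?L \<Otimes>\<^sub>M ?L"]) simp
  have q2: "Measurable.pred (M \<Otimes>\<^sub>M (?L \<Otimes>\<^sub>M ?L)) (\<lambda>p. ?P2 (snd (snd p)) (fst p))"
    by (rule pred_near_diff_snd[OF pos(2,3,4), of snd "?L \<Otimes>\<^sub>M ?L"]) simp
  have q: "Measurable.pred (M \<Otimes>\<^sub>M (?L \<Otimes>\<^sub>M ?L)) (\<lambda>p. ?Q (fst p) (snd p))"
  proof -
    have "Measurable.pred (M \<Otimes>\<^sub>M (?L \<Otimes>\<^sub>M ?L)) (\<lambda>p. fst (snd p) \<in> ?B)"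
      "Measurable.pred (M \<Otimes>\<^sub>M (?L \<Otimes>\<^sub>M ?L)) (\<lambda>p. snd (snd p) \<in> ?B)"
      unfolding mem_cball_0 by measurable
    then show ?thesis
      using q1 q2 unfolding pred_def by (intro sets.sets_Collect_conj)
  qed
  have sets: "local_range I J y R \<omega> \<in> sets ?L" for I \<omega>
  proof -
    have "local_range I J y R \<omega> = {z. near_X \<omega> I J (z - X y \<omega>)} \<inter> ?B" by (auto simp: local_range_def)
    then show ?thesis using near_diff_translate_sets[of "\<lambda>t. X t \<omega>" I J "X y \<omega>"] by simp
  qed
  have "(\<integral>\<^sup>+\<omega>. emeasure lborel (local_range I1 J y R \<omega>) * emeasure lborel (local_range I2 J y R \<omega>) \<partial>M) =
    (\<integral>\<^sup>+\<omega>. emeasure (?L \<Otimes>\<^sub>M ?L) {p \<in> space (?L \<Otimes>\<^sub>M ?L). ?Q \<omega> p} \<partial>M)"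
  proof (intro nn_integral_cong)
    fix \<omega>
    have "{p \<in> space (?L \<Otimes>\<^sub>M ?L). ?Q \<omega> p} = local_range I1 J y R \<omega> \<times> local_range I2 J y R \<omega>"
      by (auto simp: local_range_def space_pair_measure)
    then show "emeasure lborel (local_range I1 J y R \<omega>) * emeasure lborel (local_range I2 J y R \<omega>) = emeasure (?L \<Otimes>\<^sub>M ?L) {p \<in> space (?L \<Otimes>\<^sub>M ?L). ?Q \<omega> p}"
      using lborel.emeasure_pair_measure_Times[OF sets sets] by simp
  qed
  also have "\<dots> = (\<integral>\<^sup>+p. emeasure M {\<omega> \<in> space M. ?Q \<omega> p} \<partial>(?L \<Otimes>\<^sub>M ?L))"
    by (rule sigma_finite_nn_integral_emeasure_eq(2)[OF sigma_finite_pair_measure[OF lborel.sigma_finite_measure_axioms lborel.sigma_finite_measure_axioms] q])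
  also have "\<dots> \<le> (\<integral>\<^sup>+p. indicator ?B (fst p) * (indicator ?B (snd p) * g (fst p)) \<partial>(?L \<Otimes>\<^sub>M ?L))"
  proof (intro nn_integral_mono)
    fix p :: "(real ^ 'n) \<times> (real ^ 'n)"
    show "emeasure M {\<omega> \<in> space M. ?Q \<omega> p} \<le> indicator ?B (fst p) * (indicator ?B (snd p) * g (fst p))"
    proof (cases "fst p \<in> ?B \<and> snd p \<in> ?B")
      case True
      then show ?thesis using hit[of "fst p" "snd p"] by (simp only: g_def indicator_simps simp_thms mult_1)
    next
      case False
      then have "{\<omega> \<in> space M. ?Q \<omega> p} = {}" by blast
      then show ?thesis by (simp only: emeasure_empty zero_le)
    qed
  qed
  also have "\<dots> = (\<integral>\<^sup>+z. \<integral>\<^sup>+w. indicator ?B z * (indicator ?B w * g z) \<partial>?L \<partial>?L)"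
    by (subst lborel.nn_integral_fst[OF gm, symmetric]) (simp only: fst_conv snd_conv)
  also have "\<dots> = (\<integral>\<^sup>+z. V * (indicator ?B z * g z) \<partial>?L)"
  proof (intro nn_integral_cong)
    fix z
    have "(\<integral>\<^sup>+w. indicator ?B z * (indicator ?B w * g z) \<partial>?L) = (\<integral>\<^sup>+w. (indicator ?B z * g z) * indicator ?B w \<partial>?L)"
      by (intro nn_integral_cong) (simp only: mult_ac)
    also have "\<dots> = (indicator ?B z * g z) * V"
      unfolding V_def by (rule nn_integral_cmult_indicator) simp
    finally show "(\<integral>\<^sup>+w. indicator ?B z * (indicator ?B w * g z) \<partial>?L) = V * (indicator ?B z * g z)" by (simp only: mult_ac)
  qed
  \<comment> \<open>In the main term the restriction to the ball is given up, so that the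
    untruncated overlap appears; in the error term it is kept, which makes that integral equal to a
    multiple of \<open>V\<close>.\<close>
  also have "\<dots> \<le> (\<integral>\<^sup>+z. V * (?a * e z + ?b * indicator ?B z) \<partial>?L)"
    by (intro nn_integral_mono mult_left_mono) (auto simp: indicator_def g_def e_def)
  also have "\<dots> = V * (\<integral>\<^sup>+z. ?a * e z + ?b * indicator ?B z \<partial>?L)"
    by (rule nn_integral_cmult) measurable
  also have "\<dots> = V * ((\<integral>\<^sup>+z. ?a * e z \<partial>?L) + (\<integral>\<^sup>+z. ?b * indicator ?B z \<partial>?L))"
    by (subst nn_integral_add) measurable
  also have "(\<integral>\<^sup>+z. ?b * indicator ?B z \<partial>?L) = ?b * V"
    unfolding V_def by (rule nn_integral_cmult_indicator) simp
  also have "(\<integral>\<^sup>+z. ?a * e z \<partial>?L) = ?a * (\<integral>\<^sup>+z. e z \<partial>?L)"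
    by (rule nn_integral_cmult) measurable
  also have "(\<integral>\<^sup>+z. e z \<partial>?L) = (\<integral>\<^sup>+z. emeasure M (?PP z) \<partial>?L)" by (simp only: e_def)
  also have "(\<integral>\<^sup>+z. emeasure M (?PP z) \<partial>?L) = (\<integral>\<^sup>+\<omega>. emeasure ?L {z \<in> space ?L. ?P1 z \<omega> \<and> ?P2 z \<omega>} \<partial>M)"
    by (rule sigma_finite_nn_integral_emeasure_eq(2)[OF lborel.sigma_finite_measure_axioms p12, symmetric])
  also have "\<dots> = (\<integral>\<^sup>+\<omega>. emeasure lborel {z. ?nn \<omega> z} \<partial>M)"
  proof (intro nn_integral_cong)
    fix \<omega>
    have "{z. ?nn \<omega> z} = {z. near_X \<omega> I1 J z} \<inter> {z. near_X \<omega> I2 J z}"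
      by blast
    also have "\<dots> \<in> sets borel" by (intro sets.Int near_diff_sets)
    finally have "emeasure ?L {z. ?P1 z \<omega> \<and> ?P2 z \<omega>} = emeasure lborel {z. ?nn \<omega> z}"
      by (rule emeasure_lborel_translate[of "?nn \<omega>"])
    then show "emeasure ?L {z \<in> space ?L. ?P1 z \<omega> \<and> ?P2 z \<omega>} = emeasure lborel {z. ?nn \<omega> z}"
      by simp
  qed
  finally show ?thesis by (simp only: mult.commute[of _ V])
qed

end

section \<open>The scaling argument\<close>

text \<open>Inclusion-exclusion is applied to the single pair \<open>p\<close>, \<open>q\<close> and
  plain subadditivity to the rest: the slack of a covering is at least any one pairwise
  intersection.\<close>

lemma emeasure_overlap_le:
  assumes "finite S" "p \<in> S" "q \<in> S" "p \<noteq> q" and D: "\<And>i. i \<in> S \<Longrightarrow> D i \<in> sets N" and B: "B \<subseteq> (\<Union>i\<in>S. D i)"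
  shows "emeasure N B + emeasure N (D p \<inter> D q) \<le> (\<Sum>i\<in>S. emeasure N (D i))"
proof -
  let ?R = "S - {p} - {q}"
  have DR: "(\<Union>i\<in>?R. D i) \<in> sets N" using assms by (intro sets.finite_UN) auto
  have "emeasure N B \<le> emeasure N ((D p \<union> D q) \<union> (\<Union>i\<in>?R. D i))"
    using assms DR by (intro emeasure_mono sets.Un) auto
  also have "\<dots> \<le> emeasure N (D p \<union> D q) + emeasure N (\<Union>i\<in>?R. D i)"
    using assms DR by (intro emeasure_subadditive) auto
  also have "\<dots> \<le> emeasure N (D p \<union> D q) + (\<Sum>i\<in>?R. emeasure N (D i))"
    using assms by (intro add_left_mono emeasure_subadditive_finite) auto
  finally have "emeasure N B + emeasure N (D p \<inter> D q) \<le> (emeasure N (D p \<union> D q) + emeasure N (D p \<inter> D q)) + (\<Sum>i\<in>?R. emeasure N (D i))"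
    by (simp add: add.assoc add.commute add.left_commute add_right_mono)
  also have "emeasure N (D p \<union> D q) + emeasure N (D p \<inter> D q) = emeasure N (D p) + emeasure N (D q)"
    using assms by (intro emeasure_Un_Int[symmetric]) auto
  also have "emeasure N (D p) + emeasure N (D q) + (\<Sum>i\<in>?R. emeasure N (D i)) = (\<Sum>i\<in>S. emeasure N (D i))"
    using sum.remove[OF assms(1,2), of "\<lambda>i. emeasure N (D i)"] sum.remove[of "S - {p}" q "\<lambda>i. emeasure N (D i)"] assms
    by (simp add: add.assoc)
  finally show ?thesis .
qed

lemma unit_interval_cover:
  assumes "0 < N" "s \<in> {c..c + real N}"
  shows "\<exists>i<N. s \<in> {c + real i..c + real i + 1}"
proof (cases "s = c + real N")
  \<comment> \<open>At the right end the floor would give the index \<open>N\<close>, so this point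
    is assigned to the last interval.\<close>
  case True
  then show ?thesis using assms by (intro exI[of _ "N - 1"]) (auto simp: of_nat_diff)
next
  case False
  define i where "i = nat \<lfloor>s - c\<rfloor>"
  have i: "real i = of_int \<lfloor>s - c\<rfloor>" using assms by (simp add: i_def)
  have "real i \<le> s - c" "s - c < real i + 1" unfolding i by linarith+
  moreover have "s - c < real N" using False assms by auto
  ultimately have "real i < real N" by linarith
  then show ?thesis using \<open>real i \<le> s - c\<close> \<open>s - c < real i + 1\<close> by (intro exI[of _ i]) auto
qed

context critical_fbm
begin

definition unit_mean :: "nat \<Rightarrow> ennreal" where
  "unit_mean K = mean_range {0..1} {real K..real K + 1}"

lemma unit_mean_eq: "i \<le> c \<Longrightarrow> mean_range {real i..real i + 1} {real c..real c + 1} = unit_mean (c - i)"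
  using mean_range_shift[of "real i" 0 1 "real (c - i)" "real (c - i) + 1"]
  by (simp add: unit_mean_def of_nat_diff algebra_simps)

lemma overlap_mean_le:
  fixes N K :: nat
  defines "D \<equiv> \<lambda>p \<omega>. {z. near_X \<omega> {real (fst p)..real (fst p) + 1} {real (N * K + snd p)..real (N * K + snd p) + 1} z}"
  assumes N: "0 < N" and K: "1 \<le> K" and pq: "p \<in> {..<N} \<times> {..<N}" "q \<in> {..<N} \<times> {..<N}" "p \<noteq> q"
  shows "ennreal ((real N)\<^sup>2) * unit_mean K + (\<integral>\<^sup>+\<omega>. emeasure lborel (D p \<omega> \<inter> D q \<omega>) \<partial>M) \<le>
    (\<Sum>r\<in>{..<N} \<times> {..<N}. unit_mean (N * K + snd r - fst r))"
proof -
  let ?S = "{..<N} \<times> {..<N}"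
  \<comment> \<open>Since \<open>1 \<le> K\<close>, the second interval never starts before the
    first one, and the natural-number difference in \<open>unit_mean (N * K + snd r - fst r)\<close>
    is not truncated.\<close>
  have le: "fst r \<le> N * K + snd r" if "r \<in> ?S" for r
  proof -
    have "fst r \<le> N * 1" using that by auto
    also have "\<dots> \<le> N * K" using K by (intro mult_le_mono2)
    finally show ?thesis by simp
  qed
  define B where "B \<omega> = {z. near_X \<omega> {real N * 0..real N * 1} {real N * real K..real N * (real K + 1)} z}" for \<omega>
  have pred: "Measurable.pred (M \<Otimes>\<^sub>M lborel) (\<lambda>p. near_diff (\<lambda>t. X t (fst p)) I J (snd p))" if "I \<subseteq> {0..}" "J \<subseteq> {0..}" for I J
    by (rule measurable_near_diff_X[OF that]) auto
  have Bm: "(\<lambda>\<omega>. emeasure lborel (B \<omega>)) \<in> borel_measurable M"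
    unfolding B_def by (intro nn_integral_emeasure_eq(1) pred) auto
  have DDm: "(\<lambda>\<omega>. emeasure lborel (D p \<omega> \<inter> D q \<omega>)) \<in> borel_measurable M"
  proof -
    have "(\<lambda>\<omega>. emeasure lborel {z. near_X \<omega> {real (fst p)..real (fst p) + 1} {real (N * K + snd p)..real (N * K + snd p) + 1} z \<and>
      near_X \<omega> {real (fst q)..real (fst q) + 1} {real (N * K + snd q)..real (N * K + snd q) + 1} z}) \<in> borel_measurable M"
      by (intro nn_integral_emeasure_eq(1) pred_intros_logic pred) auto
    then show ?thesis by (simp only: D_def Collect_conj_eq)
  qed
  have "ennreal ((real N)\<^sup>2) * unit_mean K = (\<integral>\<^sup>+\<omega>. emeasure lborel (B \<omega>) \<partial>M)"
    unfolding unit_mean_def B_def mean_range_def[symmetric] using N by (intro mean_range_scale[symmetric]) auto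
  then have "ennreal ((real N)\<^sup>2) * unit_mean K + (\<integral>\<^sup>+\<omega>. emeasure lborel (D p \<omega> \<inter> D q \<omega>) \<partial>M) = (\<integral>\<^sup>+\<omega>. emeasure lborel (B \<omega>) + emeasure lborel (D p \<omega> \<inter> D q \<omega>) \<partial>M)"
    using nn_integral_add[OF Bm DDm] by simp
  also have "\<dots> \<le> (\<integral>\<^sup>+\<omega>. (\<Sum>r\<in>?S. emeasure lborel (D r \<omega>)) \<partial>M)"
  proof (intro nn_integral_mono emeasure_overlap_le pq)
    fix \<omega> assume \<omega>: "\<omega> \<in> space M"
    show "B \<omega> \<subseteq> (\<Union>r\<in>?S. D r \<omega>)"
    proof
      fix z assume "z \<in> B \<omega>"
      then obtain s t where s: "s \<in> {0..0 + real N}" and t: "t \<in> {real (N * K)..real (N * K) + real N}" and z: "X s \<omega> - X t \<omega> = z"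
        using near_diff_X_iff[OF \<omega>, of "real N * 0" "real N * 1" "real N * real K" "real N * (real K + 1)" z] N
        by (auto simp: B_def algebra_simps)
      obtain i where i: "i < N" "s \<in> {real i..real i + 1}" using unit_interval_cover[OF N s] by auto
      obtain j where j: "j < N" "t \<in> {real (N * K + j)..real (N * K + j) + 1}" using unit_interval_cover[OF N t] by auto
      have "z \<in> D (i, j) \<omega>"
      proof -
        have "\<exists>s\<in>{real i..real i + 1}. \<exists>t\<in>{real (N * K + j)..real (N * K + j) + 1}. X s \<omega> - X t \<omega> = z"
          using i(2) j(2) z by blast
        then have "near_X \<omega> {real i..real i + 1} {real (N * K + j)..real (N * K + j) + 1} z"
          by (subst near_diff_X_iff[OF \<omega>]) auto
        then show ?thesis by (simp only: D_def mem_Collect_eq fst_conv snd_conv)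
      qed
      then show "z \<in> (\<Union>r\<in>?S. D r \<omega>)" using i j by blast
    qed
  qed (auto simp: D_def near_diff_sets)
  also have "\<dots> = (\<Sum>r\<in>?S. \<integral>\<^sup>+\<omega>. emeasure lborel (D r \<omega>) \<partial>M)"
    unfolding D_def by (intro nn_integral_sum nn_integral_emeasure_eq(1) pred) auto
  also have "\<dots> = (\<Sum>r\<in>?S. unit_mean (N * K + snd r - fst r))"
    unfolding D_def mean_range_def[symmetric] using le by (intro sum.cong refl unit_mean_eq)
  finally show ?thesis .
qed

text \<open>After adding \<open>X y\<close> the differences depend on the increment from time 0 to
  \<open>u\<close> and on the two oscillations, all with moments bounded uniformly in
  \<open>y\<close>. Hence one radius loses at most \<eta> of the mean volume for every position of
  the second interval.\<close>

lemma mean_range_le_local: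
  assumes \<eta>: "0 < \<eta>"
  obtains R :: real where "0 \<le> R" and "\<And>u y. 0 < u \<Longrightarrow> u \<le> B \<Longrightarrow> 0 \<le> y \<Longrightarrow>
    mean_range {u..u+1} {y..y+1} \<le> (\<integral>\<^sup>+\<omega>. emeasure lborel (local_range {u..u+1} {y..y+1} y R \<omega>) \<partial>M) + ennreal \<eta>"
proof -
  let ?p = "2 * CARD('n)"
  have p0: "0 < ?p" by simp
  obtain C where C: "0 \<le> C" and osc: "\<And>x. 0 \<le> x \<Longrightarrow> \<exists>U. osc_bound C x U"
    using oscillation_moment by blast
  obtain C2 where C2: "0 \<le> C2" and sec: "\<And>a c. 0 \<le> a \<Longrightarrow> 0 \<le> c \<Longrightarrow> (\<integral>\<^sup>+\<omega>. (range_size \<omega> {a..a+1} {c..c+1})\<^sup>2 \<partial>M) \<le> ennreal C2"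
    using second_moment_range by blast
  define m where "m = enn2real (\<integral>\<^sup>+\<omega>. ennreal (norm (X 1 \<omega>) ^ ?p) \<partial>M)"
  have m: "(\<integral>\<^sup>+\<omega>. ennreal (norm (X 1 \<omega>) ^ ?p) \<partial>M) = ennreal m" "0 \<le> m"
    using norm_1_moment_finite[of "CARD('n)"] by (auto simp: m_def less_top)
  define E where "E = B ^ 4 * m + C + C"
  \<comment> \<open>\<theta> is chosen first, to make \<theta> times the second moment of the volume
    at most half of \<eta>; the threshold \<open>T\<close> follows, to make the mean of
    \<open>W / (\<theta> * T)\<close> at most the other half. The summands 1 keep the quotients well
    behaved when \<open>C2\<close> or \<open>E\<close> is 0.\<close>
  define \<theta> where "\<theta> = \<eta> / (2 * (C2 + 1))"
  have \<theta>: "0 < \<theta>" "\<theta> * C2 \<le> \<eta> / 2"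
  proof -
    show "0 < \<theta>" using \<eta> C2 by (simp add: \<theta>_def)
    have "\<theta> * C2 \<le> \<theta> * (C2 + 1)" using \<open>0 < \<theta>\<close> by (intro mult_left_mono) auto
    also have "\<dots> = \<eta> / 2" using C2 by (simp add: \<theta>_def field_simps)
    finally show "\<theta> * C2 \<le> \<eta> / 2" .
  qed
  define T where "T = 2 * (\<bar>E\<bar> + 1) / (\<theta> * \<eta>)"
  have T0: "0 < T" using \<theta> \<eta> by (simp add: T_def)
  have TE: "1 / (\<theta> * T) * \<bar>E\<bar> \<le> \<eta> / 2"
  proof -
    have "\<theta> * T = 2 * (\<bar>E\<bar> + 1) / \<eta>" using \<theta> by (simp add: T_def)
    then have "1 / (\<theta> * T) * \<bar>E\<bar> = \<eta> / 2 * (\<bar>E\<bar> / (\<bar>E\<bar> + 1))" by simp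
    also have "\<dots> \<le> \<eta> / 2 * 1" using \<eta> by (intro mult_left_mono) auto
    finally show ?thesis by simp
  qed
  define \<tau> where "\<tau> = root ?p T"
  show ?thesis
  proof (rule that[of "3 * \<tau>"])
    show "0 \<le> 3 * \<tau>" using T0 by (simp add: \<tau>_def)
    fix u y :: real assume u: "0 < u" "u \<le> B" and y: "0 \<le> y"
    let ?I = "{u..u+1}"
    let ?J = "{y..y+1}"
    obtain U1 where "osc_bound C u U1" using osc[of u] u by auto
    note U1[measurable] = osc_boundD(1)[OF this] and U1C = osc_boundD(2)[OF this] and U1b = osc_boundD(3)[OF this]
    obtain U2 where "osc_bound C y U2" using osc[OF y] by blast
    note U2[measurable] = osc_boundD(1)[OF this] and U2C = osc_boundD(2)[OF this] and U2b = osc_boundD(3)[OF this]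
    define U0 where "U0 \<omega> = ennreal (norm (X u \<omega> - X 0 \<omega>) ^ ?p)" for \<omega>
    have [measurable]: "X u \<in> borel_measurable M" "X 0 \<in> borel_measurable M" "X y \<in> borel_measurable M" using u y by (auto intro: measurable_X)
    have [measurable]: "U0 \<in> borel_measurable M" unfolding U0_def by measurable
    have U0C: "(\<integral>\<^sup>+\<omega>. U0 \<omega> \<partial>M) \<le> ennreal (B ^ 4 * m)"
    proof -
      have "(\<integral>\<^sup>+\<omega>. U0 \<omega> \<partial>M) = ennreal (u ^ 4 * m)"
        unfolding U0_def increment_norm_moment[OF order_refl u(1)] m(1) using u m(2) by (simp add: powr_H_dim ennreal_mult)
      also have "\<dots> \<le> ennreal (B ^ 4 * m)" using u m by (intro ennreal_leI mult_right_mono power_mono) auto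
      finally show ?thesis .
    qed
    define W where "W \<omega> = U0 \<omega> + U1 \<omega> + U2 \<omega>" for \<omega>
    have [measurable]: "W \<in> borel_measurable M" unfolding W_def by measurable
    have WE: "(\<integral>\<^sup>+\<omega>. W \<omega> \<partial>M) \<le> ennreal E"
    proof -
      have "(\<integral>\<^sup>+\<omega>. W \<omega> \<partial>M) = (\<integral>\<^sup>+\<omega>. U0 \<omega> \<partial>M) + (\<integral>\<^sup>+\<omega>. U1 \<omega> \<partial>M) + (\<integral>\<^sup>+\<omega>. U2 \<omega> \<partial>M)"
        unfolding W_def by (simp add: nn_integral_add)
      also have "\<dots> \<le> ennreal (B ^ 4 * m) + ennreal C + ennreal C" by (intro add_mono U0C U1C U2C)
      also have "\<dots> = ennreal E"
      proof -
        have b: "0 \<le> B ^ 4 * m" using u m by simp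
        show ?thesis by (simp only: E_def ennreal_plus[OF add_nonneg_nonneg[OF b C] C] ennreal_plus[OF b C])
      qed
      finally show ?thesis .
    qed
    let ?L = "\<lambda>\<omega>. range_size \<omega> ?I ?J"
    let ?l = "\<lambda>\<omega>. emeasure lborel (local_range ?I ?J y (3 * \<tau>) \<omega>)"
    have pt: "?L \<omega> \<le> ?l \<omega> + ennreal \<theta> * (?L \<omega>)\<^sup>2 + ennreal (1 / (\<theta> * T)) * W \<omega>" if \<omega>: "\<omega> \<in> space M" "X 0 \<omega> = 0" for \<omega>
    proof (cases "W \<omega> \<le> ennreal T")
      case True
      have small: "norm x \<le> \<tau>" if "ennreal (norm x ^ ?p) \<le> ennreal T" for x :: "real ^ 'n"
      proof -
        have "norm x ^ ?p \<le> T" using that T0 by simp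
        then have "root ?p (norm x ^ ?p) \<le> \<tau>" unfolding \<tau>_def using p0 by (intro real_root_le_mono)
        then show ?thesis using p0 by (simp add: real_root_power_cancel)
      qed
      have W: "U0 \<omega> \<le> ennreal T" "U1 \<omega> \<le> ennreal T" "U2 \<omega> \<le> ennreal T"
      proof -
        have "U0 \<omega> \<le> W \<omega>" "U1 \<omega> \<le> W \<omega>" "U2 \<omega> \<le> W \<omega>" by (simp_all add: W_def add_increasing2 add_increasing)
        then show "U0 \<omega> \<le> ennreal T" "U1 \<omega> \<le> ennreal T" "U2 \<omega> \<le> ennreal T" using True by (auto intro: order_trans)
      qed
      have "near_X \<omega> ?I ?J (z - X y \<omega>) \<Longrightarrow> norm z \<le> 3 * \<tau>" for z
      proof -
        assume "near_X \<omega> ?I ?J (z - X y \<omega>)"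
        then obtain s t where st: "s \<in> ?I" "t \<in> ?J" "X s \<omega> - X t \<omega> = z - X y \<omega>"
          using near_diff_X_iff[OF \<omega>(1), of u "u+1" y "y+1"] u y by auto
        have "z = (X s \<omega> - X u \<omega>) + (X u \<omega> - X 0 \<omega>) - (X t \<omega> - X y \<omega>)" using st(3) \<omega>(2) by (simp add: algebra_simps)
        then have "norm z \<le> norm (X s \<omega> - X u \<omega>) + norm (X u \<omega> - X 0 \<omega>) + norm (X t \<omega> - X y \<omega>)"
          by (metis norm_triangle_ineq norm_triangle_ineq4 order_trans add_right_mono)
        also have "\<dots> \<le> \<tau> + \<tau> + \<tau>"
          using order_trans[OF U1b[OF \<omega>(1) st(1)] W(2)] order_trans[OF U2b[OF \<omega>(1) st(2)] W(3)] W(1)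
          by (intro add_mono small) (auto simp: U0_def)
        finally show ?thesis by simp
      qed
      then have "local_range ?I ?J y (3 * \<tau>) \<omega> = {z. near_X \<omega> ?I ?J (z - X y \<omega>)}"
        by (auto simp: local_range_def)
      then have "?l \<omega> = ?L \<omega>"
        using emeasure_lborel_translate[OF near_diff_sets, of "\<lambda>t. X t \<omega>" "?I" "?J" "X y \<omega>"] by simp
      then show ?thesis by (simp add: add.assoc add_increasing2)
    next
      case False
      \<comment> \<open>If x exceeds 1 / \<theta>, then x is at most
        \<open>\<theta> * x\<^sup>2\<close>. The remaining constant 1 / \<theta> is then charged to
        \<open>W\<close>, which exceeds \<open>T\<close> in this case.\<close>
      have "?L \<omega> \<le> ennreal \<theta> * (?L \<omega>)\<^sup>2 + ennreal (1 / \<theta>)"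
      proof (cases "?L \<omega>")
        case (real x)
        have "x \<le> \<theta> * x\<^sup>2 + 1 / \<theta>"
        proof (cases "x \<le> 1 / \<theta>")
          case True then show ?thesis using \<theta> by (simp add: add_increasing)
        next
          case f: False
          then have "1 \<le> \<theta> * x" using \<theta> by (simp add: field_simps)
          then have "1 * x \<le> (\<theta> * x) * x" using real by (intro mult_right_mono) auto
          also have "\<dots> \<le> \<theta> * x\<^sup>2 + 1 / \<theta>" using \<theta> by (simp add: power2_eq_square)
          finally show ?thesis by simp
        qed
        then have "ennreal x \<le> ennreal (\<theta> * x\<^sup>2 + 1 / \<theta>)" by (rule ennreal_leI)
        then show ?thesis using real \<theta> by (simp add: ennreal_power ennreal_mult)
      next
        case top
        then show ?thesis using \<theta> by (simp add: power2_eq_square ennreal_mult_top)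
      qed
      also have "ennreal (1 / \<theta>) \<le> ennreal (1 / (\<theta> * T)) * W \<omega>"
      proof -
        have "ennreal (1 / \<theta>) = ennreal (1 / (\<theta> * T)) * ennreal T" using T0 \<theta> by (simp add: ennreal_mult[symmetric])
        also have "\<dots> \<le> ennreal (1 / (\<theta> * T)) * W \<omega>" using False by (intro mult_left_mono) auto
        finally show ?thesis .
      qed
      finally have "?L \<omega> \<le> ennreal \<theta> * (?L \<omega>)\<^sup>2 + ennreal (1 / (\<theta> * T)) * W \<omega>" by (simp add: add_left_mono)
      then show ?thesis by (simp add: add.assoc add_increasing)
    qed
    have Lm[measurable]: "?L \<in> borel_measurable M"
      using u y by (intro nn_integral_emeasure_eq(1) measurable_near_diff_X) auto
    have lm[measurable]: "?l \<in> borel_measurable M"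
      using u y by (intro measurable_local_range) auto
    let ?El = "\<integral>\<^sup>+\<omega>. ?l \<omega> \<partial>M"
    have "mean_range ?I ?J = (\<integral>\<^sup>+\<omega>. ?L \<omega> \<partial>M)" by (simp add: mean_range_def)
    also have "\<dots> \<le> (\<integral>\<^sup>+\<omega>. ?l \<omega> + ennreal \<theta> * (?L \<omega>)\<^sup>2 + ennreal (1 / (\<theta> * T)) * W \<omega> \<partial>M)"
      by (rule nn_integral_mono_AE) (use start_zero AE_space in eventually_elim, use pt in auto)
    also have "\<dots> = ?El + ennreal \<theta> * (\<integral>\<^sup>+\<omega>. (?L \<omega>)\<^sup>2 \<partial>M) + ennreal (1 / (\<theta> * T)) * (\<integral>\<^sup>+\<omega>. W \<omega> \<partial>M)"
      by (subst nn_integral_add, measurable, subst nn_integral_add, measurable, subst nn_integral_cmult, measurable, subst nn_integral_cmult, measurable)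
    also have "\<dots> \<le> ?El + ennreal \<theta> * ennreal C2 + ennreal (1 / (\<theta> * T)) * ennreal E"
      using sec[of u y] u y WE by (intro add_mono mult_left_mono) auto
    also have "\<dots> \<le> ?El + ennreal (\<eta> / 2) + ennreal (\<eta> / 2)"
    proof (intro add_mono order_refl)
      show "ennreal \<theta> * ennreal C2 \<le> ennreal (\<eta> / 2)"
        using ennreal_leI[OF \<theta>(2)] \<theta>(1) C2 by (simp only: ennreal_mult less_imp_le)
      have "ennreal (1 / (\<theta> * T)) * ennreal E \<le> ennreal (1 / (\<theta> * T)) * ennreal \<bar>E\<bar>" by (intro mult_left_mono ennreal_leI) auto
      also have "\<dots> = ennreal (1 / (\<theta> * T) * \<bar>E\<bar>)" using \<theta> T0 by (intro ennreal_mult[symmetric]) auto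
      also have "\<dots> \<le> ennreal (\<eta> / 2)" using TE by (rule ennreal_leI)
      finally show "ennreal (1 / (\<theta> * T)) * ennreal E \<le> ennreal (\<eta> / 2)" .
    qed
    also have "\<dots> = ?El + ennreal \<eta>" using \<eta> by (simp add: add.assoc ennreal_plus[symmetric] del: ennreal_plus)
    finally show "mean_range ?I ?J \<le> ?El + ennreal \<eta>" .
  qed
qed

end

text \<open>The squared mean of the sum is at most its second moment, in which the diagonal grows
  linearly in \<open>k\<close> and the mixed terms contribute at most \<open>e\<close> each. For
  large \<open>k\<close> and small \<open>e\<close> this forces \<open>a\<close> to be
  small.\<close>

lemma (in prob_space) second_moment_sum:
  fixes f :: "nat \<Rightarrow> 'a \<Rightarrow> real"
  assumes f[measurable]: "\<And>i. i < k \<Longrightarrow> f i \<in> borel_measurable M" and b: "\<And>i x. i < k \<Longrightarrow> \<bar>f i x\<bar> \<le> V"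
    and lo: "\<And>i. i < k \<Longrightarrow> a \<le> expectation (f i)" and a: "0 \<le> a"
    and sq: "\<And>i. i < k \<Longrightarrow> expectation (\<lambda>x. f i x * f i x) \<le> C"
    and pr: "\<And>i j. i < k \<Longrightarrow> j < k \<Longrightarrow> i \<noteq> j \<Longrightarrow> expectation (\<lambda>x. f i x * f j x) \<le> e" and e: "0 \<le> e"
  shows "(real k * a)\<^sup>2 \<le> real k * C + (real k)\<^sup>2 * e"
proof -
  have i1: "integrable M (f i)" if "i < k" for i
    using that b by (intro integrable_const_bound[where B=V]) auto
  have i2: "integrable M (\<lambda>x. f i x * f j x)" if "i < k" "j < k" for i j
  proof (rule integrable_const_bound[where B="V * V"])
    show "AE x in M. norm (f i x * f j x) \<le> V * V"
      using b[OF that(1)] b[OF that(2)] by (auto simp: abs_mult intro!: mult_mono order_trans[OF abs_ge_zero b[OF that(1)]])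
  qed (use that in auto)
  let ?F = "\<lambda>x. \<Sum>i<k. f i x"
  have sqF: "(?F x)\<^sup>2 = (\<Sum>i<k. \<Sum>j<k. f i x * f j x)" for x by (simp add: power2_eq_square sum_product)
  have iF: "integrable M ?F" using i1 by auto
  have iF2: "integrable M (\<lambda>x. (?F x)\<^sup>2)" unfolding sqF by (intro Bochner_Integration.integrable_sum i2) auto
  have "(real k * a)\<^sup>2 \<le> (expectation ?F)\<^sup>2"
  proof (rule power_mono)
    have "real k * a = (\<Sum>i<k. a)" by simp
    also have "\<dots> \<le> (\<Sum>i<k. expectation (f i))" using lo by (intro sum_mono) auto
    also have "\<dots> = expectation ?F" using i1 by (intro Bochner_Integration.integral_sum[symmetric]) auto
    finally show "real k * a \<le> expectation ?F" .
  qed (use a in auto)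
  also have "\<dots> \<le> expectation (\<lambda>x. (?F x)\<^sup>2)"
    using variance_eq[OF iF iF2] variance_positive[of ?F] by linarith
  also have "\<dots> = (\<Sum>i<k. \<Sum>j<k. expectation (\<lambda>x. f i x * f j x))"
  proof -
    have "expectation (\<lambda>x. \<Sum>i<k. \<Sum>j<k. f i x * f j x) = (\<Sum>i<k. expectation (\<lambda>x. \<Sum>j<k. f i x * f j x))"
      by (intro Bochner_Integration.integral_sum Bochner_Integration.integrable_sum i2) auto
    also have "\<dots> = (\<Sum>i<k. \<Sum>j<k. expectation (\<lambda>x. f i x * f j x))"
      by (intro sum.cong refl Bochner_Integration.integral_sum i2) auto
    finally show ?thesis by (simp only: sqF)
  qed
  also have "\<dots> \<le> (\<Sum>i<k. \<Sum>j<k. (if j = i then C else 0) + e)"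
  proof (intro sum_mono)
    fix i j assume "i \<in> {..<k}" "j \<in> {..<k}"
    then show "expectation (\<lambda>x. f i x * f j x) \<le> (if j = i then C else 0) + e"
      using sq[of i] pr[of i j] e by (cases "j = i") auto
  qed
  also have "\<dots> = real k * C + (real k)\<^sup>2 * e"
    by (simp add: sum.distrib power2_eq_square algebra_simps)
  finally show ?thesis .
qed

section \<open>Vanishing of the mean volumes\<close>

context critical_fbm
begin

lemma unit_mean_bounded:
  obtains C :: real where "\<And>K. unit_mean K \<le> ennreal C"
proof -
  obtain C2 where C2: "0 \<le> C2" and sec: "\<And>a c. 0 \<le> a \<Longrightarrow> 0 \<le> c \<Longrightarrow> (\<integral>\<^sup>+\<omega>. (range_size \<omega> {a..a+1} {c..c+1})\<^sup>2 \<partial>M) \<le> ennreal C2"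
    using second_moment_range by blast
  show ?thesis
  proof (rule that[of "1 + C2"])
    fix K
    let ?L = "\<lambda>\<omega>. range_size \<omega> {0..1} {real K..real K + 1}"
    have [measurable]: "?L \<in> borel_measurable M"
      by (intro nn_integral_emeasure_eq(1) measurable_near_diff_X) auto
    have "x \<le> 1 + x\<^sup>2" for x :: ennreal
    proof (cases "x \<le> 1")
      case True then show ?thesis by (simp add: add_increasing2)
    next
      case False
      then have "1 * x \<le> x * x" by (intro mult_right_mono) auto
      then show ?thesis by (simp add: power2_eq_square add_increasing)
    qed
    then have "unit_mean K \<le> (\<integral>\<^sup>+\<omega>. 1 + (?L \<omega>)\<^sup>2 \<partial>M)"
      unfolding unit_mean_def mean_range_def by (intro nn_integral_mono)
    also have "\<dots> = 1 + (\<integral>\<^sup>+\<omega>. (?L \<omega>)\<^sup>2 \<partial>M)"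
      by (subst nn_integral_add) (auto simp: emeasure_space_1)
    also have "\<dots> \<le> 1 + ennreal C2" using sec[of 0 "real K"] by (intro add_left_mono) simp
    also have "\<dots> = ennreal (1 + C2)" using C2 by simp
    finally show "unit_mean K \<le> ennreal (1 + C2)" .
  qed
qed

lemma unit_mean_eq_0: "2 \<le> K0 \<Longrightarrow> unit_mean K0 = 0"
proof -
  assume K0: "2 \<le> K0"
  obtain C0 where C0: "\<And>K. unit_mean K \<le> ennreal C0" using unit_mean_bounded by blast
  define \<alpha> where "\<alpha> K = enn2real (unit_mean K)" for K
  have \<alpha>: "unit_mean K = ennreal (\<alpha> K)" "0 \<le> \<alpha> K" for K
    using le_less_trans[OF C0[of K] ennreal_less_top] by (simp_all add: \<alpha>_def)
  have bdd: "bdd_above (\<alpha> ` {2..})"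
  proof (rule bdd_aboveI2[where M="\<bar>C0\<bar>"])
    fix K
    have "ennreal (\<alpha> K) \<le> ennreal \<bar>C0\<bar>" using C0[of K] \<alpha>(1)[of K] order_trans[OF _ ennreal_leI[OF abs_ge_self]] by simp
    then show "\<alpha> K \<le> \<bar>C0\<bar>" by simp
  qed
  \<comment> \<open>The range \<open>2 \<le> K\<close> is stable under the blow-up: every unit
    square in the block of such a \<open>K\<close> again has index at least 2, so A bounds all the
    terms of the covering.\<close>
  define A where "A = (SUP K\<in>{2..}. \<alpha> K)"
  have \<alpha>A: "\<alpha> K \<le> A" if "2 \<le> K" for K unfolding A_def using that by (intro cSUP_upper bdd) auto
  show "unit_mean K0 = 0"
  proof (rule ccontr)
    assume "unit_mean K0 \<noteq> 0"
    then have "0 < \<alpha> K0" using \<alpha>[of K0] by (auto simp: less_le)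
    then have A0: "0 < A" using \<alpha>A[OF K0] by linarith
    obtain C2 where C2: "0 \<le> C2" and sec: "\<And>a c. 0 \<le> a \<Longrightarrow> 0 \<le> c \<Longrightarrow> (\<integral>\<^sup>+\<omega>. (range_size \<omega> {a..a+1} {c..c+1})\<^sup>2 \<partial>M) \<le> ennreal C2"
      using second_moment_range by blast
    \<comment> \<open>Chosen so that \<open>(real k * (A / 2))\<^sup>2\<close> is 4 times
      \<open>(real k)\<^sup>2 * \<epsilon>\<close>. The final inequality leaves at most one such
      multiple for the mixed terms and, by the choice of \<open>k\<close>, less than one for the
      diagonal.\<close>
    define \<epsilon> where "\<epsilon> = A\<^sup>2 / 16"
    have \<epsilon>0: "0 < \<epsilon>" using A0 by (simp add: \<epsilon>_def)
    obtain k where k: "C2 < real k * \<epsilon>" using reals_Archimedean3[OF \<epsilon>0] by blast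
    have k0: "0 < k" using k C2 by (cases k) auto
    define N where "N = 4 * k + 1"
    let ?N2 = "(real N)\<^sup>2"
    have N0: "0 < real N" "0 < N" by (auto simp: N_def)
    obtain R where R0: "0 \<le> R" and R: "\<And>u y. 0 < u \<Longrightarrow> u \<le> real N \<Longrightarrow> 0 \<le> y \<Longrightarrow>
        mean_range {u..u+1} {y..y+1} \<le> (\<integral>\<^sup>+\<omega>. emeasure lborel (local_range {u..u+1} {y..y+1} y R \<omega>) \<partial>M) + ennreal (A / 4)"
      using mean_range_le_local[of "A / 4" "real N"] A0 by auto
    define V where "V = measure lborel (cball 0 R :: (real ^ 'n) set)"
    have V: "emeasure lborel (cball 0 R :: (real ^ 'n) set) = ennreal V" "0 \<le> V"
      using emeasure_lborel_cball_finite[of "0 :: real ^ 'n" R] by (auto simp: V_def measure_def less_top)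
    define S where "S = 9 / (H * (1 - 2 * H)) * (2 * R)\<^sup>2 + 1"
    \<comment> \<open>Makes the shift error \<open>V * V * (l / 2 * exp S)\<close> at most half of
      \<epsilon>; the added 1 keeps the denominator positive.\<close>
    define l where "l = \<epsilon> / (V * V * exp S + 1)"
    have D0: "0 < V * V * exp S + 1" using V by (intro add_nonneg_pos) auto
    have l0: "0 < l" using \<epsilon>0 D0 by (simp add: l_def)
    have lV: "V * (V * (l / 2 * exp S)) \<le> \<epsilon> / 2"
    proof -
      have "V * (V * (l / 2 * exp S)) = l / 2 * (V * V * exp S)" by simp
      also have "\<dots> \<le> l / 2 * (V * V * exp S + 1)" using l0 by (intro mult_left_mono) auto
      also have "\<dots> = l * (V * V * exp S + 1) / 2" by simp
      also have "l * (V * V * exp S + 1) = \<epsilon>"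
        by (rule iffD1[OF nonzero_eq_divide_eq l_def]) (use D0 in simp)
      finally show ?thesis .
    qed
    \<comment> \<open>The defects of all \<open>N * N\<close> squares may add up, hence the
      division. The first entry of the minimum keeps each square above 3 A / 4; the second makes the
      main term at most half of \<epsilon> after multiplication by
      \<open>V / (2 * l)\<close>.\<close>
    define \<delta> where "\<delta> = min (A / 4) (\<epsilon> * l / (V + 1)) / ?N2"
    have \<delta>0: "0 < \<delta>" using A0 \<epsilon>0 l0 V N0 by (simp add: \<delta>_def add_nonneg_pos)
    have N\<delta>: "?N2 * \<delta> = min (A / 4) (\<epsilon> * l / (V + 1))" using N0 by (simp add: \<delta>_def)
    have \<delta>1: "?N2 * \<delta> \<le> A / 4" unfolding N\<delta> by (rule min.cobounded1)
    have \<delta>2: "V * (1 / (2 * l) * (?N2 * \<delta>)) \<le> \<epsilon> / 2"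
    proof -
      have "V * (1 / (2 * l) * (?N2 * \<delta>)) \<le> V * (1 / (2 * l) * (\<epsilon> * l / (V + 1)))"
        unfolding N\<delta> using V l0 by (intro mult_left_mono min.cobounded2) auto
      also have "\<dots> = \<epsilon> / 2 * (V / (V + 1))" using l0 by simp
      also have "\<dots> \<le> \<epsilon> / 2 * 1" using \<epsilon>0 V by (intro mult_left_mono) auto
      finally show ?thesis by simp
    qed
    have "A - \<delta> < A" using \<delta>0 by simp
    then obtain K where K: "2 \<le> K" "A - \<delta> < \<alpha> K"
      unfolding A_def using less_cSUP_iff[OF _ bdd, of "A - \<delta>"] unfolding A_def by auto
    let ?S = "{..<N} \<times> {..<N}"
    \<comment> \<open>The bump at \<open>4 * j + 3\<close> vanishes from distance 2 below its
      plateau's left end and from distance 2 above it, so spacing 4 frees all the other intervals.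
      The offset 3 meets the requirement \<open>3 \<le> u\<close>, and \<open>N = 4 * k + 1\<close>
      leaves room for all \<open>k\<close> intervals.\<close>
    let ?I = "\<lambda>i. {real (4 * i + 3)..real (4 * i + 3) + 1}"
    define y where "y = real (N * K)"
    let ?J = "{y..y + 1}"
    have NK: "2 * N \<le> N * K" using K by simp
    have idx: "2 \<le> N * K + snd r - fst r" if "r \<in> ?S" for r
    proof -
      have "fst r < N" using that by auto
      then show ?thesis using NK N0(2) by linarith
    qed
    have um: "unit_mean (N * K + snd r - fst r) \<le> ennreal A" if "r \<in> ?S" for r
      unfolding \<alpha>(1) using idx[OF that] by (intro ennreal_leI \<alpha>A)
    have inS: "(4 * i + 3, 0) \<in> ?S" if "i < k" for i using that by (auto simp: N_def)
    have cS: "card ?S = N * N" by simp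
    let ?O = "\<lambda>p q. \<integral>\<^sup>+\<omega>. emeasure lborel ({z. near_X \<omega> {real (fst p)..real (fst p) + 1} {real (N * K + snd p)..real (N * K + snd p) + 1} z} \<inter>
        {z. near_X \<omega> {real (fst q)..real (fst q) + 1} {real (N * K + snd q)..real (N * K + snd q) + 1} z}) \<partial>M"
    let ?T = "\<Sum>r\<in>?S. unit_mean (N * K + snd r - fst r)"
    let ?C = "cball 0 R :: (real ^ 'n) set"
    have ov: "ennreal (?N2) * unit_mean K + ?O p q \<le> ?T"
      if "p \<in> ?S" "q \<in> ?S" "p \<noteq> q" for p q
      using overlap_mean_le[OF N0(2) _ that, of K] K by simp
    have NA: "?N2 * A - ?N2 * \<alpha> K \<le> ?N2 * \<delta>"
    proof -
      have "?N2 * (A - \<alpha> K) \<le> ?N2 * \<delta>" using K by (intro mult_left_mono) auto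
      then show ?thesis by (simp add: algebra_simps)
    qed
    have overlap: "(\<integral>\<^sup>+\<omega>. emeasure lborel {z. near_X \<omega> (?I i) ?J z \<and> near_X \<omega> (?I j) ?J z} \<partial>M) \<le> ennreal (?N2 * \<delta>)"
      if ij: "i < k" "j < k" "i \<noteq> j" for i j
    proof -
      let ?o = "?O (4 * i + 3, 0) (4 * j + 3, 0)"
      have "ennreal (?N2) * unit_mean K + ?o \<le> ?T"
        using ij by (intro ov inS) auto
      also have "\<dots> \<le> (\<Sum>r\<in>?S. ennreal A)" by (intro sum_mono um)
      also have "\<dots> = ennreal (?N2 * A)"
        using A0 by (simp add: ennreal_mult ennreal_of_nat_eq_real_of_nat power2_eq_square)
      also have "ennreal (?N2) * unit_mean K = ennreal (?N2 * \<alpha> K)" using \<alpha>[of K] by (simp add: ennreal_mult)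
      finally have *: "ennreal (?N2 * \<alpha> K) + ?o \<le> ennreal (?N2 * A)" .
      have "?o \<le> ennreal (?N2 * A - ?N2 * \<alpha> K)"
      proof -
        have "?o = (ennreal (?N2 * \<alpha> K) + ?o) - ennreal (?N2 * \<alpha> K)" by simp
        also have "\<dots> \<le> ennreal (?N2 * A) - ennreal (?N2 * \<alpha> K)" by (rule ennreal_minus_mono[OF * order_refl])
        also have "\<dots> = ennreal (?N2 * A - ?N2 * \<alpha> K)" using \<alpha>[of K] by (intro ennreal_minus) auto
        finally show ?thesis .
      qed
      also have "\<dots> \<le> ennreal (?N2 * \<delta>)" using NA by (rule ennreal_leI)
      finally show ?thesis by (simp only: Collect_conj_eq y_def fst_conv snd_conv add_0_right)
    qed
    have low: "ennreal (3 * A / 4) \<le> mean_range (?I i) ?J" if i: "i < k" for i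
    proof -
      let ?p = "(4 * i + 3, 0 :: nat)"
      have p: "?p \<in> ?S" using inS[OF i] .
      \<comment> \<open>Any second square serves here, since its overlap with the first is dropped.
        The point is that a sum of terms at most A that is almost maximal cannot contain a term much
        below A.\<close>
      have q: "(0, 0) \<in> ?S" using N0 by auto
      let ?c = "N * K - (4 * i + 3)"
      have "ennreal (?N2) * unit_mean K \<le> ?T"
        by (rule order_trans[OF _ ov[OF p q]]) (simp_all add: add_increasing2)
      also have "\<dots> = unit_mean ?c + (\<Sum>r\<in>?S - {?p}. unit_mean (N * K + snd r - fst r))"
        using sum.remove[OF _ p, of "\<lambda>r. unit_mean (N * K + snd r - fst r)"] by simp
      also have "\<dots> \<le> unit_mean ?c + (\<Sum>r\<in>?S - {?p}. ennreal A)"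
        by (intro add_left_mono sum_mono um) auto
      also have "(\<Sum>r\<in>?S - {?p}. ennreal A) = of_nat (N * N - 1) * ennreal A"
        using p by (simp only: sum_constant card_Diff_singleton cS)
      also have "\<dots> = ennreal (real (N * N - 1) * A)"
        using A0 by (simp add: ennreal_mult ennreal_of_nat_eq_real_of_nat)
      finally have "ennreal (?N2 * \<alpha> K) \<le> ennreal (\<alpha> ?c + real (N * N - 1) * A)"
        using \<alpha>[of K] \<alpha>[of ?c] A0 by (simp add: ennreal_mult)
      then have "?N2 * \<alpha> K \<le> \<alpha> ?c + real (N * N - 1) * A"
        using \<alpha>(2)[of ?c] A0 by (subst (asm) ennreal_le_iff) auto
      also have "real (N * N - 1) * A = ?N2 * A - A"
        using N0 by (simp add: of_nat_diff power2_eq_square algebra_simps Suc_leI)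
      finally have "A - ?N2 * \<delta> \<le> \<alpha> ?c" using NA by linarith
      then have "3 * A / 4 \<le> \<alpha> ?c" using \<delta>1 by linarith
      then have "ennreal (3 * A / 4) \<le> unit_mean ?c" unfolding \<alpha>(1) by (rule ennreal_leI)
      also have "unit_mean ?c = mean_range (?I i) ?J"
        unfolding y_def using i NK by (intro unit_mean_eq[symmetric]) (auto simp: N_def)
      finally show ?thesis .
    qed
    define f where "f i \<omega> = measure lborel (local_range (?I i) ?J y R \<omega>)" for i \<omega>
    have lrV: "emeasure lborel (local_range (?I i) ?J y R \<omega>) \<le> ennreal V" for i \<omega>
      unfolding V(1)[symmetric] by (intro emeasure_mono) (auto simp: local_range_def)
    have fe: "emeasure lborel (local_range (?I i) ?J y R \<omega>) = ennreal (f i \<omega>)" for i \<omega>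
      unfolding f_def measure_def using le_less_trans[OF lrV ennreal_less_top] by (simp only: ennreal_enn2real)
    have f0: "0 \<le> f i \<omega>" for i \<omega> by (simp add: f_def)
    have fV: "\<bar>f i \<omega>\<bar> \<le> V" for i \<omega> using lrV[of i \<omega>] V f0 unfolding fe by simp
    have fm[measurable]: "f i \<in> borel_measurable M" for i
    proof -
      have [measurable]: "(\<lambda>\<omega>. emeasure lborel (local_range (?I i) ?J y R \<omega>)) \<in> borel_measurable M"
        by (intro measurable_local_range) (auto simp: y_def)
      show ?thesis unfolding f_def measure_def by measurable
    qed
    have intf: "expectation (\<lambda>\<omega>. g \<omega>) \<le> c" if "g \<in> borel_measurable M" "\<And>\<omega>. 0 \<le> g \<omega>" "(\<integral>\<^sup>+\<omega>. ennreal (g \<omega>) \<partial>M) \<le> ennreal c" "0 \<le> c" for g and c :: real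
      using that by (subst integral_eq_nn_integral) (auto intro: enn2real_leI)
    have y0: "0 \<le> y" by (simp add: y_def)
    have "(real k * (A / 2))\<^sup>2 \<le> real k * C2 + (real k)\<^sup>2 * \<epsilon>"
    proof (rule second_moment_sum[of k f V])
      show "\<bar>f i x\<bar> \<le> V" for i x by (rule fV)
      show "A / 2 \<le> expectation (f i)" if i: "i < k" for i
      proof -
        have "integrable M (f i)" using fV by (intro integrable_const_bound[where B=V]) auto
        then have "(\<integral>\<^sup>+\<omega>. ennreal (f i \<omega>) \<partial>M) = ennreal (expectation (f i))"
          using f0 by (intro nn_integral_eq_integral) auto
        moreover have "mean_range (?I i) ?J \<le> (\<integral>\<^sup>+\<omega>. ennreal (f i \<omega>) \<partial>M) + ennreal (A / 4)"
          unfolding fe[symmetric] using i by (intro R y0) (auto simp: N_def)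
        ultimately have "ennreal (3 * A / 4) \<le> ennreal (expectation (f i)) + ennreal (A / 4)" using order_trans[OF low[OF i]] by simp
        moreover have "0 \<le> expectation (f i)" using f0 by (intro integral_nonneg_AE) auto
        ultimately have "3 * A / 4 \<le> expectation (f i) + A / 4" using A0 by (simp add: ennreal_plus[symmetric] del: ennreal_plus)
        then show ?thesis by linarith
      qed
      show "expectation (\<lambda>x. f i x * f i x) \<le> C2" if i: "i < k" for i
      proof (rule intf)
        have "ennreal (f i \<omega> * f i \<omega>) \<le> (range_size \<omega> (?I i) ?J)\<^sup>2" for \<omega>
        proof -
          have tr: "emeasure lborel {z. near_X \<omega> (?I i) ?J (z - X y \<omega>)} = range_size \<omega> (?I i) ?J"
            by (rule emeasure_lborel_translate[OF near_diff_sets])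
          have "ennreal (f i \<omega>) \<le> range_size \<omega> (?I i) ?J"
            unfolding fe[symmetric] tr[symmetric]
            by (intro emeasure_mono) (auto simp: local_range_def near_diff_translate_sets)
          then have "ennreal (f i \<omega>) * ennreal (f i \<omega>) \<le> range_size \<omega> (?I i) ?J * range_size \<omega> (?I i) ?J"
            by (intro mult_mono) auto
          then show ?thesis using f0 by (simp add: ennreal_mult power2_eq_square)
        qed
        then have "(\<integral>\<^sup>+\<omega>. ennreal (f i \<omega> * f i \<omega>) \<partial>M) \<le> (\<integral>\<^sup>+\<omega>. (range_size \<omega> (?I i) ?J)\<^sup>2 \<partial>M)"
          by (intro nn_integral_mono)
        also have "\<dots> \<le> ennreal C2" by (intro sec y0) auto
        finally show "(\<integral>\<^sup>+\<omega>. ennreal (f i \<omega> * f i \<omega>) \<partial>M) \<le> ennreal C2" .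
      qed (use f0 C2 in auto)
      show "expectation (\<lambda>x. f i x * f j x) \<le> \<epsilon>" if ij: "i < k" "j < k" "i \<noteq> j" for i j
      proof (rule intf)
        have rat: "?I m \<inter> \<rat> \<noteq> {}" "?J \<inter> \<rat> \<noteq> {}" for m
        proof -
          have "real (4 * m + 3) \<in> ?I m \<inter> \<rat>" "y \<in> ?J \<inter> \<rat>" by (auto simp: y_def)
          then show "?I m \<inter> \<rat> \<noteq> {}" "?J \<inter> \<rat> \<noteq> {}" by blast+
        qed
        \<comment> \<open>Since \<open>2 \<le> K\<close>, the second interval, and with it the
          reference time \<open>y\<close>, lies beyond the support of every bump used.\<close>
        have yb: "real (4 * j + 3) + 2 \<le> y"
        proof -
          have "4 * j + 3 + 2 \<le> N * K" using NK ij by (simp add: N_def)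
          then have "real (4 * j + 3 + 2) \<le> real (N * K)" by (simp only: of_nat_le_iff)
          then show ?thesis by (simp add: y_def)
        qed
        have b0: "bump (real (4 * j + 3)) t = 0" if "t \<in> ?I i \<union> ?J \<union> {y}" for t
        proof (rule bump_0)
          have "t \<in> ?I i \<or> y \<le> t" using that by auto
          moreover have "i < j \<or> j < i" using ij(3) by (rule nat_neq_iff[THEN iffD1])
          ultimately consider "i < j" "t \<in> ?I i" | "j < i" "t \<in> ?I i" | "y \<le> t" by blast
          then show "t \<le> real (4 * j + 3) - 2 \<or> real (4 * j + 3) + 2 \<le> t"
          proof cases
            case 1
            then have "real (4 * i + 4) \<le> real (4 * j)" by (simp only: of_nat_le_iff)
            then show ?thesis using 1 by simp
          next
            case 2
            then have "real (4 * j + 4) \<le> real (4 * i)" by (simp only: of_nat_le_iff)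
            then show ?thesis using 2 by simp
          next
            case 3 then show ?thesis using yb by linarith
          qed
        qed
        \<comment> \<open>The mean overlap of the full sets is at most \<open>?N2 * \<delta>\<close>
          by near-extremality, so the decoupling bound leaves two halves of \<epsilon>: \<delta>
          pays for the overlap and \<open>l\<close> for the shift.\<close>
        have "(\<integral>\<^sup>+\<omega>. ennreal (f i \<omega> * f j \<omega>) \<partial>M) = (\<integral>\<^sup>+\<omega>. emeasure lborel (local_range (?I i) ?J y R \<omega>) * emeasure lborel (local_range (?I j) ?J y R \<omega>) \<partial>M)"
          unfolding fe using f0 by (simp add: ennreal_mult)
        also have "\<dots> \<le> emeasure lborel ?C * (ennreal (1 / (2 * l)) * (\<integral>\<^sup>+\<omega>. emeasure lborel {z. near_X \<omega> (?I i) ?J z \<and> near_X \<omega> (?I j) ?J z} \<partial>M)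
          + emeasure lborel ?C * ennreal (l / 2 * exp (9 / (H * (1 - 2 * H)) * (2 * R)\<^sup>2 + 1)))"
          by (rule local_range_product_bound[OF H_less _ l0 R0 _ _ _ y0 rat(1) rat(1) rat(2) b0 bump_1]) (use y0 in auto)
        also have "\<dots> \<le> ennreal V * (ennreal (1 / (2 * l)) * ennreal (?N2 * \<delta>) + ennreal V * ennreal (l / 2 * exp S))"
          unfolding V(1) S_def[symmetric] by (intro mult_left_mono add_mono overlap ij) auto
        also have "\<dots> = ennreal (V * (1 / (2 * l) * (?N2 * \<delta>) + V * (l / 2 * exp S)))"
        proof -
          let ?e = "1 / (2 * l) * (?N2 * \<delta>)" and ?b = "l / 2 * exp S"
          have p: "0 \<le> 1 / (2 * l)" "0 \<le> ?N2 * \<delta>" "0 \<le> l / 2 * exp S" using l0 \<delta>0 by auto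
          have "ennreal (V * (?e + V * ?b)) = ennreal V * ennreal (?e + V * ?b)"
            by (rule ennreal_mult[OF V(2) add_nonneg_nonneg[OF mult_nonneg_nonneg[OF p(1,2)] mult_nonneg_nonneg[OF V(2) p(3)]]])
          also have "ennreal (?e + V * ?b) = ennreal ?e + ennreal (V * ?b)"
            by (rule ennreal_plus[OF mult_nonneg_nonneg[OF p(1,2)] mult_nonneg_nonneg[OF V(2) p(3)]])
          also have "ennreal ?e = ennreal (1 / (2 * l)) * ennreal (?N2 * \<delta>)"
            by (rule ennreal_mult[OF p(1,2)])
          also have "ennreal (V * ?b) = ennreal V * ennreal ?b"
            by (rule ennreal_mult[OF V(2) p(3)])
          finally show ?thesis ..
        qed
        also have "\<dots> \<le> ennreal \<epsilon>"
          unfolding distrib_left[of V] using \<delta>2 lV by (intro ennreal_leI) linarith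
        finally show "(\<integral>\<^sup>+\<omega>. ennreal (f i \<omega> * f j \<omega>) \<partial>M) \<le> ennreal \<epsilon>" .
      qed (use f0 \<epsilon>0 in auto)
    qed (use A0 \<epsilon>0 in auto)
    moreover have "(real k * (A / 2))\<^sup>2 = 4 * ((real k)\<^sup>2 * \<epsilon>)" by (simp add: \<epsilon>_def power_mult_distrib power_divide)
    moreover have "real k * C2 < real k * (real k * \<epsilon>)" using k k0 by (intro mult_strict_left_mono) auto
    then have "real k * C2 < (real k)\<^sup>2 * \<epsilon>" by (simp add: power2_eq_square)
    moreover have "0 \<le> (real k)\<^sup>2 * \<epsilon>" using \<epsilon>0 by simp
    ultimately show False by linarith
  qed
qed

text \<open>A vanishing mean volume means that almost every fixed value is almost surely missed. One
  such \<open>z\<close> suffices: the shift by \<open>z\<close> carries the event of hitting 0 to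
  that of hitting \<open>z\<close>, whose probability is 0, and the error tends to 0 with
  \<open>l\<close>. The bump starts at time \<open>a\<close>; \<open>3 \<le> a\<close> keeps it away
  from time 0, and \<open>a + 2 \<le> c\<close> makes it vanish on the second interval.\<close>

lemma hit_zero_unit:
  fixes a c :: nat
  assumes ac: "3 \<le> a" "a + 2 \<le> c"
  shows "emeasure M {\<omega> \<in> space M. near_X \<omega> {real a..real a + 1} {real c..real c + 1} 0} = 0"
proof -
  let ?I = "{real a..real a + 1}" and ?J = "{real c..real c + 1}"
  have p: "Measurable.pred (M \<Otimes>\<^sub>M lborel) (\<lambda>p. near_diff (\<lambda>t. X t (fst p)) ?I ?J (snd p))"
    by (intro measurable_near_diff_X) auto
  have "(\<integral>\<^sup>+z. emeasure M {\<omega> \<in> space M. near_X \<omega> ?I ?J z} \<partial>lborel) = mean_range ?I ?J"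
    unfolding mean_range_def by (rule nn_integral_emeasure_eq(2)[OF p, symmetric])
  also have "\<dots> = unit_mean (c - a)" using ac by (intro unit_mean_eq) auto
  also have "\<dots> = 0" using ac by (intro unit_mean_eq_0) auto
  finally have "AE z in lborel. emeasure M {\<omega> \<in> space M. near_X \<omega> ?I ?J z} = 0"
    using nn_integral_0_iff_AE[OF nn_integral_emeasure_eq(3)[OF p]] by simp
  moreover have "ae_filter (lborel :: (real ^ 'n) measure) \<noteq> bot"
    by (simp add: ae_filter_eq_bot_iff)
  ultimately obtain z where z: "emeasure M {\<omega> \<in> space M. near_X \<omega> ?I ?J z} = 0"
    using eventually_happens' by blast
  define S where "S = 9 / (H * (1 - 2 * H)) * (norm z)\<^sup>2 + 1"
  have S: "0 < S" "9 / (H * (1 - 2 * H)) * (norm z)\<^sup>2 \<le> S"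
    unfolding S_def using H_less Hurst_parameter by (auto intro!: add_nonneg_pos)
  \<comment> \<open>The first condition of \<open>pair_shift_bound\<close> is made void by
    degenerate intervals and the target 0, leaving a bound for a single square.\<close>
  have triv: "near_X \<omega> {0} {0} 0" for \<omega> by (simp add: near_diff_def)
  have rat: "?I \<inter> \<rat> \<noteq> {}" "?J \<inter> \<rat> \<noteq> {}" "{0 :: real} \<inter> \<rat> \<noteq> {}"
  proof -
    have "real a \<in> ?I \<inter> \<rat>" "real c \<in> ?J \<inter> \<rat>" by auto
    then show "?I \<inter> \<rat> \<noteq> {}" "?J \<inter> \<rat> \<noteq> {}" by blast+
  qed auto
  have b0: "bump (real a) t = 0" if "t \<in> {0} \<union> {0} \<union> ?J \<union> {0}" for t
    using that ac by (intro bump_0) auto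
  let ?E = "emeasure M {\<omega> \<in> space M. near_X \<omega> ?I ?J 0}"
  have bound: "?E \<le> ennreal (l / 2 * exp S)" if l: "0 < l" for l
    using pair_shift_bound[OF H_less _ l S _ _ _ _ order_refl rat(3,3,1,2) b0 bump_1, where ?z1.0 = 0 and ?z2.0 = z and k = 0] ac
    by (simp add: triv z)
  have "?E \<le> 0"
  proof (rule ennreal_le_epsilon)
    fix e :: real assume e: "0 < e"
    have "?E \<le> ennreal (2 * e / exp S / 2 * exp S)" using e by (intro bound) auto
    then show "?E \<le> 0 + ennreal e" by simp
  qed
  then show ?thesis by simp
qed

text \<open>Countably many squares of side 1 / q cover all pairs s < t of positive times. Each keeps
  a gap of at least one cell from the diagonal and starts at the third cell or later, and scaling by
  1 / q reduces it to a unit square.\<close>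

theorem no_double_points:
  "{\<omega> \<in> space M. \<exists>s t. 0 < s \<and> 0 < t \<and> s \<noteq> t \<and> X s \<omega> = X t \<omega>} \<in> null_sets M" (is "?D \<in> _")
proof -
  let ?I = "\<lambda>q a. {1 / real q * real a..1 / real q * (real a + 1)}"
  define E where "E q a c = {\<omega> \<in> space M. near_X \<omega>
    (?I q a) (?I q c) 0}" for q a c :: nat
  define T where "T = {(q :: nat, a :: nat, c :: nat). 0 < q \<and> 3 \<le> a \<and> a + 2 \<le> c}"
  have null: "E q a c \<in> null_sets M" if "(q, a, c) \<in> T" for q a c
  proof (rule null_setsI)
    have qac: "0 < q" "3 \<le> a" "a + 2 \<le> c" using that by (auto simp: T_def)
    show "emeasure M (E q a c) = 0"
      unfolding E_def using qac by (subst hit_zero_scale) (auto simp: hit_zero_unit)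
    have "Measurable.pred M (\<lambda>\<omega>. near_X \<omega>
      (?I q a) (?I q c) 0)"
      using qac by (intro measurable_near_diff_X) (auto simp: subset_eq intro: order_trans[rotated])
    then show "E q a c \<in> sets M" unfolding E_def pred_def .
  qed
  have iff: "\<omega> \<in> E q a c \<longleftrightarrow> \<omega> \<in> space M \<and> (\<exists>s\<in>(?I q a). \<exists>t\<in>(?I q c). X s \<omega> = X t \<omega>)"
    if "0 < q" for q a c \<omega>
    unfolding E_def using near_diff_X_iff[of \<omega> "1 / real q * real a" "1 / real q * (real a + 1)" "1 / real q * real c" "1 / real q * (real c + 1)" 0] that
    by (auto simp: divide_strict_right_mono)
  have "?D = (\<Union>(q, a, c)\<in>T. E q a c)"
  proof (intro equalityI subsetI)
    fix \<omega> assume "\<omega> \<in> (\<Union>(q, a, c)\<in>T. E q a c)"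
    then obtain q a c where qac: "(q, a, c) \<in> T" and \<omega>: "\<omega> \<in> E q a c" by blast
    have q: "0 < q" "3 \<le> a" "a + 2 \<le> c" using qac by (auto simp: T_def)
    obtain s t where st: "1 / real q * real a \<le> s" "s \<le> 1 / real q * (real a + 1)" "1 / real q * real c \<le> t" "X s \<omega> = X t \<omega>" "\<omega> \<in> space M"
      using \<omega> unfolding iff[OF q(1)] by auto
    have "1 / real q * (real a + 1) < 1 / real q * real c" using q by (intro mult_strict_left_mono) auto
    moreover have "0 < 1 / real q * real a" using q by simp
    ultimately have "0 < s" "0 < t" "s \<noteq> t" using st by linarith+
    then show "\<omega> \<in> ?D" using st by blast
  next
    fix \<omega> assume "\<omega> \<in> ?D"
    then obtain s t where \<omega>: "\<omega> \<in> space M" and st: "0 < s" "s < t" "X s \<omega> = X t \<omega>"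
      by (auto elim!: linorder_neqE)
    \<comment> \<open>The factor 3 absorbs the floors: \<open>real q * s > 3\<close> gives
      \<open>a \<ge> 3\<close>, and a difference above 3 between \<open>real q * t\<close> and
      \<open>real q * s\<close> gives \<open>c \<ge> a + 2\<close>.\<close>
    obtain q :: nat where q: "max (3 / s) (3 / (t - s)) < real q" using reals_Archimedean2 by blast
    have "0 < 3 / s" using st by simp
    then have q0: "0 < real q" using q by linarith
    have qs: "3 < real q * s" "3 < real q * t - real q * s"
      using q st by (auto simp: field_simps)
    define a where "a = nat \<lfloor>real q * s\<rfloor>"
    define c where "c = nat \<lfloor>real q * t\<rfloor>"
    have ra: "real a = of_int \<lfloor>real q * s\<rfloor>" and rc: "real c = of_int \<lfloor>real q * t\<rfloor>"
      using qs by (auto simp: a_def c_def)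
    have a: "real a \<le> real q * s" "real q * s < real a + 1" unfolding ra by linarith+
    have c: "real c \<le> real q * t" "real q * t < real c + 1" unfolding rc by linarith+
    have "real 2 < real a" "real a + real 1 < real c" using a c qs by simp_all
    then have "(q, a, c) \<in> T" using q0 unfolding T_def of_nat_add[symmetric] of_nat_less_iff by auto
    moreover have "s \<in> (?I q a)" "t \<in> (?I q c)"
      using a c q0 by (auto simp: field_simps)
    then have "\<omega> \<in> E q a c" using iff[of q \<omega> a c] \<omega> st q0 by auto
    ultimately show "\<omega> \<in> (\<Union>(q, a, c)\<in>T. E q a c)" by blast
  qed
  moreover have "(\<Union>(q, a, c)\<in>T. E q a c) \<in> null_sets M"
    using null by (intro null_sets_UN') auto
  ultimately show ?thesis by simp
qed

end

theorem theorem2: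
  fixes M :: "'w measure" and H :: real and X :: "real \<Rightarrow> 'w \<Rightarrow> real ^ 'n"
  assumes "0 < H" and "H < 1 / 2"
    and "real CARD('n) = 2 / H"
    and "fractional_brownian_motion M H X"
  shows "{\<omega> \<in> space M. \<exists>s t. 0 < s \<and> 0 < t \<and> s \<noteq> t \<and> X s \<omega> = X t \<omega>} \<in> sets M \<and>
    measure M {\<omega> \<in> space M. \<exists>s t. 0 < s \<and> 0 < t \<and> s \<noteq> t \<and> X s \<omega> = X t \<omega>} = 0"
proof -
  interpret fractional_brownian_motion M H X by fact
  interpret critical_fbm M H X by unfold_locales (use assms in auto)
  show ?thesis using no_double_points by (auto simp: measure_eq_0_null_sets)
qed

end
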